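(* For $w,v\in\mathbb{R}^n$ define the following kernels. (a) For $n\ge 3$, $$K(w,v)=\int_{(\mathbb{R}^n)^n}\prod_{k=1}^n|x_k|^{-(n-1)}\Big[\Big|w-\sum_{k=1}^n x_k\Big|\,\Big|v-\sum_{k=1}^n x_k\Big|\Big]^{-(n-1)}\delta\Big[1+\sum_{k=1}^{n-1}|x_k|^2-|x_n|^2\Big]\,dx_1\cdots dx_n .$$ (b) For $n\ge3$, $n-1>\alpha>n-1-\frac2n$ and $\lambda=\frac{n(n-\alpha+1)}{2}-1$, $$K_{n,\alpha}(w,v)=\int_{(\mathbb{R}^n)^n}\prod_{k=1}^n|x_k|^{-\alpha}\Big[\Big|w-\sum_{k=1}^n x_k\Big|\,\Big|v-\sum_{k=1}^n x_k\Big|\Big]^{-\lambda}\delta\Big[1+\sum_{k=1}^{n-1}|x_k|^2-|x_n|^2\Big]\,dx_1\cdots dx_n .$$ (c) For $n\ge 2$ and $\frac{n-1}{2}<\alpha<n-1$, $$H_{n,\alpha}(w,v)=\int_{\mathbb{R}^n\times\mathbb{R}^n}|x|^{-\alpha}|y|^{-\alpha}\big[|w-x-y|\,|v-x-y|\big]^{-(\frac{3n}{2}-1-\alpha)}\,\delta\big(1+|x|^2-|y|^2\big)\,dx\,dy .$$ (d) For $n\ge2$, $$J(w,v)=\int_{\mathbb{R}^n\times\mathbb{R}^n\times\mathbb{R}^n}\big[|x|\,|y|\,|z|\big]^{-(n-1)}\big[|w-x-y-z|\,|v-x-y-z|\big]^{-(n+1)/2}\,\delta\big[1+|x|^2+|z|^2-|y|^2\big]\,dx\,dy\,dz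 .$$ Let $T$ be any one of the kernels $K$, $K_{n,\alpha}$, $H_{n,\alpha}$, $J$, with $n$ and $\alpha$ in the range indicated for it. Then there is a finite constant $c$ (depending only on the kernel, i.e. on $n$ and, where applicable, $\alpha$) such that for every non-negative $f\in L^2(\mathbb{R}^n)$ $$\int_{\mathbb{R}^n\times\mathbb{R}^n}f(w)\,T(w,v)\,f(v)\,dw\,dv\le c\int_{\mathbb{R}^n}|f|^2\,dx .$$
   Context: Here $|\cdot|$ is the Euclidean norm, and each $x_k$ (and $x,y,z$) ranges over $\mathbb{R}^n$. All integrals have nonnegative integrands and take values in $[0,\infty]$. Meaning of the delta function: it is the Dirac delta on $\mathbb{R}$ composed with a smooth function $F$ of the integration variables whose gradient does not vanish on $\{F=0\}$: $\int \delta[F(X)]\,g(X)\,dX=\int_{\{F=0\}} g\,\frac{d\mathcal{H}}{|\nabla F|}$, where $\mathcal{H}$ is the surface measure (Hausdorff measure of codimension one) on $\{F=0\}$. *)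

theory Defs
  imports "HOL-Analysis.Analysis"
begin

text \<open>
  The \<open>k\<close>-dimensional Hausdorff measure, normalised by the volume of the unit ball of
  dimension \<open>k\<close>, so that it is surface measure on smooth \<open>k\<close>-dimensional submanifolds.
  Empty members of a cover are given weight 0 explicitly, because \<open>0 ^ 0 = 1\<close>; the boundedness
  condition is needed because \<^const>\<open>diameter\<close> is only meaningful on bounded sets.
\<close>

definition hausdorff_premeasure :: "nat \<Rightarrow> real \<Rightarrow> 'a::metric_space set \<Rightarrow> ennreal" where
  "hausdorff_premeasure k \<delta> A =
     (INF C \<in> {C :: nat \<Rightarrow> 'a set. A \<subseteq> (\<Union>i. C i) \<and> (\<forall>i. bounded (C i) \<and> diameter (C i) \<le> \<delta>)}.
        \<Sum>i. if C i = {} then 0 else ennreal (unit_ball_vol (real k) * (diameter (C i) / 2) ^ k))"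

definition hausdorff_outer :: "nat \<Rightarrow> 'a::metric_space set \<Rightarrow> ennreal" where
  "hausdorff_outer k A = (SUP \<delta>\<in>{0<..}. hausdorff_premeasure k \<delta> A)"

text \<open>
  By Caratheodory's criterion for metric outer measures, \<open>hausdorff_outer k\<close> is countably
  additive on the Borel sets, so the following has it as its \<^const>\<open>emeasure\<close>.
\<close>

definition hausdorff_measure :: "nat \<Rightarrow> 'a::metric_space measure" where
  "hausdorff_measure k = measure_of UNIV (sets borel) (hausdorff_outer k)"

definition gradient :: "('a::euclidean_space \<Rightarrow> real) \<Rightarrow> 'a \<Rightarrow> 'a" where
  "gradient F X = (THE D. GDERIV F X :> D)"

text \<open>
  The integral of \<open>\<delta>[F(X)] g(X)\<close>, for smooth \<open>F\<close> whose gradient does not vanish on the zero set.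
\<close>

definition delta_integral :: "('a::euclidean_space \<Rightarrow> real) \<Rightarrow> ('a \<Rightarrow> ennreal) \<Rightarrow> ennreal" where
  "delta_integral F g =
     (\<integral>\<^sup>+X\<in>{X. F X = 0}. (g X / ennreal (norm (gradient F X))) \<partial>hausdorff_measure (DIM('a) - 1))"

text \<open>
  \<open>neg_pow r s\<close> is \<open>r\<close> to the power \<open>-s\<close> with values in \<open>[0,\<infinity>]\<close>, used for \<open>r \<ge> 0\<close> and \<open>s > 0\<close>.
  Its value at \<open>r = 0\<close> is \<open>\<infinity>\<close>, whereas \<open>0 powr (-s) = 0\<close>.
\<close>

definition neg_pow :: "real \<Rightarrow> real \<Rightarrow> ennreal" where
  "neg_pow r s = inverse (ennreal (r powr s))"

text \<open>
  A point of \<open>(\<real>\<^sup>n)\<^sup>n\<close> is \<open>X :: real^'n^'n\<close> with \<open>n = CARD('n)\<close>; the vectors \<open>x\<^sub>k\<close> are the \<open>X $ k\<close>.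
  The index type carries no order, so the index \<open>l\<close> of the vector that enters the
  delta function with a minus sign is a parameter.
\<close>

definition kernel_K :: "'n::finite \<Rightarrow> real^'n \<Rightarrow> real^'n \<Rightarrow> ennreal" where
  "kernel_K l w v =
     delta_integral
       (\<lambda>X :: real^'n^'n. 1 + (\<Sum>k\<in>UNIV - {l}. (norm (X $ k))\<^sup>2) - (norm (X $ l))\<^sup>2)
       (\<lambda>X. (\<Prod>k\<in>UNIV. neg_pow (norm (X $ k)) (real CARD('n) - 1)) *
            neg_pow (norm (w - (\<Sum>k\<in>UNIV. X $ k)) * norm (v - (\<Sum>k\<in>UNIV. X $ k)))
              (real CARD('n) - 1))"

definition kernel_K_alpha :: "real \<Rightarrow> 'n::finite \<Rightarrow> real^'n \<Rightarrow> real^'n \<Rightarrow> ennreal" where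
  "kernel_K_alpha \<alpha> l w v =
     delta_integral
       (\<lambda>X :: real^'n^'n. 1 + (\<Sum>k\<in>UNIV - {l}. (norm (X $ k))\<^sup>2) - (norm (X $ l))\<^sup>2)
       (\<lambda>X. (\<Prod>k\<in>UNIV. neg_pow (norm (X $ k)) \<alpha>) *
            neg_pow (norm (w - (\<Sum>k\<in>UNIV. X $ k)) * norm (v - (\<Sum>k\<in>UNIV. X $ k)))
              (real CARD('n) * (real CARD('n) - \<alpha> + 1) / 2 - 1))"

definition kernel_H :: "real \<Rightarrow> real^'n \<Rightarrow> real^'n \<Rightarrow> ennreal" where
  "kernel_H \<alpha> w v =
     delta_integral
       (\<lambda>(x :: real^'n, y :: real^'n). 1 + (norm x)\<^sup>2 - (norm y)\<^sup>2)
       (\<lambda>(x, y). neg_pow (norm x) \<alpha> * neg_pow (norm y) \<alpha> *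
            neg_pow (norm (w - x - y) * norm (v - x - y)) (3 * real CARD('n) / 2 - 1 - \<alpha>))"

definition kernel_J :: "real^'n \<Rightarrow> real^'n \<Rightarrow> ennreal" where
  "kernel_J w v =
     delta_integral
       (\<lambda>(x :: real^'n, y :: real^'n, z :: real^'n). 1 + (norm x)\<^sup>2 + (norm z)\<^sup>2 - (norm y)\<^sup>2)
       (\<lambda>(x, y, z). neg_pow (norm x * norm y * norm z) (real CARD('n) - 1) *
            neg_pow (norm (w - x - y - z) * norm (v - x - y - z)) ((real CARD('n) + 1) / 2))"

end

theory Submission
  imports Defs
begin

text \<open>
  Let \<open>n\<close> be the dimension, \<open>s\<close> the sum of the integration variables and \<open>m(s)\<close> the density of the measure
  \<open>\<Prod>\<bar>x\<^sub>k\<bar>\<^bsup>-\<alpha>\<^esup> \<delta>[F]\<close> under the map to \<open>s\<close>. Then \<open>T(w,v) = \<integral> \<bar>w - s\<bar>\<^bsup>-\<kappa>\<^esup> \<bar>v - s\<bar>\<^bsup>-\<kappa>\<^esup> m(s) ds\<close>. In each case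
  \<open>m(s) \<le> C \<bar>s\<bar>\<^bsup>-2\<beta>\<^esup>\<close> with \<open>\<kappa> = n - \<beta>\<close> and \<open>0 < \<beta> < n/2\<close>, so that the claim becomes the Stein--Weiss
  inequality for the weight \<open>\<bar>s\<bar>\<^bsup>-\<beta>\<^esup>\<close>, which is Schur's test with the function \<open>\<bar>w\<bar>\<^bsup>-n/2\<^esup>\<close>.

  For the bound on \<open>m\<close>, substitute \<open>y = s - u - z\<close> for the variable with the minus sign, where \<open>u\<close> is the sum of
  the other variables but one, \<open>z\<close>. Then \<open>F = 0\<close> is a linear equation for \<open>z\<close>, and the integral over this
  hyperplane, followed by integrals of the form \<open>\<integral> \<bar>x\<bar>\<^bsup>-a\<^esup> \<bar>x - y\<bar>\<^bsup>-b\<^esup> dx\<close> over the remaining variables, gives the power of \<open>\<bar>s\<bar>\<close>.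

  As only upper bounds are needed, \<open>\<delta>[F]\<close> is replaced by \<open>1/\<epsilon>\<close> times the indicator of \<open>-\<epsilon> < F < 0\<close>: the surface
  is a finite union of Lipschitz graphs, on which Hausdorff measure is at most a constant times the
  Lebesgue measure of the projection.
\<close>

subsection \<open>Upper bounds for Hausdorff measure\<close>

text \<open>The exponent of |s| is dictated by scaling. Without the constant 1 in F, the density m
  of N variables with weight exponent \<alpha> would be homogeneous of degree (N - 1) n - N \<alpha>
  - 2, and this number is -2 \<beta>. The relation \<kappa> = n - \<beta> then makes the operator
  with kernel |s|^-\<beta> |w - s|^-\<kappa> homogeneous of the degree that L^2 boundedness demands.

  The shell is one-sided because F < 0 says that the variable with the minus sign has larger norm
  than every other one. Its weight can therefore be traded for powers of the other norms and of |s|,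
  which is how the bound for m becomes a chain of convergent integrals.

  The weights take the value infinity at their singularities. As functions into [0, infinity] they
  are then continuous everywhere, so the passage from the shell to the surface has no exceptional
  points.\<close>

lemma sets_hausdorff_measure [measurable_cong]:
  "sets (hausdorff_measure k :: 'a::metric_space measure) = sets borel"
  unfolding hausdorff_measure_def
  by (metis sets.sigma_sets_eq sets_measure_of_conv space_borel sets.space_closed)

text \<open>The \<open>emeasure\<close> of \<open>measure_of\<close> is either the given set
  function or zero, and both are at most the outer measure.\<close>

lemma emeasure_hausdorff_measure_le:
  "emeasure (hausdorff_measure k) A \<le> hausdorff_outer k (A :: 'a::metric_space set)"
  by (auto simp: hausdorff_measure_def emeasure_measure_of_conv)

section \<open>Covers by small cubes and comparison with a projection\<close>

lemma dist_cube_le: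
  fixes x y u v :: "'a::euclidean_space" and h :: real
  assumes "x \<in> cbox u v" "y \<in> cbox u v" "\<And>b. b \<in> Basis \<Longrightarrow> v \<bullet> b - u \<bullet> b = h"
  shows "norm (x - y) \<le> DIM('a) * h"
proof -
  have "norm (x - y) \<le> (\<Sum>b\<in>Basis. \<bar>(x - y) \<bullet> b\<bar>)" by (rule norm_le_l1)
  also have "\<dots> \<le> (\<Sum>b\<in>(Basis::'a set). h)"
  proof (rule sum_mono)
    fix b :: 'a assume b: "b \<in> Basis"
    have "u \<bullet> b \<le> x \<bullet> b" "x \<bullet> b \<le> v \<bullet> b" "u \<bullet> b \<le> y \<bullet> b" "y \<bullet> b \<le> v \<bullet> b"
      using assms(1,2) b by (auto simp: mem_box)
    then show "\<bar>(x - y) \<bullet> b\<bar> \<le> h" using assms(3)[OF b] by (auto simp: inner_diff_left)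
  qed
  finally show ?thesis by simp
qed

lemma hausdorff_premeasure_le:
  fixes A :: "'a::metric_space set"
  assumes "A \<subseteq> (\<Union>i. C i)" "\<And>i. bounded (C i)" "\<And>i. diameter (C i) \<le> \<delta>"
    "\<And>i. C i \<noteq> {} \<Longrightarrow> ennreal (unit_ball_vol (real k) * (diameter (C i) / 2) ^ k) \<le> B i"
  shows "hausdorff_premeasure k \<delta> A \<le> (\<Sum>i. B i)"
proof -
  have "hausdorff_premeasure k \<delta> A \<le> (\<Sum>i. if C i = {} then 0 else ennreal (unit_ball_vol (real k) * (diameter (C i) / 2) ^ k))"
    unfolding hausdorff_premeasure_def using assms(1-3) by (intro INF_lower) auto
  also have "\<dots> \<le> (\<Sum>i. B i)"
    using assms(4) by (intro suminf_le) auto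
  finally show ?thesis .
qed

text \<open>These are the dyadic cubes of \<open>covering_lemma\<close>, arranged as a sequence. The
  countable family may be finite, so it is padded with degenerate cubes of side 0, which account for
  the alternative \<open>h i = 0\<close>.\<close>

lemma covering_lemma_seq:
  fixes S :: "'a::euclidean_space set"
  assumes S: "S \<subseteq> U" "open U" "bounded S" and \<delta>: "\<delta> > 0"
  obtains u v :: "nat \<Rightarrow> 'a" and h :: "nat \<Rightarrow> real" where
    "\<And>i b. b \<in> Basis \<Longrightarrow> v i \<bullet> b - u i \<bullet> b = h i" "\<And>i. 0 \<le> h i"
    "\<And>i. DIM('a) * h i \<le> \<delta>"
    "\<And>i. cbox (u i) (v i) \<subseteq> U \<or> h i = 0" "disjoint_family (\<lambda>i. box (u i) (v i))"
    "S \<subseteq> (\<Union>i. cbox (u i) (v i))"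
proof (cases "S = {}")
  case True
  show ?thesis
    by (rule that[of "\<lambda>_. 0" "\<lambda>_. 0" "\<lambda>_. 0"]) (use \<delta> True in \<open>auto simp: disjoint_family_on_def\<close>)
next
  case False
  \<comment> \<open>Opposite corners of a cube inside a ball of radius \<open>\<delta>'\<close> are
    closer than \<open>2 * \<delta>'\<close>, so its side is too, and \<open>DIM('a) * h\<close> is
    at most \<delta>.\<close>
  define \<delta>' where "\<delta>' = \<delta> / (2 * DIM('a))"
  have \<delta>': "\<delta>' > 0" using \<delta> by (simp add: \<delta>'_def)
  obtain R where R: "R > 0" "\<And>x. x \<in> S \<Longrightarrow> norm x \<le> R"
    using S(3) unfolding bounded_pos by blast
  define a b :: 'a where "a = - R *\<^sub>R One" and "b = R *\<^sub>R One"
  have Sab: "S \<subseteq> cbox a b"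
  proof
    fix x assume x: "x \<in> S"
    show "x \<in> cbox a b" unfolding mem_box
    proof
      fix i :: 'a assume i: "i \<in> Basis"
      have "\<bar>x \<bullet> i\<bar> \<le> R" using R(2)[OF x] Basis_le_norm[OF i, of x] by linarith
      then show "a \<bullet> i \<le> x \<bullet> i \<and> x \<bullet> i \<le> b \<bullet> i" using i by (simp add: a_def b_def abs_le_iff)
    qed
  qed
  have box: "box a b \<noteq> {}" using R(1) by (auto simp: box_ne_empty a_def b_def)
  \<comment> \<open>Each cube is tagged by a point of S, hence of U, so this gauge forces it into U
    and into the small ball at once.\<close>
  have "gauge (\<lambda>x. if x \<in> U then U \<inter> ball x \<delta>' else ball x \<delta>')" (is "gauge ?g")
    using S \<delta>' by (auto simp: gauge_def)
  from covering_lemma[OF Sab box this] obtain \<D> where D: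
    "countable \<D>"  "\<Union>\<D> \<subseteq> cbox a b"
    "\<And>K. K \<in> \<D> \<Longrightarrow> interior K \<noteq> {} \<and> (\<exists>c d. K = cbox c d)"
    "pairwise (\<lambda>A B. interior A \<inter> interior B = {}) \<D>"
    "\<And>K. K \<in> \<D> \<Longrightarrow> \<exists>x \<in> S \<inter> K. K \<subseteq> ?g x"
    "\<And>u v. cbox u v \<in> \<D> \<Longrightarrow> \<exists>n. \<forall>i \<in> Basis. v \<bullet> i - u \<bullet> i = (b \<bullet> i - a \<bullet> i) / 2^n"
    "S \<subseteq> \<Union>\<D>" by blast
  have "\<exists>c d (h::real). K = cbox c d \<and> (\<forall>b\<in>Basis. d \<bullet> b - c \<bullet> b = h) \<and> 0 \<le> h \<and> DIM('a) * h \<le> \<delta> \<and> K \<subseteq> U"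
    if K: "K \<in> \<D>" for K
  proof -
    obtain c d where cd: "K = cbox c d" using D(3)[OF K] by auto
    obtain n where n: "\<And>i. i \<in> Basis \<Longrightarrow> d \<bullet> i - c \<bullet> i = (b \<bullet> i - a \<bullet> i) / 2^n"
      using D(6) K cd by blast
    define h where "h = 2 * R / 2 ^ n"
    have h: "\<And>b. b \<in> Basis \<Longrightarrow> d \<bullet> b - c \<bullet> b = h" using n by (simp add: a_def b_def h_def)
    have h0: "h \<ge> 0" using R by (simp add: h_def)
    obtain x where x: "x \<in> S" "x \<in> K" "K \<subseteq> ?g x" using D(5)[OF K] by auto
    have "?g x = U \<inter> ball x \<delta>'" using x(1) S(1) by auto
    then have sub: "K \<subseteq> U" "K \<subseteq> ball x \<delta>'" using x(3) by blast+
    have ne: "c \<in> cbox c d" "d \<in> cbox c d" using h h0 by (auto simp: mem_box) (metis diff_ge_0_iff_ge)+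
    then have "dist x c < \<delta>'" "dist x d < \<delta>'" using sub(2) cd by auto
    then have "norm (d - c) < 2 * \<delta>'" by (metis dist_commute dist_norm dist_triangle_half_l mult.commute nonzero_mult_div_cancel_left zero_neq_numeral)
    moreover obtain e :: 'a where e: "e \<in> Basis" using nonempty_Basis by blast
    moreover have "h \<le> norm (d - c)" using Basis_le_norm[OF e, of "d - c"] h[OF e] by (simp add: inner_diff_left)
    ultimately have "DIM('a) * h \<le> DIM('a) * (2 * \<delta>')" by (intro mult_left_mono) auto
    also have "\<dots> = \<delta>" by (simp add: \<delta>'_def)
    finally have "DIM('a) * h \<le> \<delta>" .
    then have "K = cbox c d \<and> (\<forall>b\<in>Basis. d \<bullet> b - c \<bullet> b = h) \<and> 0 \<le> h \<and> DIM('a) * h \<le> \<delta> \<and> K \<subseteq> U"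
      using cd h h0 sub(1) by simp
    then show ?thesis by blast
  qed
  then have "\<forall>K. \<exists>c d (h::real). K \<in> \<D> \<longrightarrow> K = cbox c d \<and> (\<forall>b\<in>Basis. d \<bullet> b - c \<bullet> b = h) \<and> 0 \<le> h \<and> DIM('a) * h \<le> \<delta> \<and> K \<subseteq> U"
    by blast
  then obtain c d and h :: "'a set \<Rightarrow> real" where cdh0: "\<forall>K. K \<in> \<D> \<longrightarrow> K = cbox (c K) (d K) \<and> (\<forall>b\<in>Basis. d K \<bullet> b - c K \<bullet> b = h K) \<and> 0 \<le> h K \<and> DIM('a) * h K \<le> \<delta> \<and> K \<subseteq> U"
    unfolding choice_iff by (elim exE)
  have cdh: "K = cbox (c K) (d K)" "\<And>b. b \<in> Basis \<Longrightarrow> d K \<bullet> b - c K \<bullet> b = h K" "0 \<le> h K" "DIM('a) * h K \<le> \<delta>" "K \<subseteq> U" if "K \<in> \<D>" for K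
    using cdh0 that by auto
  define I where "I = to_nat_on \<D> ` \<D>"
  define f where "f = from_nat_into \<D>"
  have f: "\<And>i. i \<in> I \<Longrightarrow> f i \<in> \<D>" unfolding f_def I_def using from_nat_into by blast
  have finj: "f i \<noteq> f j" if "i \<in> I" "j \<in> I" "i \<noteq> j" for i j
    using that D(1) by (auto simp: I_def f_def)
  have fsurj: "\<exists>i\<in>I. f i = K" if "K \<in> \<D>" for K
    using that D(1) by (auto simp: I_def f_def)
  show ?thesis
  proof (rule that[of "\<lambda>i. if i \<in> I then d (f i) else 0" "\<lambda>i. if i \<in> I then c (f i) else 0" "\<lambda>i. if i \<in> I then h (f i) else 0"])
    show "disjoint_family (\<lambda>i. box (if i \<in> I then c (f i) else 0) (if i \<in> I then d (f i) else 0))"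
      unfolding disjoint_family_on_def
    proof (intro ballI impI)
      fix i j :: nat assume ij: "i \<noteq> j"
      show "box (if i \<in> I then c (f i) else 0) (if i \<in> I then d (f i) else 0) \<inter> box (if j \<in> I then c (f j) else 0) (if j \<in> I then d (f j) else 0) = {}"
      proof (cases "i \<in> I \<and> j \<in> I")
        case True
        then have "interior (f i) \<inter> interior (f j) = {}"
          using D(4) f finj ij by (auto simp: pairwise_def)
        moreover have "interior (f i) = box (c (f i)) (d (f i))" "interior (f j) = box (c (f j)) (d (f j))"
          using cdh(1)[OF f, of i] cdh(1)[OF f, of j] True by (metis interior_cbox)+
        ultimately show ?thesis using True by auto
      qed auto
    qed
    show "S \<subseteq> (\<Union>i. cbox (if i \<in> I then c (f i) else 0) (if i \<in> I then d (f i) else 0))"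
    proof
      fix x assume "x \<in> S"
      then obtain K where K: "K \<in> \<D>" "x \<in> K" using D(7) by auto
      then obtain i where "i \<in> I" "f i = K" using fsurj by auto
      then show "x \<in> (\<Union>i. cbox (if i \<in> I then c (f i) else 0) (if i \<in> I then d (f i) else 0))"
        using K(2) cdh(1)[OF K(1)] by (intro UN_I[of i]) auto
    qed
  next
    fix i
    show "cbox (if i \<in> I then c (f i) else 0) (if i \<in> I then d (f i) else 0) \<subseteq> U \<or> (if i \<in> I then h (f i) else 0) = 0"
      using cdh(1,5)[OF f, of i] by auto
  qed (use cdh(2-4)[OF f] \<delta> in auto)
qed

lemma nn_integral_slice_le:
  fixes f :: "real \<Rightarrow> ennreal"
  assumes [measurable]: "f \<in> borel_measurable borel" and "(\<integral>\<^sup>+t. f t \<partial>lborel) < c"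
  obtains t where "0 \<le> t" "t \<le> 1" "f t \<le> c"
proof -
  have "\<exists>t\<in>{0..1}. f t \<le> c"
  proof (rule ccontr)
    assume "\<not> ?thesis"
    then have "c * indicator {0..1} t \<le> f t" for t by (auto simp: indicator_def not_le intro: less_imp_le)
    then have "(\<integral>\<^sup>+(t::real). c * indicator {0..1} t \<partial>lborel) \<le> (\<integral>\<^sup>+t. f t \<partial>lborel)"
      by (rule nn_integral_mono)
    then have "c \<le> (\<integral>\<^sup>+t. f t \<partial>lborel)" by (simp add: nn_integral_cmult_indicator)
    then show False using assms(2) by auto
  qed
  then show thesis using that by auto
qed

text \<open>
  A cover of the cylinder of height 1 over the shadow of \<open>A\<close> by small cubes of side \<open>h\<^sub>i\<close> and total
  volume \<open>V\<close> has, by Fubini, a horizontal slice in which the sum of \<open>h\<^sub>i ^ (D - 1)\<close> is at most \<open>V\<close>;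
  lifting the cubes that meet this slice back to \<open>A\<close> gives the cover of \<open>A\<close>.
\<close>

lemma hausdorff_outer_le_shadow:
  fixes A S :: "'a::euclidean_space set" and e :: 'a and \<pi> :: "'a \<Rightarrow> 'a \<Rightarrow> 'a"
  defines "\<pi> \<equiv> \<lambda>e X. X - (X \<bullet> e) *\<^sub>R e"
  defines "S \<equiv> {X. 0 \<le> X \<bullet> e \<and> X \<bullet> e \<le> 1 \<and> (\<exists>Y\<in>A. \<pi> e Y = \<pi> e X)}"
  assumes e: "e \<in> Basis" and D: "DIM('a) \<ge> 2" and L: "L > 0" and A: "bounded A"
    and lip: "\<And>X Y. X \<in> A \<Longrightarrow> Y \<in> A \<Longrightarrow> norm (X - Y) \<le> L * norm (\<pi> e X - \<pi> e Y)"
    and shadow: "S \<in> sets borel"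
  shows "hausdorff_outer (DIM('a) - 1) A
    \<le> ennreal (unit_ball_vol (real (DIM('a) - 1)) * (L * DIM('a) / 2) ^ (DIM('a) - 1)) * emeasure lborel S"
    (is "_ \<le> ennreal ?c * _")
  unfolding hausdorff_outer_def
proof (rule SUP_least)
  fix \<delta> :: real assume "\<delta> \<in> {0<..}"
  then have \<delta>: "\<delta> > 0" by simp
  define k where "k = DIM('a) - 1"
  have Dk: "DIM('a) = Suc k" "k > 0" using D by (auto simp: k_def)
  have ee: "e \<bullet> e = 1" using e by simp
  have c0: "?c \<ge> 0" using L by simp
  obtain R where R: "R > 0" "\<And>x. x \<in> A \<Longrightarrow> norm x \<le> R"
    using A unfolding bounded_pos by blast
  have Sb: "bounded S"
  proof (rule boundedI)
    fix X assume "X \<in> S"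
    then obtain Y where X: "0 \<le> X \<bullet> e" "X \<bullet> e \<le> 1" and Y: "Y \<in> A" "\<pi> e Y = \<pi> e X" by (auto simp: S_def)
    have "X = (Y - (Y \<bullet> e) *\<^sub>R e) + (X \<bullet> e) *\<^sub>R e"
      using Y(2) by (simp add: \<pi>_def)
    then have "norm X \<le> norm Y + norm ((Y \<bullet> e) *\<^sub>R e) + norm ((X \<bullet> e) *\<^sub>R e)"
      by (metis norm_triangle_ineq4 norm_triangle_le add_right_mono)
    also have "\<dots> \<le> R + R + 1"
      using R(2)[OF Y(1)] X Basis_le_norm[OF e, of Y] e by simp
    finally show "norm X \<le> R + R + 1" .
  qed
  have "emeasure lborel S < \<infinity>" by (rule emeasure_bounded_finite[OF Sb])
  have ineq: "hausdorff_premeasure k \<delta> A \<le> ennreal ?c * (emeasure lborel S + ennreal \<eta>)" if \<eta>: "\<eta> > 0" for \<eta> :: real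
  proof -
    \<comment> \<open>The surplus \<eta> provides the strict inequality that
      \<open>nn_integral_slice_le\<close> asks for; it is sent to 0 at the end.\<close>
    obtain U where U: "open U" "S \<subseteq> U" "emeasure lborel (U - S) < ennreal \<eta>"
      using outer_regular_lborel[OF shadow \<eta>] by blast
    have "emeasure lborel U = emeasure lborel (S \<union> (U - S))"
      using U by (intro arg_cong2[where f=emeasure]) auto
    also have "\<dots> = emeasure lborel S + emeasure lborel (U - S)"
      using shadow U(1) by (intro plus_emeasure[symmetric]) auto
    also have "\<dots> < emeasure lborel S + ennreal \<eta>"
      using U(3) \<open>emeasure lborel S < \<infinity>\<close> by (simp add: ennreal_add_left_cancel_less)
    finally have Um: "emeasure lborel U < emeasure lborel S + ennreal \<eta>" .
    \<comment> \<open>Lifting back to A stretches diameters by up to L, so the cubes are chosen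
      finer by this factor.\<close>
    have "\<delta> / L > 0" using \<delta> L by simp
    then obtain u v :: "nat \<Rightarrow> 'a" and h :: "nat \<Rightarrow> real" where uv:
      "\<And>i b. b \<in> Basis \<Longrightarrow> v i \<bullet> b - u i \<bullet> b = h i" "\<And>i. 0 \<le> h i"
      "\<And>i. DIM('a) * h i \<le> \<delta> / L"
      "\<And>i. cbox (u i) (v i) \<subseteq> U \<or> h i = 0" "disjoint_family (\<lambda>i. box (u i) (v i))"
      "S \<subseteq> (\<Union>i. cbox (u i) (v i))"
      by (rule covering_lemma_seq[OF U(2,1) Sb]) (rule that)
    define f where "f t = (\<Sum>i. ennreal (h i ^ k) * indicator {u i \<bullet> e .. v i \<bullet> e} t)" for t
    have [measurable]: "f \<in> borel_measurable borel" unfolding f_def by measurable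
    have box: "emeasure lborel (box (u i) (v i)) = ennreal (h i ^ k) * ennreal (h i)" for i
    proof -
      have "u i \<bullet> b \<le> v i \<bullet> b" if "b \<in> Basis" for b using uv(1)[OF that, of i] uv(2)[of i] by linarith
      then have "emeasure lborel (box (u i) (v i)) = ennreal (\<Prod>b\<in>Basis. (v i - u i) \<bullet> b)"
        by (intro emeasure_lborel_box) auto
      also have "(\<Prod>b\<in>Basis. (v i - u i) \<bullet> b) = (\<Prod>b\<in>(Basis::'a set). h i)"
        using uv(1) by (intro prod.cong) (auto simp: inner_diff_left)
      also have "\<dots> = h i ^ k * h i" by (simp add: Dk)
      finally show ?thesis using uv(2) by (simp add: ennreal_mult)
    qed
    have "(\<integral>\<^sup>+t. f t \<partial>lborel) = (\<Sum>i. \<integral>\<^sup>+t. ennreal (h i ^ k) * indicator {u i \<bullet> e .. v i \<bullet> e} t \<partial>lborel)"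
      unfolding f_def by (rule nn_integral_suminf) measurable
    also have "\<dots> = (\<Sum>i. emeasure lborel (box (u i) (v i)))"
      by (rule suminf_cong) (use uv(1)[OF e] uv(2) in \<open>simp add: nn_integral_cmult_indicator box algebra_simps\<close>)
    also have "\<dots> = emeasure lborel (\<Union>i. box (u i) (v i))"
      by (rule suminf_emeasure) (use uv(5) in auto)
    also have "\<dots> \<le> emeasure lborel U"
    proof (rule emeasure_mono)
      have "box (u i) (v i) \<subseteq> U" for i
      proof (cases "h i = 0")
        case True
        then have "u i \<bullet> e = v i \<bullet> e" using uv(1)[OF e, of i] by simp
        then have "box (u i) (v i) = {}" using e by (auto simp: box_eq_empty intro!: bexI[of _ e])
        then show ?thesis by simp
      next
        case False
        then show ?thesis using uv(4)[of i] box_subset_cbox[of "u i" "v i"] by blast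
      qed
      then show "(\<Union>i. box (u i) (v i)) \<subseteq> U" by auto
    qed (use U in auto)
    also note Um
    finally have "(\<integral>\<^sup>+t. f t \<partial>lborel) < emeasure lborel S + ennreal \<eta>" .
    then obtain t where t: "0 \<le> t" "t \<le> 1" "f t \<le> emeasure lborel S + ennreal \<eta>"
      using nn_integral_slice_le[of f] by auto
    \<comment> \<open>A cube that misses the height t yields an empty member of the cover, which has
      weight 0; this is why only the cubes counted by \<open>f t\<close> contribute.\<close>
    define C where "C i = {Y\<in>A. \<pi> e Y + t *\<^sub>R e \<in> cbox (u i) (v i)}" for i
    have diam: "diameter (C i) \<le> L * (DIM('a) * h i)" for i
    proof (rule diameter_le)
      show "C i \<noteq> {} \<or> 0 \<le> L * (DIM('a) * h i)" using L uv(2)[of i] by simp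
      fix X Y assume XY: "X \<in> C i" "Y \<in> C i"
      then have "norm (X - Y) \<le> L * norm (\<pi> e X - \<pi> e Y)" by (intro lip) (auto simp: C_def)
      also have "\<pi> e X - \<pi> e Y = (\<pi> e X + t *\<^sub>R e) - (\<pi> e Y + t *\<^sub>R e)" by simp
      also have "norm \<dots> \<le> DIM('a) * h i"
        using XY uv(1) by (intro dist_cube_le[of _ "u i" "v i"]) (auto simp: C_def)
      finally show "norm (X - Y) \<le> L * (DIM('a) * h i)" using L by simp
    qed
    have cb: "bounded (C i)" for i using A by (rule bounded_subset) (auto simp: C_def)
    have "hausdorff_premeasure k \<delta> A \<le> (\<Sum>i. ennreal ?c * (ennreal (h i ^ k) * indicator {u i \<bullet> e .. v i \<bullet> e} t))"
    proof (rule hausdorff_premeasure_le)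
      show "A \<subseteq> \<Union> (range C)"
      proof
        fix Y assume Y: "Y \<in> A"
        have "\<pi> e (\<pi> e Y + t *\<^sub>R e) = \<pi> e Y" by (simp add: \<pi>_def algebra_simps ee)
        moreover have "(\<pi> e Y + t *\<^sub>R e) \<bullet> e = t" by (simp add: \<pi>_def algebra_simps ee)
        ultimately have "\<pi> e Y + t *\<^sub>R e \<in> S" using Y t by (force simp: S_def)
        then have "\<pi> e Y + t *\<^sub>R e \<in> (\<Union>i. cbox (u i) (v i))" using uv(6) by blast
        then show "Y \<in> \<Union> (range C)" using Y by (auto simp: C_def)
      qed
      show "bounded (C i)" for i by (rule cb)
      show "diameter (C i) \<le> \<delta>" for i
      proof -
        have "L * (DIM('a) * h i) \<le> L * (\<delta> / L)" using uv(3)[of i] L by (intro mult_left_mono) auto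
        then show ?thesis using diam[of i] L by simp
      qed
      fix i assume "C i \<noteq> {}"
      then obtain Y where "\<pi> e Y + t *\<^sub>R e \<in> cbox (u i) (v i)" by (auto simp: C_def)
      moreover have "(\<pi> e Y + t *\<^sub>R e) \<bullet> e = t" by (simp add: \<pi>_def algebra_simps ee)
      ultimately have "t \<in> {u i \<bullet> e .. v i \<bullet> e}" using e by (metis atLeastAtMost_iff mem_box(2))
      moreover have "unit_ball_vol (real k) * (diameter (C i) / 2) ^ k \<le> ?c * h i ^ k"
      proof -
        have "(diameter (C i) / 2) ^ k \<le> (L * DIM('a) / 2 * h i) ^ k"
          using diam[of i] diameter_ge_0[OF cb] by (intro power_mono) (auto simp: algebra_simps)
        then have "unit_ball_vol (real k) * (diameter (C i) / 2) ^ k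
            \<le> unit_ball_vol (real k) * (L * DIM('a) / 2 * h i) ^ k"
          by (intro mult_left_mono) auto
        also have "\<dots> = unit_ball_vol (real k) * (L * DIM('a) / 2) ^ k * h i ^ k"
          by (simp only: power_mult_distrib mult.assoc)
        finally show ?thesis by (simp only: k_def)
      qed
      ultimately show "ennreal (unit_ball_vol (real k) * (diameter (C i) / 2) ^ k)
          \<le> ennreal ?c * (ennreal (h i ^ k) * indicator {u i \<bullet> e .. v i \<bullet> e} t)"
        using c0 uv(2)[of i] by (auto simp: ennreal_mult[symmetric] intro!: ennreal_leI)
    qed
    also have "\<dots> = ennreal ?c * f t" unfolding f_def by (rule ennreal_suminf_cmult)
    also have "\<dots> \<le> ennreal ?c * (emeasure lborel S + ennreal \<eta>)" using t(3) by (rule mult_left_mono) auto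
    finally show ?thesis .
  qed
  have "hausdorff_premeasure k \<delta> A \<le> ennreal ?c * emeasure lborel S"
  proof (rule tendsto_lowerbound)
    show "((\<lambda>\<eta>. ennreal ?c * (emeasure lborel S + ennreal \<eta>)) \<longlongrightarrow> ennreal ?c * emeasure lborel S) (at_right 0)"
    proof -
      have "((\<lambda>\<eta>. ennreal ?c * (emeasure lborel S + ennreal \<eta>)) \<longlongrightarrow> ennreal ?c * (emeasure lborel S + ennreal 0)) (at_right 0)"
        using \<open>emeasure lborel S < \<infinity>\<close>
        by (intro tendsto_mult_ennreal tendsto_intros) auto
      then show ?thesis by simp
    qed
    show "\<forall>\<^sub>F \<eta> in at_right 0. hausdorff_premeasure k \<delta> A \<le> ennreal ?c * (emeasure lborel S + ennreal \<eta>)"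
      using ineq by (intro eventually_at_rightI[of 0 1]) auto
  qed simp
  then show "hausdorff_premeasure (DIM('a) - 1) \<delta> A \<le> ennreal ?c * emeasure lborel S"
    by (simp add: k_def)
qed

subsection \<open>Delta integrals over quadrics\<close>

lemma gradient_eqI: "GDERIV F X :> D \<Longrightarrow> gradient F X = D"
proof -
  assume D: "GDERIV F X :> D"
  have "D' = D" if "GDERIV F X :> D'" for D'
  proof -
    have "(\<lambda>h. h \<bullet> D') = (\<lambda>h. h \<bullet> D)"
      using that D has_derivative_unique unfolding gderiv_def by blast
    then show ?thesis by (metis inner_commute vector_eq_ldot)
  qed
  then show ?thesis unfolding gradient_def using D by blast
qed

lemma nn_integral_lborel_translate:
  fixes f :: "'a::euclidean_space \<Rightarrow> ennreal"
  assumes [measurable]: "f \<in> borel_measurable borel"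
  shows "(\<integral>\<^sup>+x. f (a + x) \<partial>lborel) = (\<integral>\<^sup>+x. f x \<partial>lborel)"
proof -
  have "(\<integral>\<^sup>+x. f x \<partial>lborel) = (\<integral>\<^sup>+x. f x \<partial>distr lborel borel ((+) a))"
    by (simp add: lborel_distr_plus)
  also have "\<dots> = (\<integral>\<^sup>+x. f (a + x) \<partial>lborel)" by (subst nn_integral_distr) auto
  finally show ?thesis by simp
qed

text \<open>The inner integral does not depend on \<open>X \<bullet> e\<close>, so the strip of
  height 1 stands for the hyperplane orthogonal to e. This form keeps all integrals in the ambient
  space, without a measure on the hyperplane.\<close>

lemma nn_integral_shift_average:
  fixes W :: "'a::euclidean_space \<Rightarrow> ennreal"
  assumes [measurable]: "W \<in> borel_measurable borel" and e: "e \<in> Basis"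
  shows "(\<integral>\<^sup>+X. indicator {0..1} (X \<bullet> e) * (\<integral>\<^sup>+t. W (X + t *\<^sub>R e) \<partial>lborel) \<partial>lborel) = (\<integral>\<^sup>+X. W X \<partial>lborel)"
proof -
  have "(\<integral>\<^sup>+X. indicator {0..1} (X \<bullet> e) * (\<integral>\<^sup>+t. W (X + t *\<^sub>R e) \<partial>lborel) \<partial>lborel)
      = (\<integral>\<^sup>+X. (\<integral>\<^sup>+t. indicator {0..1} (X \<bullet> e) * W (X + t *\<^sub>R e) \<partial>lborel) \<partial>lborel)"
    by (intro nn_integral_cong nn_integral_cmult[symmetric]) measurable
  also have "\<dots> = (\<integral>\<^sup>+t. (\<integral>\<^sup>+X. indicator {0..1} (X \<bullet> e) * W (X + t *\<^sub>R e) \<partial>lborel) \<partial>lborel)"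
    by (rule lborel_pair.Fubini') measurable
  also have "\<dots> = (\<integral>\<^sup>+t. (\<integral>\<^sup>+X. indicator {0..1} (X \<bullet> e - t) * W X \<partial>lborel) \<partial>lborel)"
  proof (rule nn_integral_cong)
    fix t :: real
    have "e \<bullet> e = 1" using e by simp
    then show "(\<integral>\<^sup>+X. indicator {0..1} (X \<bullet> e) * W (X + t *\<^sub>R e) \<partial>lborel) = (\<integral>\<^sup>+X. indicator {0..1} (X \<bullet> e - t) * W X \<partial>lborel)"
      by (subst nn_integral_lborel_translate[of _ "t *\<^sub>R e", symmetric])
        (auto intro!: nn_integral_cong simp: inner_add_left add.commute)
  qed
  also have "\<dots> = (\<integral>\<^sup>+X. (\<integral>\<^sup>+t. indicator {0..1} (X \<bullet> e - t) * W X \<partial>lborel) \<partial>lborel)"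
    by (rule lborel_pair.Fubini') measurable
  also have "\<dots> = (\<integral>\<^sup>+X. W X \<partial>lborel)"
  proof (rule nn_integral_cong)
    fix X :: 'a
    have "(\<integral>\<^sup>+t. indicator {0..1} (X \<bullet> e - t) * W X \<partial>lborel) = (\<integral>\<^sup>+t. indicator {0..1} (X \<bullet> e - t) \<partial>lborel) * W X"
      by (rule nn_integral_multc) measurable
    also have "(\<integral>\<^sup>+t. indicator {0..1} (X \<bullet> e - t) \<partial>lborel) = (\<integral>\<^sup>+t. indicator {X \<bullet> e - 1..X \<bullet> e} t \<partial>lborel)"
      by (intro nn_integral_cong) (auto simp: indicator_def)
    also have "\<dots> = 1" by simp
    finally show "(\<integral>\<^sup>+t. indicator {0..1} (X \<bullet> e - t) * W X \<partial>lborel) = W X" by simp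
  qed
  finally show ?thesis .
qed

text \<open>A changes the signs of some coordinates. This treats the delta functions of all kernels
  at once, whatever product of copies of the base space is integrated over; that A is an isometry
  gives the gradient of F the norm 2 |X|.\<close>

locale quadric =
  fixes A :: "'a::euclidean_space \<Rightarrow> 'a"
  assumes linear_A: "linear A"
    and inner_A: "x \<bullet> A y = A x \<bullet> y"
    and norm_A: "norm (A x) = norm x"
    and A_Basis: "b \<in> Basis \<Longrightarrow> A b = b \<or> A b = - b"
    and dim: "DIM('a) \<ge> 2"
begin

definition F :: "'a \<Rightarrow> real" where "F X = 1 + X \<bullet> A X"

section \<open>Sheets of the quadric as Lipschitz graphs\<close>

definition proj :: "'a \<Rightarrow> 'a \<Rightarrow> 'a" where "proj e X = X - (X \<bullet> e) *\<^sub>R e"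

text \<open>With c = 1 or -1, these are the points where the coordinate along e has sign c and is
  comparable with the norm. There the derivative of F along e is comparable with the whole
  gradient.\<close>

definition sheet :: "'a \<Rightarrow> real \<Rightarrow> 'a set" where
  "sheet e c = {X. F X = 0 \<and> norm X \<le> DIM('a) * (c * (X \<bullet> e))}"

text \<open>On the zero set the square of the height over the hyperplane equals |F| at the
  projection, so this map recovers a point of the sheet from its projection. The absolute value
  serves both signs that A may give to e.\<close>

definition graph :: "'a \<Rightarrow> real \<Rightarrow> 'a \<Rightarrow> 'a" where
  "graph e c X = proj e X + (c * sqrt \<bar>F (proj e X)\<bar>) *\<^sub>R e"

text \<open>The constant of \<open>hausdorff_outer_le_shadow\<close> for the Lipschitz constant 1 +
  D of a sheet, where D is the dimension.\<close>

definition sheet_const :: real where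
  "sheet_const = unit_ball_vol (real (DIM('a) - 1)) * ((1 + real DIM('a)) * DIM('a) / 2) ^ (DIM('a) - 1)"

lemma sheet_const_nonneg: "0 \<le> sheet_const"
  unfolding sheet_const_def by simp

lemma continuous_F [continuous_intros]: "continuous_on UNIV F"
proof -
  have "continuous_on UNIV A"
    using linear_A by (intro linear_continuous_on) (simp add: linear_linear)
  then show ?thesis unfolding F_def by (intro continuous_intros)
qed

lemma measurable_F [measurable]: "F \<in> borel_measurable borel"
  by (rule borel_measurable_continuous_onI[OF continuous_F])

lemma measurable_proj [measurable]: "proj e \<in> borel_measurable borel"
  unfolding proj_def by measurable

lemma measurable_graph [measurable]: "graph e c \<in> borel_measurable borel"
  unfolding graph_def by measurable

lemma sets_sheet [measurable]: "sheet e c \<in> sets borel"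
  unfolding sheet_def by measurable

lemma gderiv_F: "GDERIV F X :> 2 *\<^sub>R A X"
proof -
  have "bounded_linear A" using linear_A by (simp add: linear_linear)
  then have "((\<lambda>X. A X) has_derivative (\<lambda>h. A h)) (at X)"
    by (rule bounded_linear.has_derivative) (rule has_derivative_ident)
  from has_derivative_add[OF has_derivative_const[of 1] has_derivative_inner[OF has_derivative_ident this]]
  have "(F has_derivative (\<lambda>h. X \<bullet> A h + h \<bullet> A X)) (at X)"
    by (simp add: F_def[abs_def])
  moreover have "(\<lambda>h. X \<bullet> A h + h \<bullet> A X) = (\<lambda>h. h \<bullet> (2 *\<^sub>R A X))"
    by (auto simp: inner_A[of X] inner_commute)
  ultimately show ?thesis by (simp add: gderiv_def)
qed

lemma norm_gradient: "norm (gradient F X) = 2 * norm X"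
  using gradient_eqI[OF gderiv_F] by (simp add: norm_A)

lemma A_add: "A (x + y) = A x + A y" and A_scaleR: "A (c *\<^sub>R x) = c *\<^sub>R A x"
  using linear_A by (simp_all add: linear_add linear_cmul)

lemma sign_of_Basis:
  assumes "e \<in> Basis"
  obtains \<sigma> where "\<sigma> = 1 \<or> \<sigma> = -1" "A e = \<sigma> *\<^sub>R e" "\<And>X t. F (X + t *\<^sub>R e) = F X + 2 * t * \<sigma> * (X \<bullet> e) + \<sigma> * t\<^sup>2"
proof -
  obtain \<sigma> :: real where s: "\<sigma> = 1 \<or> \<sigma> = -1" "A e = \<sigma> *\<^sub>R e"
    using A_Basis[OF assms] by (metis scaleR_minus1_left scaleR_one)
  have ee: "e \<bullet> e = 1" using assms by simp
  have "F (X + t *\<^sub>R e) = F X + 2 * t * \<sigma> * (X \<bullet> e) + \<sigma> * t\<^sup>2" for X t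
    using inner_A[of e X] s(2) ee
    by (simp add: F_def A_add A_scaleR inner_simps algebra_simps power2_eq_square inner_commute)
  then show thesis using s that by blast
qed

lemma proj_graph: "e \<in> Basis \<Longrightarrow> proj e (graph e c X) = proj e X"
  by (simp add: graph_def proj_def inner_simps algebra_simps)

lemma proj_inner: "e \<in> Basis \<Longrightarrow> proj e X \<bullet> e = 0"
  by (simp add: proj_def inner_simps)

lemma F_proj:
  assumes e: "e \<in> Basis" and X: "F X = 0"
  shows "\<bar>F (proj e X)\<bar> = (X \<bullet> e)\<^sup>2"
proof -
  obtain \<sigma> where s: "\<sigma> = 1 \<or> \<sigma> = -1" "\<And>X t. F (X + t *\<^sub>R e) = F X + 2 * t * \<sigma> * (X \<bullet> e) + \<sigma> * t\<^sup>2"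
    using sign_of_Basis[OF e] by metis
  have "F (proj e X + (X \<bullet> e) *\<^sub>R e) = F (proj e X) + \<sigma> * (X \<bullet> e)\<^sup>2"
    unfolding s(2) using proj_inner[OF e] by simp
  then have "F (proj e X) = - \<sigma> * (X \<bullet> e)\<^sup>2" using X by (simp add: proj_def)
  then show ?thesis using s(1) by auto
qed

text \<open>F = 0 and the Cauchy--Schwarz inequality give |X| \<ge> 1. A sheet therefore stays away
  from height 0, where the square root in \<open>graph\<close> would fail to be Lipschitz.\<close>

lemma sheetD:
  assumes "X \<in> sheet e c" "e \<in> Basis" "c = 1 \<or> c = -1"
  shows "F X = 0" "1 \<le> norm X" "1 \<le> DIM('a) * (c * (X \<bullet> e))" "0 < c * (X \<bullet> e)" "c * (X \<bullet> e) \<le> norm X"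
    "graph e c X = X"
proof -
  show F0: "F X = 0" using assms by (simp add: sheet_def)
  have "1 = - (X \<bullet> A X)" using F0 by (simp add: F_def)
  also have "\<dots> \<le> norm X * norm (A X)" using Cauchy_Schwarz_ineq2[of X "A X"] by linarith
  also have "\<dots> = (norm X)\<^sup>2" by (simp add: norm_A power2_eq_square)
  finally show n: "1 \<le> norm X" using power2_le_imp_le[of 1 "norm X"] by simp
  then show r: "1 \<le> DIM('a) * (c * (X \<bullet> e))" using assms by (simp add: sheet_def)
  then show r0: "0 < c * (X \<bullet> e)" by (metis (no_types) less_le_trans of_nat_0_less_iff DIM_positive zero_less_mult_pos zero_less_one)
  show "c * (X \<bullet> e) \<le> norm X" using Basis_le_norm[OF assms(2), of X] assms(3) by auto
  have "c * sqrt \<bar>F (proj e X)\<bar> = X \<bullet> e"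
    using F_proj[OF assms(2) F0] assms(3) r0 by (auto simp: real_sqrt_abs)
  then show "graph e c X = X" by (simp add: graph_def proj_def)
qed

lemma graph_eqI:
  assumes "X \<in> sheet e c" "e \<in> Basis" "c = 1 \<or> c = -1" "proj e X = proj e Y"
  shows "graph e c Y = X"
  using sheetD(6)[OF assms(1-3)] assms(4) by (simp add: graph_def)

text \<open>
  On a sheet the height \<open>c (X \<bullet> e)\<close> controls the norm, and the difference of the squares of two heights
  is the difference of the values of \<open>F\<close> at the projections, so the slope is at most \<open>DIM('a)\<close>.
\<close>

lemma sheet_lipschitz:
  assumes X: "X \<in> sheet e c" and Y: "Y \<in> sheet e c" and e: "e \<in> Basis" and c: "c = 1 \<or> c = -1"
  shows "norm (X - Y) \<le> (1 + DIM('a)) * norm (proj e X - proj e Y)"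
proof -
  define a b where "a = c * (X \<bullet> e)" and "b = c * (Y \<bullet> e)"
  let ?p = "proj e X" and ?q = "proj e Y"
  obtain \<sigma> where s: "\<sigma> = 1 \<or> \<sigma> = -1" "\<And>X t. F (X + t *\<^sub>R e) = F X + 2 * t * \<sigma> * (X \<bullet> e) + \<sigma> * t\<^sup>2"
    using sign_of_Basis[OF e] by metis
  have Fp: "F (proj e Z) = - \<sigma> * (Z \<bullet> e)\<^sup>2" if "F Z = 0" for Z
  proof -
    have "F (proj e Z + (Z \<bullet> e) *\<^sub>R e) = F (proj e Z) + \<sigma> * (Z \<bullet> e)\<^sup>2"
      unfolding s(2) using proj_inner[OF e] by simp
    then show ?thesis using that by (simp add: proj_def)
  qed
  have ab: "a\<^sup>2 = (X \<bullet> e)\<^sup>2" "b\<^sup>2 = (Y \<bullet> e)\<^sup>2" using c by (auto simp: a_def b_def)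
  have "\<bar>a\<^sup>2 - b\<^sup>2\<bar> = \<bar>F ?p - F ?q\<bar>"
    using s(1) Fp[OF sheetD(1)[OF X e c]] Fp[OF sheetD(1)[OF Y e c]] ab by auto
  also have "F ?p - F ?q = (?p - ?q) \<bullet> A (?p + ?q)"
    using inner_A[of ?p ?q] by (simp add: F_def A_add inner_simps inner_commute)
  also have "\<bar>\<dots>\<bar> \<le> norm (?p - ?q) * norm (?p + ?q)"
    using Cauchy_Schwarz_ineq2[of "?p - ?q" "A (?p + ?q)"] by (simp add: norm_A)
  also have "norm (?p + ?q) \<le> DIM('a) * (a + b)"
  proof -
    have "norm (proj e Z) \<le> norm Z" for Z
    proof -
      have "(norm (proj e Z))\<^sup>2 = (norm Z)\<^sup>2 - (Z \<bullet> e)\<^sup>2"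
        using norm_add_Pythagorean[of "proj e Z" "(Z \<bullet> e) *\<^sub>R e"] proj_inner[OF e] e
        by (simp add: orthogonal_def proj_def)
      then have "(norm (proj e Z))\<^sup>2 \<le> (norm Z)\<^sup>2" by simp
      then show ?thesis by (rule power2_le_imp_le) simp
    qed
    then have "norm (?p + ?q) \<le> norm X + norm Y" by (intro norm_triangle_le add_mono)
    then show ?thesis using X Y by (simp add: sheet_def a_def b_def algebra_simps)
  qed
  finally have "\<bar>a\<^sup>2 - b\<^sup>2\<bar> \<le> norm (?p - ?q) * (DIM('a) * (a + b))" by (simp add: mult_left_mono)
  moreover have pos: "0 < a + b" using sheetD(4)[OF X e c] sheetD(4)[OF Y e c] by (simp add: a_def b_def)
  moreover have "\<bar>a\<^sup>2 - b\<^sup>2\<bar> = \<bar>a - b\<bar> * (a + b)"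
    using pos by (simp add: power2_eq_square square_diff_square_factored abs_mult)
  ultimately have "\<bar>a - b\<bar> * (a + b) \<le> (DIM('a) * norm (?p - ?q)) * (a + b)" by (simp add: mult.assoc mult.left_commute)
  then have ineq: "\<bar>a - b\<bar> \<le> DIM('a) * norm (?p - ?q)" using pos by simp
  have "X - Y = (?p - ?q) + (X \<bullet> e - Y \<bullet> e) *\<^sub>R e" by (simp add: proj_def algebra_simps)
  then have "norm (X - Y) \<le> norm (?p - ?q) + \<bar>X \<bullet> e - Y \<bullet> e\<bar>"
    using e norm_triangle_ineq[of "?p - ?q" "(X \<bullet> e - Y \<bullet> e) *\<^sub>R e"] by simp
  also have "\<bar>X \<bullet> e - Y \<bullet> e\<bar> = \<bar>a - b\<bar>" using c by (auto simp: a_def b_def)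
  finally show ?thesis using ineq by (simp add: algebra_simps)
qed

text \<open>Exhaustion by balls supplies the boundedness that
  \<open>hausdorff_outer_le_shadow\<close> requires. The shadow is given by an existential
  quantifier; rewriting it as a preimage under the Borel map \<open>graph e c\<close> shows that it
  is Borel.\<close>

lemma emeasure_hausdorff_sheet_le:
  assumes e: "e \<in> Basis" and c: "c = 1 \<or> c = -1" and B: "B \<in> sets borel" "B \<subseteq> sheet e c"
  shows "emeasure (hausdorff_measure (DIM('a) - 1)) B
    \<le> ennreal sheet_const * emeasure lborel {X. X \<bullet> e \<in> {0..1} \<and> graph e c X \<in> B}"
proof -
  note [measurable] = B(1)
  have "emeasure (hausdorff_measure (DIM('a) - 1)) B
      = (SUP n. emeasure (hausdorff_measure (DIM('a) - 1)) (B \<inter> cball 0 (real n)))"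
  proof -
    have "B = (\<Union>n. B \<inter> cball 0 (real n))" by (auto simp: real_arch_simple)
    then show ?thesis
      by (subst SUP_emeasure_incseq) (auto simp: sets_hausdorff_measure incseq_def)
  qed
  also have "\<dots> \<le> ennreal sheet_const * emeasure lborel {X. X \<bullet> e \<in> {0..1} \<and> graph e c X \<in> B}"
  proof (rule SUP_least)
    fix n
    let ?B = "B \<inter> cball 0 (real n)"
    let ?S = "{X. 0 \<le> X \<bullet> e \<and> X \<bullet> e \<le> 1 \<and> (\<exists>Y\<in>?B. Y - (Y \<bullet> e) *\<^sub>R e = X - (X \<bullet> e) *\<^sub>R e)}"
    have S: "?S = {X. X \<bullet> e \<in> {0..1} \<and> graph e c X \<in> ?B}"
    proof -
      have "(\<exists>Y\<in>?B. Y - (Y \<bullet> e) *\<^sub>R e = X - (X \<bullet> e) *\<^sub>R e) \<longleftrightarrow> graph e c X \<in> ?B" for X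
        using graph_eqI[OF _ e c, of _ X] B(2) proj_graph[OF e, of c X] by (metis IntD1 proj_def subsetD)
      then show ?thesis by auto
    qed
    have [measurable]: "?B \<in> sets borel" by auto
    have Sm: "{X. X \<bullet> e \<in> {0..1} \<and> graph e c X \<in> ?B} \<in> sets borel" by measurable
    have "emeasure (hausdorff_measure (DIM('a) - 1)) ?B \<le> hausdorff_outer (DIM('a) - 1) ?B"
      by (rule emeasure_hausdorff_measure_le)
    also have "\<dots> \<le> ennreal sheet_const * emeasure lborel ?S"
      unfolding sheet_const_def
    proof (rule hausdorff_outer_le_shadow)
      show "norm (X - Y) \<le> (1 + real DIM('a)) * norm (X - (X \<bullet> e) *\<^sub>R e - (Y - (Y \<bullet> e) *\<^sub>R e))"
        if "X \<in> ?B" "Y \<in> ?B" for X Y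
        using sheet_lipschitz[OF _ _ e c, of X Y] that B(2) by (auto simp: proj_def)
      show "?S \<in> sets borel" unfolding S by (rule Sm)
    qed (use e dim bounded_subset[OF bounded_cball] in auto)
    also have "emeasure lborel ?S \<le> emeasure lborel {X. X \<bullet> e \<in> {0..1} \<and> graph e c X \<in> B}"
      unfolding S by (rule emeasure_mono) (auto, measurable)
    finally show "emeasure (hausdorff_measure (DIM('a) - 1)) ?B
        \<le> ennreal sheet_const * emeasure lborel {X. X \<bullet> e \<in> {0..1} \<and> graph e c X \<in> B}"
      by (simp add: mult_left_mono)
  qed
  finally show ?thesis .
qed

text \<open>The inequality for sets says that Hausdorff measure on the sheet is dominated, as a
  measure, by the image of a weighted Lebesgue measure under \<open>graph e c\<close>. Integrals of
  all Borel functions then compare at once.\<close>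

lemma nn_integral_hausdorff_sheet_le:
  assumes e: "e \<in> Basis" and c: "c = 1 \<or> c = -1" and [measurable]: "g \<in> borel_measurable borel"
  shows "(\<integral>\<^sup>+X\<in>sheet e c. g X \<partial>hausdorff_measure (DIM('a) - 1))
    \<le> ennreal sheet_const * (\<integral>\<^sup>+X. indicator {0..1} (X \<bullet> e) * (indicator (sheet e c) (graph e c X) * g (graph e c X)) \<partial>lborel)"
proof -
  let ?H = "hausdorff_measure (DIM('a) - 1) :: 'a measure"
  let ?d = "\<lambda>X. ennreal sheet_const * indicator {0..1} (X \<bullet> e) * indicator (sheet e c) (graph e c X)"
  let ?M = "density ?H (indicator (sheet e c))"
  let ?N = "distr (density lborel ?d) borel (graph e c)"
  have MN: "?M \<le> ?N"
  proof (subst le_measure)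
    show "\<forall>B\<in>sets ?M. emeasure ?M B \<le> emeasure ?N B"
    proof
      fix B assume "B \<in> sets ?M"
      then have [measurable]: "B \<in> sets borel" by (simp add: sets_hausdorff_measure)
      have "emeasure ?M B = emeasure ?H (sheet e c \<inter> B)"
        by (subst emeasure_density) (auto simp flip: indicator_inter_arith)
      also have "\<dots> \<le> ennreal sheet_const * emeasure lborel {X. X \<bullet> e \<in> {0..1} \<and> graph e c X \<in> sheet e c \<inter> B}"
        by (intro emeasure_hausdorff_sheet_le e c) auto
      also have "emeasure lborel {X. X \<bullet> e \<in> {0..1} \<and> graph e c X \<in> sheet e c \<inter> B}
          = (\<integral>\<^sup>+X. indicator {X. X \<bullet> e \<in> {0..1} \<and> graph e c X \<in> sheet e c \<inter> B} X \<partial>lborel)"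
        by (subst nn_integral_indicator) (auto, measurable)
      also have "ennreal sheet_const * \<dots> = (\<integral>\<^sup>+X. ennreal sheet_const * indicator {X. X \<bullet> e \<in> {0..1} \<and> graph e c X \<in> sheet e c \<inter> B} X \<partial>lborel)"
        by (rule nn_integral_cmult[symmetric]) measurable
      also have "\<dots> = (\<integral>\<^sup>+X. ?d X * indicator (graph e c -` B \<inter> space lborel) X \<partial>lborel)"
        by (intro nn_integral_cong) (auto simp: indicator_def)
      also have "\<dots> = emeasure (density lborel ?d) (graph e c -` B \<inter> space lborel)"
        using measurable_sets[OF measurable_graph, of B e c] by (subst emeasure_density) auto
      also have "\<dots> = emeasure ?N B" by (subst emeasure_distr) auto
      finally show "emeasure ?M B \<le> emeasure ?N B" .
    qed
  qed (simp add: sets_hausdorff_measure)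
  have "(\<integral>\<^sup>+X\<in>sheet e c. g X \<partial>?H) = (\<integral>\<^sup>+X. g X \<partial>?M)"
    by (subst nn_integral_density) (auto simp: mult.commute)
  also have "\<dots> \<le> (\<integral>\<^sup>+X. g X \<partial>?N)"
    by (rule nn_integral_mono_measure[OF _ MN]) (simp add: sets_hausdorff_measure)
  also have "\<dots> = (\<integral>\<^sup>+X. ?d X * g (graph e c X) \<partial>lborel)"
    by (simp add: nn_integral_distr nn_integral_density)
  also have "\<dots> = (\<integral>\<^sup>+X. ennreal sheet_const * (indicator {0..1} (X \<bullet> e) * (indicator (sheet e c) (graph e c X) * g (graph e c X))) \<partial>lborel)"
    by (intro nn_integral_cong) (simp add: mult_ac)
  also have "\<dots> = ennreal sheet_const * (\<integral>\<^sup>+X. indicator {0..1} (X \<bullet> e) * (indicator (sheet e c) (graph e c X) * g (graph e c X)) \<partial>lborel)"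
    by (rule nn_integral_cmult) measurable
  finally show ?thesis .
qed

text \<open>The coordinate of largest modulus serves, since |X| is at most the sum of the moduli of
  all coordinates.\<close>

lemma sheets_cover:
  assumes "F X = 0"
  shows "\<exists>e\<in>Basis. \<exists>c\<in>{1,-1}. X \<in> sheet e c"
proof -
  define m where "m = Max ((\<lambda>b. \<bar>X \<bullet> b\<bar>) ` Basis)"
  have "m \<in> (\<lambda>b. \<bar>X \<bullet> b\<bar>) ` Basis" unfolding m_def by (intro Max_in) auto
  then obtain e where e: "e \<in> Basis" "m = \<bar>X \<bullet> e\<bar>" by auto
  have "norm X \<le> (\<Sum>b\<in>Basis. \<bar>X \<bullet> b\<bar>)" by (rule norm_le_l1)
  also have "\<dots> \<le> (\<Sum>b\<in>(Basis::'a set). m)" by (intro sum_mono) (simp add: m_def)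
  finally have "norm X \<le> DIM('a) * \<bar>X \<bullet> e\<bar>" using e by simp
  then have "X \<in> sheet e (if X \<bullet> e \<ge> 0 then 1 else -1)" using assms by (auto simp: sheet_def)
  then show ?thesis using e(1) by (intro bexI[of _ e]) (auto split: if_splits)
qed

text \<open>Only the side F < 0 is taken, so that the variable with the minus sign dominates the
  others throughout the shell.\<close>

definition thick :: "real \<Rightarrow> 'a set" where "thick \<epsilon> = {X. - \<epsilon> < F X \<and> F X < 0}"

lemma sets_thick [measurable]: "thick \<epsilon> \<in> sets borel"
  unfolding thick_def by measurable

text \<open>The line through a sheet point Y in direction e crosses the zero set with slope 2 r,
  where r is the height of Y. Next to Y it runs inside the shell of thickness 1/(m+1) for a length
  of at least 1/(3 r (m+1)), and G stays near G Y there. As the gradient has norm at least 2 r, the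
  loss is the factor 3/2.\<close>

lemma le_liminf_thick:
  fixes G :: "'a \<Rightarrow> ennreal"
  assumes e: "e \<in> Basis" and c: "c = 1 \<or> c = -1" and G: "continuous_on UNIV G"
    and X: "graph e c X \<in> sheet e c"
  shows "G (graph e c X) / ennreal (norm (gradient F (graph e c X)))
    \<le> liminf (\<lambda>m. ennreal (3/2) * (ennreal (real (Suc m)) * (\<integral>\<^sup>+t. indicator (thick (1 / real (Suc m))) (X + t *\<^sub>R e) * G (X + t *\<^sub>R e) \<partial>lborel)))"
  unfolding le_Liminf_iff
proof (intro allI impI)
  have Gm [measurable]: "G \<in> borel_measurable borel" using G by (rule borel_measurable_continuous_onI)
  define Y where "Y = graph e c X"
  define r where "r = c * (Y \<bullet> e)"
  note Y = sheetD[OF X e c, folded Y_def, folded r_def]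
  fix y assume y: "y < G (graph e c X) / ennreal (norm (gradient F (graph e c X)))"
  have nY: "norm (gradient F (graph e c X)) = 2 * norm Y" unfolding norm_gradient Y_def ..
  have pos: "0 < 2 * norm Y" using Y(2) by linarith
  have "y * ennreal (2 * norm Y) < G Y"
  proof (rule ccontr)
    assume "\<not> ?thesis"
    then have "G Y / ennreal (2 * norm Y) \<le> y"
      using pos by (intro divide_le_posI_ennreal) (auto simp: mult.commute)
    then show False using y nY by (simp add: Y_def)
  qed
  \<comment> \<open>The value y' leaves room below G Y, so that it is still a lower bound for G near
    Y.\<close>
  then obtain y' where y': "y * ennreal (2 * norm Y) < y'" "y' < G Y" using dense by blast
  obtain \<sigma> where s: "\<sigma> = 1 \<or> \<sigma> = -1" "\<And>X t. F (X + t *\<^sub>R e) = F X + 2 * t * \<sigma> * (X \<bullet> e) + \<sigma> * t\<^sup>2"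
    using sign_of_Basis[OF e] by metis
  \<comment> \<open>Moving from Y by a small step against the direction \<open>d *\<^sub>R e\<close>
    makes F negative.\<close>
  define d where "d = \<sigma> * c"
  have d: "d = 1 \<or> d = -1" using s(1) c by (auto simp: d_def)
  define t0 where "t0 = Y \<bullet> e - X \<bullet> e"
  have XY: "X + t *\<^sub>R e = Y + (t - t0) *\<^sub>R e" for t
  proof -
    have "Y - (Y \<bullet> e) *\<^sub>R e = X - (X \<bullet> e) *\<^sub>R e"
      using proj_graph[OF e, of c X] by (simp add: proj_def Y_def)
    then have "Y = X + t0 *\<^sub>R e" by (simp add: t0_def algebra_simps)
    then show ?thesis by (simp add: algebra_simps)
  qed
  have FY: "F (Y + (- d * k) *\<^sub>R e) = k\<^sup>2 * \<sigma> - 2 * r * k" for k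
  proof -
    have "2 * (- d * k) * \<sigma> * (Y \<bullet> e) = - 2 * r * k" using s(1) by (auto simp: d_def r_def)
    moreover have "\<sigma> * (- d * k)\<^sup>2 = k\<^sup>2 * \<sigma>" using d by auto
    moreover have "F (Y + (- d * k) *\<^sub>R e) = F Y + 2 * (- d * k) * \<sigma> * (Y \<bullet> e) + \<sigma> * (- d * k)\<^sup>2"
      by (rule s(2))
    ultimately show ?thesis using Y(1) by linarith
  qed
  have "open (G -` {y'<..})" using G by (simp add: continuous_on_open_vimage)
  moreover have "Y \<in> G -` {y'<..}" using y' by simp
  ultimately obtain \<rho> where \<rho>: "\<rho> > 0" "ball Y \<rho> \<subseteq> G -` {y'<..}" using open_contains_ball by blast
  define \<eta>0 where "\<eta>0 = min r \<rho>"
  have \<eta>0: "\<eta>0 > 0" using Y(4) \<rho>(1) by (simp add: \<eta>0_def)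
  \<comment> \<open>For k < r the quadratic term of F is below r k in modulus, so F lies between -3
    r k and -r k at distance k. This length keeps the first bound above -1/(m+1).\<close>
  define \<eta> where "\<eta> m = 1 / (real (Suc m) * (3 * r))" for m
  have \<eta>pos: "\<eta> m > 0" for m using Y(4) by (simp add: \<eta>_def)
  have "\<eta> \<longlonglongrightarrow> 0"
  proof -
    have "(\<lambda>m. (1 / (3 * r)) * (1 / real (Suc m))) \<longlonglongrightarrow> (1 / (3 * r)) * 0"
      by (intro tendsto_mult tendsto_const) (use LIMSEQ_inverse_real_of_nat in \<open>simp add: inverse_eq_divide\<close>)
    then show ?thesis by (simp add: \<eta>_def[abs_def] mult.commute)
  qed
  then have ev: "eventually (\<lambda>m. \<eta> m < \<eta>0) sequentially" using \<eta>0 by (auto dest: order_tendstoD)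
  show "\<forall>\<^sub>F m in sequentially. y < ennreal (3/2) * (ennreal (real (Suc m)) * (\<integral>\<^sup>+t. indicator (thick (1 / real (Suc m))) (X + t *\<^sub>R e) * G (X + t *\<^sub>R e) \<partial>lborel))"
    using ev
  proof eventually_elim
    fix m assume m: "\<eta> m < \<eta>0"
    define J where "J = {t. 0 < d * (t0 - t) \<and> d * (t0 - t) < \<eta> m}"
    have Jeq: "J = (if d = 1 then {t0 - \<eta> m<..<t0} else {t0<..<t0 + \<eta> m})" using d by (auto simp: J_def)
    have [measurable]: "J \<in> sets borel" by (simp add: Jeq)
    have J: "emeasure lborel J = ennreal (\<eta> m)" using \<eta>pos[of m] by (simp add: Jeq)
    have "y' * indicator J t \<le> indicator (thick (1 / real (Suc m))) (X + t *\<^sub>R e) * G (X + t *\<^sub>R e)" for t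
    proof (cases "t \<in> J")
      case True
      define k where "k = d * (t0 - t)"
      have k: "0 < k" "k < \<eta> m" using True by (auto simp: J_def k_def)
      have kr: "k < r" "k < \<rho>" using k m by (auto simp: \<eta>0_def)
      have Xt: "X + t *\<^sub>R e = Y + (- d * k) *\<^sub>R e" using d unfolding XY by (auto simp: k_def algebra_simps)
      have "dist Y (X + t *\<^sub>R e) < \<rho>" using d k(1) kr e unfolding Xt by (auto simp: dist_norm)
      then have "y' < G (X + t *\<^sub>R e)" using \<rho>(2) by auto
      moreover have "X + t *\<^sub>R e \<in> thick (1 / real (Suc m))"
      proof -
        have k2: "k\<^sup>2 < r * k" using k(1) kr by (simp add: power2_eq_square)
        have "3 * (r * k) < 1 / real (Suc m)"
          using k(2) Y(4) by (simp add: \<eta>_def pos_less_divide_eq mult_ac del: of_nat_Suc)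
        moreover have "\<bar>k\<^sup>2 * \<sigma>\<bar> = k\<^sup>2" using s(1) by auto
        ultimately show ?thesis using k2 unfolding thick_def mem_Collect_eq Xt FY by linarith
      qed
      ultimately show ?thesis using True by (simp add: less_imp_le)
    qed simp
    then have "(\<integral>\<^sup>+t. y' * indicator J t \<partial>lborel) \<le> (\<integral>\<^sup>+t. indicator (thick (1 / real (Suc m))) (X + t *\<^sub>R e) * G (X + t *\<^sub>R e) \<partial>lborel)"
      by (rule nn_integral_mono)
    then have I: "y' * ennreal (\<eta> m) \<le> (\<integral>\<^sup>+t. indicator (thick (1 / real (Suc m))) (X + t *\<^sub>R e) * G (X + t *\<^sub>R e) \<partial>lborel)"
      by (simp add: nn_integral_cmult_indicator J)
    have "y < y' / ennreal (2 * norm Y)"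
    proof (rule ccontr)
      assume "\<not> ?thesis"
      then have "y' / ennreal (2 * norm Y) \<le> y" by simp
      then have "y' / ennreal (2 * norm Y) * ennreal (2 * norm Y) \<le> y * ennreal (2 * norm Y)" by (rule mult_right_mono) simp
      then show False using y'(1) pos by (simp add: ennreal_divide_times ennreal_mult_divide_eq)
    qed
    also have "y' / ennreal (2 * norm Y) \<le> y' * ennreal (1 / (2 * r))"
      using Y(4,5) pos
      by (auto simp: divide_ennreal_def inverse_ennreal inverse_eq_divide intro!: mult_left_mono ennreal_leI divide_left_mono)
    also have "\<dots> = ennreal (3/2) * (ennreal (real (Suc m)) * (y' * ennreal (\<eta> m)))"
    proof -
      have "real (Suc m) * \<eta> m = 1 / (3 * r)" by (simp add: \<eta>_def del: of_nat_Suc)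
      then have "1 / (2 * r) = 3/2 * (real (Suc m) * \<eta> m)" by simp
      then have "ennreal (1 / (2 * r)) = ennreal (3/2) * (ennreal (real (Suc m)) * ennreal (\<eta> m))"
        using \<eta>pos[of m] by (simp only: ennreal_mult of_nat_0_le_iff less_imp_le mult_nonneg_nonneg zero_le_divide_iff zero_le_numeral simp_thms)
      then show ?thesis by (simp only: mult_ac)
    qed
    also have "\<dots> \<le> ennreal (3/2) * (ennreal (real (Suc m)) * (\<integral>\<^sup>+t. indicator (thick (1 / real (Suc m))) (X + t *\<^sub>R e) * G (X + t *\<^sub>R e) \<partial>lborel))"
      by (intro mult_left_mono I) auto
    finally show "y < ennreal (3/2) * (ennreal (real (Suc m)) * (\<integral>\<^sup>+t. indicator (thick (1 / real (Suc m))) (X + t *\<^sub>R e) * G (X + t *\<^sub>R e) \<partial>lborel))" .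
  qed
qed

text \<open>
  The delta function is the limit of \<open>1/\<epsilon>\<close> times the indicator of \<open>- \<epsilon> < F < 0\<close>, and for an upper bound
  Fatou's lemma suffices.
\<close>

lemma delta_integral_le:
  fixes G :: "'a \<Rightarrow> ennreal"
  assumes G: "continuous_on UNIV G"
    and B: "\<And>\<epsilon>. \<epsilon> > 0 \<Longrightarrow> (\<integral>\<^sup>+X\<in>thick \<epsilon>. G X \<partial>lborel) \<le> ennreal \<epsilon> * B"
  shows "delta_integral F G \<le> ennreal (3 * DIM('a) * sheet_const) * B"
proof -
  let ?H = "hausdorff_measure (DIM('a) - 1) :: 'a measure"
  let ?g = "\<lambda>X. G X / ennreal (norm (gradient F X))"
  let ?W = "\<lambda>e m X. ennreal (3/2) * (ennreal (real (Suc m)) * (\<integral>\<^sup>+t. indicator (thick (1 / real (Suc m))) (X + t *\<^sub>R e) * G (X + t *\<^sub>R e) \<partial>lborel))"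
  have Gm [measurable]: "G \<in> borel_measurable borel" using G by (rule borel_measurable_continuous_onI)
  have gm [measurable]: "?g \<in> borel_measurable borel" unfolding norm_gradient by measurable
  have Hm: "f \<in> borel_measurable borel \<Longrightarrow> f \<in> borel_measurable ?H" for f :: "'a \<Rightarrow> ennreal"
    using sets_hausdorff_measure measurable_cong_sets by blast
  have sheet: "(\<integral>\<^sup>+X\<in>sheet e c. ?g X \<partial>?H) \<le> ennreal (sheet_const * 3 / 2) * B" if e: "e \<in> Basis" and "c \<in> {1,-1}" for e c
  proof -
    have c: "c = 1 \<or> c = -1" using that by auto
    have "(\<integral>\<^sup>+X\<in>sheet e c. ?g X \<partial>?H) \<le> ennreal sheet_const * (\<integral>\<^sup>+X. indicator {0..1} (X \<bullet> e) * (indicator (sheet e c) (graph e c X) * ?g (graph e c X)) \<partial>lborel)"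
      by (rule nn_integral_hausdorff_sheet_le[OF e c gm])
    also have "(\<integral>\<^sup>+X. indicator {0..1} (X \<bullet> e) * (indicator (sheet e c) (graph e c X) * ?g (graph e c X)) \<partial>lborel)
        \<le> (\<integral>\<^sup>+X. liminf (\<lambda>m. indicator {0..1} (X \<bullet> e) * ?W e m X) \<partial>lborel)"
    proof (rule nn_integral_mono)
      fix X :: 'a
      show "indicator {0..1} (X \<bullet> e) * (indicator (sheet e c) (graph e c X) * ?g (graph e c X)) \<le> liminf (\<lambda>m. indicator {0..1} (X \<bullet> e) * ?W e m X)"
        using le_liminf_thick[OF e c G, of X] by (auto simp: indicator_def split: if_splits)
    qed
    also have "\<dots> \<le> liminf (\<lambda>m. \<integral>\<^sup>+X. indicator {0..1} (X \<bullet> e) * ?W e m X \<partial>lborel)"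
      by (rule nn_integral_liminf) measurable
    also have "\<dots> \<le> liminf (\<lambda>m::nat. ennreal (3/2) * B)"
    proof (intro Liminf_mono eventuallyI)
      fix m
      have "(\<integral>\<^sup>+X. indicator {0..1} (X \<bullet> e) * ?W e m X \<partial>lborel)
        = (\<integral>\<^sup>+X. ennreal (3/2) * (ennreal (real (Suc m)) * (indicator {0..1} (X \<bullet> e) * (\<integral>\<^sup>+t. indicator (thick (1 / real (Suc m))) (X + t *\<^sub>R e) * G (X + t *\<^sub>R e) \<partial>lborel))) \<partial>lborel)"
        by (intro nn_integral_cong) (simp only: mult_ac)
      also have "\<dots> = ennreal (3/2) * (ennreal (real (Suc m)) * (\<integral>\<^sup>+X. indicator {0..1} (X \<bullet> e) * (\<integral>\<^sup>+t. indicator (thick (1 / real (Suc m))) (X + t *\<^sub>R e) * G (X + t *\<^sub>R e) \<partial>lborel) \<partial>lborel))"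
        by (subst nn_integral_cmult, measurable)+
      also have "(\<integral>\<^sup>+X. indicator {0..1} (X \<bullet> e) * (\<integral>\<^sup>+t. indicator (thick (1 / real (Suc m))) (X + t *\<^sub>R e) * G (X + t *\<^sub>R e) \<partial>lborel) \<partial>lborel)
         = (\<integral>\<^sup>+X. indicator (thick (1 / real (Suc m))) X * G X \<partial>lborel)"
        by (rule nn_integral_shift_average) (use e in measurable)
      also have "\<dots> = (\<integral>\<^sup>+X\<in>thick (1 / real (Suc m)). G X \<partial>lborel)" by (simp only: mult.commute)
      also have "\<dots> \<le> ennreal (1 / real (Suc m)) * B" by (rule B) simp
      finally have "(\<integral>\<^sup>+X. indicator {0..1} (X \<bullet> e) * ?W e m X \<partial>lborel) \<le> ennreal (3/2) * (ennreal (real (Suc m)) * (ennreal (1 / real (Suc m)) * B))"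
        by (simp add: mult_left_mono)
      also have "ennreal (real (Suc m)) * (ennreal (1 / real (Suc m)) * B) = B"
        unfolding mult.assoc[symmetric] by (subst ennreal_mult[symmetric]) (auto simp del: of_nat_Suc)
      finally show "(\<integral>\<^sup>+X. indicator {0..1} (X \<bullet> e) * ?W e m X \<partial>lborel) \<le> ennreal (3/2) * B" .
    qed
    also have "\<dots> = ennreal (3/2) * B" by (simp add: Liminf_const)
    finally have "(\<integral>\<^sup>+X\<in>sheet e c. ?g X \<partial>?H) \<le> ennreal sheet_const * (ennreal (3/2) * B)"
      by (simp add: mult_left_mono)
    also have "\<dots> = ennreal (sheet_const * 3 / 2) * B"
      using sheet_const_nonneg by (simp add: mult.assoc[symmetric] ennreal_mult[symmetric])
    finally show ?thesis .
  qed
  have "delta_integral F G = (\<integral>\<^sup>+X\<in>{X. F X = 0}. ?g X \<partial>?H)" by (simp add: delta_integral_def)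
  \<comment> \<open>The sheets overlap; counting a point once for each sheet that contains it only
    enlarges the integral.\<close>
  also have "\<dots> \<le> (\<integral>\<^sup>+X. (\<Sum>(e,c)\<in>Basis \<times> {1,-1}. ?g X * indicator (sheet e c) X) \<partial>?H)"
  proof (rule nn_integral_mono)
    fix X
    show "?g X * indicator {X. F X = 0} X \<le> (\<Sum>(e,c)\<in>Basis \<times> {1,-1}. ?g X * indicator (sheet e c) X)"
    proof (cases "F X = 0")
      case True
      then obtain e c where ec: "(e,c) \<in> Basis \<times> {1,-1}" "X \<in> sheet e c" using sheets_cover by blast
      then have "?g X * indicator {X. F X = 0} X = (case (e,c) of (e,c) \<Rightarrow> ?g X * indicator (sheet e c) X)"
        using True by simp
      also have "\<dots> \<le> (\<Sum>(e,c)\<in>Basis \<times> {1,-1}. ?g X * indicator (sheet e c) X)"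
        by (rule member_le_sum) (use ec in auto)
      finally show ?thesis .
    qed simp
  qed
  also have "\<dots> = (\<Sum>(e,c)\<in>Basis \<times> {1,-1}. (\<integral>\<^sup>+X\<in>sheet e c. ?g X \<partial>?H))"
    by (subst nn_integral_sum) (auto simp: case_prod_unfold intro!: Hm)
  also have "\<dots> \<le> (\<Sum>(e,c)\<in>(Basis :: 'a set) \<times> {1,-1::real}. ennreal (sheet_const * 3 / 2) * B)"
    by (intro sum_mono) (use sheet in auto)
  also have "\<dots> = of_nat (card ((Basis :: 'a set) \<times> {1,-1::real})) * (ennreal (sheet_const * 3 / 2) * B)"
    by (simp add: case_prod_unfold)
  \<comment> \<open>The 2 D sheets with the factor 3/2 each produce the constant 3 D.\<close>
  also have "card ((Basis :: 'a set) \<times> {1,-1::real}) = DIM('a) * 2" by (simp add: card_cartesian_product)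
  also have "of_nat (DIM('a) * 2) * (ennreal (sheet_const * 3 / 2) * B) = ennreal (3 * DIM('a) * sheet_const) * B"
  proof -
    have "of_nat (DIM('a) * 2) * ennreal (sheet_const * 3 / 2) = ennreal (real (DIM('a) * 2) * (sheet_const * 3 / 2))"
      using sheet_const_nonneg unfolding ennreal_of_nat_eq_real_of_nat by (intro ennreal_mult[symmetric]) auto
    also have "real (DIM('a) * 2) * (sheet_const * 3 / 2) = 3 * DIM('a) * sheet_const" by simp
    finally show ?thesis by (simp only: mult.assoc[symmetric])
  qed
  finally show ?thesis .
qed

end

subsection \<open>Power weights\<close>

lemma neg_pow_pos: "r > 0 \<Longrightarrow> neg_pow r s = ennreal (r powr (- s))"
  by (simp add: neg_pow_def inverse_ennreal powr_minus)

lemma neg_pow_zero [simp]: "neg_pow 0 s = top"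
  by (simp add: neg_pow_def)

lemma neg_pow_gt_0 [simp]: "0 < neg_pow r s"
  by (simp add: neg_pow_def ennreal_inverse_positive less_top)

lemma neg_pow_neq_0 [simp]: "neg_pow r s \<noteq> 0"
  by (metis neg_pow_gt_0 less_irrefl)

lemma neg_pow_add: "0 \<le> r \<Longrightarrow> neg_pow r a * neg_pow r b = neg_pow r (a + b)"
  by (cases "r = 0") (auto simp: neg_pow_pos ennreal_mult[symmetric] powr_add powr_minus powr_diff divide_inverse)

lemma neg_pow_mult: "0 \<le> x \<Longrightarrow> 0 \<le> y \<Longrightarrow> neg_pow (x * y) s = neg_pow x s * neg_pow y s"
  by (simp add: neg_pow_def powr_mult ennreal_mult ennreal_inverse_mult)

lemma neg_pow_antimono: "0 \<le> x \<Longrightarrow> x \<le> y \<Longrightarrow> 0 \<le> s \<Longrightarrow> neg_pow y s \<le> neg_pow x s"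
  by (cases "x = 0") (auto simp: neg_pow_pos intro!: ennreal_leI powr_mono2')

lemma neg_pow_sum:
  assumes "finite I" "r > 0"
  shows "neg_pow r (\<Sum>i\<in>I. \<gamma> i) = (\<Prod>i\<in>I. neg_pow r (\<gamma> i))"
  using assms
proof (induction I rule: finite_induct)
  case empty
  then show ?case by (simp add: neg_pow_pos)
next
  case (insert i I)
  then show ?case by (simp add: neg_pow_add[symmetric])
qed

lemma measurable_neg_pow [measurable]:
  assumes [measurable]: "f \<in> borel_measurable M"
  shows "(\<lambda>x. neg_pow (f x) s) \<in> borel_measurable M"
  unfolding neg_pow_def by measurable

text \<open>The value infinity at 0 is the limit there when s > 0, so the weight is continuous
  across its singularity. This makes the integrands of the kernels admissible in
  \<open>delta_integral_le\<close>.\<close>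

lemma continuous_on_neg_pow [continuous_intros]:
  assumes "continuous_on S f" "\<And>x. x \<in> S \<Longrightarrow> 0 \<le> f x" "0 < s"
  shows "continuous_on S (\<lambda>x. neg_pow (f x) s)"
  unfolding neg_pow_def using assms
  by (intro continuous_on_inverse_ennreal continuous_on_ennreal continuous_on_powr' continuous_intros) auto

lemma neg_pow_le_scaled:
  assumes "0 \<le> m" "m \<le> c * x" "0 < c" "0 \<le> s"
  shows "neg_pow x s \<le> ennreal (c powr s) * neg_pow m s"
proof -
  have "0 \<le> x" using assms by (metis mult_nonneg_nonneg order_trans zero_le_mult_iff less_le_not_le linorder_linear)
  have "neg_pow x s \<le> neg_pow (inverse c * m) s"
    using assms \<open>0 \<le> x\<close> by (intro neg_pow_antimono) (auto simp: field_simps)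
  also have "\<dots> = ennreal (c powr s) * neg_pow m s"
    using assms by (simp add: neg_pow_mult neg_pow_pos powr_minus inverse_powr)
  finally show ?thesis .
qed

section \<open>Radial integrals against measures of polynomial growth\<close>

lemma dyadic_interval:
  assumes "1 \<le> (y::real)"
  obtains k :: nat where "2 powr real k \<le> y" "y < 2 powr (real k + 1)"
proof -
  define l where "l = log 2 y"
  have l: "l \<ge> 0" "y = 2 powr l" using assms by (auto simp: l_def)
  have "real (nat \<lfloor>l\<rfloor>) \<le> l" "l < real (nat \<lfloor>l\<rfloor>) + 1" using l(1) by linarith+
  then show thesis using that[of "nat \<lfloor>l\<rfloor>"] l(2) by simp
qed

lemma suminf_geometric_ennreal:
  assumes "0 \<le> c" "0 \<le> q" "q < (1::real)"
  shows "(\<Sum>k. ennreal (c * q ^ k)) = ennreal (c * (1 / (1 - q)))"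
  using assms by (intro suminf_ennreal_eq sums_mult geometric_sums) auto

text \<open>The two summands come from the geometric series over the dyadic shells inside and
  outside the radius R in \<open>nn_integral_growth\<close>; their ratios are below 1 when a < d and
  d < a + b.\<close>

definition growth_const :: "real \<Rightarrow> real \<Rightarrow> real \<Rightarrow> real" where
  "growth_const a b d = 2 powr a * (1 / (1 - 2 powr (- (d - a)))) + 2 powr d * (1 / (1 - 2 powr (- (a + b - d))))"

lemma le_suminf_ennreal: "f k \<le> (\<Sum>k. f k :: ennreal)"
  using sum_le_suminf[of f "{k}"] by (simp add: summableI)

text \<open>The growth exponent d is kept general because two measures will be inserted: Lebesgue
  measure with d = n, and its restriction to a thin slab with d = n - 1, where the width of the slab
  enters only through K.\<close>

lemma nn_integral_growth:
  fixes \<mu> :: "'a::euclidean_space measure"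
  assumes [measurable_cong]: "sets \<mu> = sets borel"
    and growth: "\<And>r. r > 0 \<Longrightarrow> emeasure \<mu> (cball 0 r) \<le> ennreal (K * r powr d)"
    and K: "0 \<le> K" and a: "0 \<le> a" "a < d" and b: "0 \<le> b" "d < a + b" and R: "R > 0"
  shows "(\<integral>\<^sup>+x. neg_pow (norm x) a * neg_pow (max R (norm x)) b \<partial>\<mu>)
    \<le> ennreal (growth_const a b d * K) * neg_pow R (a + b - d)"
proof -
  define B where "B k = cball (0::'a) (R * 2 powr (- real k))" for k :: nat
  define B' where "B' k = cball (0::'a) (R * 2 powr (real k + 1))" for k :: nat
  define u where "u k = (R * 2 powr (- (real k + 1))) powr (- a) * R powr (- b)" for k :: nat
  define v where "v k = (R * 2 powr real k) powr (- (a + b))" for k :: nat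
  have [measurable]: "B k \<in> sets borel" "B' k \<in> sets borel" for k by (auto simp: B_def B'_def)
  have uv: "0 \<le> u k" "0 \<le> v k" for k by (auto simp: u_def v_def)
  \<comment> \<open>The origin lies in no dyadic shell, and the weight may be infinite there; since
    d > 0, the growth bound makes it a null set.\<close>
  have zero: "emeasure \<mu> {0} = 0"
  proof -
    have "emeasure \<mu> {0} \<le> 0"
    proof (rule tendsto_lowerbound)
      have "((\<lambda>r. K * r powr d) \<longlongrightarrow> K * 0 powr d) (at_right 0)"
        using a by (intro tendsto_intros) (auto simp: eventually_at_right_less less_imp_le intro!: eventually_mono[OF eventually_at_right_less])
      then show "((\<lambda>r. ennreal (K * r powr d)) \<longlongrightarrow> 0) (at_right 0)"
        using tendsto_ennrealI[of _ "K * 0 powr d"] by simp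
      have "emeasure \<mu> {0} \<le> ennreal (K * r powr d)" if "r > 0" for r
      proof -
        have "emeasure \<mu> {0} \<le> emeasure \<mu> (cball 0 r)" using that assms(1) by (intro emeasure_mono) auto
        also note growth[OF that]
        finally show ?thesis .
      qed
      then show "\<forall>\<^sub>F r in at_right 0. emeasure \<mu> {0} \<le> ennreal (K * r powr d)"
        by (intro eventually_at_rightI[of 0 1]) auto
    qed simp
    then show ?thesis by simp
  qed
  have AE0: "AE x in \<mu>. x \<noteq> 0"
    by (rule AE_I[of _ _ "{0}"]) (use zero assms(1) in \<open>auto\<close>)
  \<comment> \<open>The term of the shell containing x already suffices. Balls replace shells so
    that the growth hypothesis applies to each term.\<close>
  have pw: "neg_pow (norm x) a * neg_pow (max R (norm x)) b
      \<le> (\<Sum>k. ennreal (u k) * indicator (B k) x) + (\<Sum>k. ennreal (v k) * indicator (B' k) x)" if x: "x \<noteq> 0" for x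
  proof (cases "norm x \<le> R")
    case True
    have "1 \<le> R / norm x" using True x by simp
    then obtain k :: nat where k: "2 powr real k \<le> R / norm x" "R / norm x < 2 powr (real k + 1)"
      by (rule dyadic_interval)
    have k1: "norm x \<le> R * 2 powr (- real k)" using k(1) x by (simp add: powr_minus field_simps)
    have k2: "R * 2 powr (- (real k + 1)) \<le> norm x" using k(2) x unfolding powr_minus by (simp add: field_simps)
    have "neg_pow (norm x) a * neg_pow (max R (norm x)) b \<le> neg_pow (R * 2 powr (- (real k + 1))) a * neg_pow R b"
      using a b(1) R True k2 by (intro mult_mono neg_pow_antimono) auto
    also have "\<dots> = ennreal (u k) * indicator (B k) x"
      using R k1 by (simp add: neg_pow_pos u_def B_def ennreal_mult[symmetric])
    also have "\<dots> \<le> (\<Sum>k. ennreal (u k) * indicator (B k) x)" by (rule le_suminf_ennreal)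
    finally show ?thesis by (rule order_trans) simp
  next
    case False
    have "1 \<le> norm x / R" using False R by simp
    then obtain k :: nat where k: "2 powr real k \<le> norm x / R" "norm x / R < 2 powr (real k + 1)"
      by (rule dyadic_interval)
    have k1: "norm x \<le> R * 2 powr (real k + 1)" using k(2) R by (simp add: field_simps)
    have k2: "R * 2 powr real k \<le> norm x" using k(1) R by (simp add: field_simps)
    have "neg_pow (norm x) a * neg_pow (max R (norm x)) b = neg_pow (norm x) (a + b)"
      using False by (simp add: max_def neg_pow_add)
    also have "\<dots> \<le> neg_pow (R * 2 powr real k) (a + b)"
      using a b R k2 by (intro neg_pow_antimono) auto
    also have "\<dots> = ennreal (v k) * indicator (B' k) x"
      using R k1 by (simp add: neg_pow_pos v_def B'_def)
    also have "\<dots> \<le> (\<Sum>k. ennreal (v k) * indicator (B' k) x)" by (rule le_suminf_ennreal)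
    finally show ?thesis by (rule order_trans) simp
  qed
  have "(\<integral>\<^sup>+x. neg_pow (norm x) a * neg_pow (max R (norm x)) b \<partial>\<mu>)
      \<le> (\<integral>\<^sup>+x. (\<Sum>k. ennreal (u k) * indicator (B k) x) + (\<Sum>k. ennreal (v k) * indicator (B' k) x) \<partial>\<mu>)"
    using AE0 by (intro nn_integral_mono_AE) (auto intro: pw)
  also have "\<dots> = (\<Sum>k. ennreal (u k) * emeasure \<mu> (B k)) + (\<Sum>k. ennreal (v k) * emeasure \<mu> (B' k))"
    by (subst nn_integral_add) (auto simp: nn_integral_suminf nn_integral_cmult_indicator)
  also have "(\<Sum>k. ennreal (u k) * emeasure \<mu> (B k)) \<le> (\<Sum>k. ennreal ((K * 2 powr a * R powr (- (a + b - d))) * (2 powr (- (d - a))) ^ k))"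
  proof (intro suminf_le summableI)
    fix k :: nat
    have "ennreal (u k) * emeasure \<mu> (B k) \<le> ennreal (u k) * ennreal (K * (R * 2 powr (- real k)) powr d)"
      unfolding B_def using R by (intro mult_left_mono growth) auto
    also have "\<dots> = ennreal (u k * (K * (R * 2 powr (- real k)) powr d))" using uv by (simp add: ennreal_mult')
    also have "u k * (K * (R * 2 powr (- real k)) powr d)
      = K * (R powr (- a) * R powr (- b) * R powr d) * (2 powr (- (real k + 1) * - a) * 2 powr (- real k * d))"
      using R by (simp add: u_def powr_mult powr_powr)
    also have "\<dots> = K * R powr (- (a + b - d)) * 2 powr (a + (- (d - a)) * real k)"
      by (simp add: powr_add[symmetric] algebra_simps)
    also have "\<dots> = (K * 2 powr a * R powr (- (a + b - d))) * (2 powr (- (d - a))) ^ k"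
      unfolding powr_add powr_powr[symmetric] by (simp add: powr_realpow)
    finally show "ennreal (u k) * emeasure \<mu> (B k) \<le> ennreal ((K * 2 powr a * R powr (- (a + b - d))) * (2 powr (- (d - a))) ^ k)" .
  qed
  also have "\<dots> = ennreal ((K * 2 powr a * R powr (- (a + b - d))) * (1 / (1 - 2 powr (- (d - a)))))"
    using K a by (intro suminf_geometric_ennreal) (auto simp: powr_less_one)
  also have "(\<Sum>k. ennreal (v k) * emeasure \<mu> (B' k)) \<le> (\<Sum>k. ennreal ((K * 2 powr d * R powr (- (a + b - d))) * (2 powr (- (a + b - d))) ^ k))"
  proof (intro suminf_le summableI)
    fix k :: nat
    have "ennreal (v k) * emeasure \<mu> (B' k) \<le> ennreal (v k) * ennreal (K * (R * 2 powr (real k + 1)) powr d)"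
      unfolding B'_def using R by (intro mult_left_mono growth) auto
    also have "\<dots> = ennreal (v k * (K * (R * 2 powr (real k + 1)) powr d))" using uv by (simp add: ennreal_mult')
    also have "v k * (K * (R * 2 powr (real k + 1)) powr d)
      = K * (R powr (- (a + b)) * R powr d) * (2 powr (real k * - (a + b)) * 2 powr ((real k + 1) * d))"
      using R by (simp add: v_def powr_mult powr_powr)
    also have "\<dots> = K * R powr (- (a + b - d)) * 2 powr (d + (- (a + b - d)) * real k)"
      by (simp add: powr_add[symmetric] algebra_simps)
    also have "\<dots> = (K * 2 powr d * R powr (- (a + b - d))) * (2 powr (- (a + b - d))) ^ k"
      unfolding powr_add powr_powr[symmetric] by (simp add: powr_realpow)
    finally show "ennreal (v k) * emeasure \<mu> (B' k) \<le> ennreal ((K * 2 powr d * R powr (- (a + b - d))) * (2 powr (- (a + b - d))) ^ k)" .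
  qed
  also have "\<dots> = ennreal ((K * 2 powr d * R powr (- (a + b - d))) * (1 / (1 - 2 powr (- (a + b - d)))))"
    using K b by (intro suminf_geometric_ennreal) (auto simp: powr_less_one)
  finally have "(\<integral>\<^sup>+x. neg_pow (norm x) a * neg_pow (max R (norm x)) b \<partial>\<mu>)
    \<le> ennreal ((K * 2 powr a * R powr (- (a + b - d))) * (1 / (1 - 2 powr (- (d - a)))))
      + ennreal ((K * 2 powr d * R powr (- (a + b - d))) * (1 / (1 - 2 powr (- (a + b - d)))))"
    by (simp add: add_mono)
  also have "\<dots> = ennreal (growth_const a b d * K * R powr (- (a + b - d)))"
  proof -
    have "2 powr (- (d - a)) \<le> (1::real)" "2 powr (- (a + b - d)) \<le> (1::real)"
      using a b by (auto simp: powr_less_one less_imp_le)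
    then show ?thesis
      using K by (subst ennreal_plus[symmetric]) (auto simp: growth_const_def algebra_simps)
  qed
  also have "\<dots> = ennreal (growth_const a b d * K) * neg_pow R (a + b - d)"
    using R by (simp add: neg_pow_pos ennreal_mult'')
  finally show ?thesis .
qed

lemma growth_const_pos:
  assumes "a < d" "d < a + b"
  shows "0 < growth_const a b d"
proof -
  have "2 powr (- (d - a)) < (1::real)" "2 powr (- (a + b - d)) < (1::real)"
    using assms by (auto simp: powr_less_one)
  then show ?thesis unfolding growth_const_def by (intro add_pos_pos mult_pos_pos) auto
qed

lemma nn_integral_growth_lborel:
  fixes R a b :: real
  assumes "0 \<le> a" "a < DIM('a)" "0 \<le> b" "DIM('a) < a + b" "R > 0"
  shows "(\<integral>\<^sup>+(x::'a::euclidean_space). neg_pow (norm x) a * neg_pow (max R (norm x)) b \<partial>lborel)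
    \<le> ennreal (growth_const a b DIM('a) * unit_ball_vol DIM('a)) * neg_pow R (a + b - DIM('a))"
proof (rule nn_integral_growth)
  fix r :: real assume "r > 0"
  then show "emeasure lborel (cball (0::'a) r) \<le> ennreal (unit_ball_vol (real DIM('a)) * r powr real DIM('a))"
    by (subst emeasure_cball) (auto simp: powr_realpow)
qed (use assms in auto)

section \<open>Two-centre integrals and integrals over slabs\<close>

lemma nn_integral_lborel_shift:
  fixes f :: "'a::euclidean_space \<Rightarrow> ennreal"
  assumes "f \<in> borel_measurable borel"
  shows "(\<integral>\<^sup>+x. f (x - a) \<partial>lborel) = (\<integral>\<^sup>+x. f x \<partial>lborel)"
  using nn_integral_lborel_translate[OF assms, of "- a"] by simp

text \<open>The distance of x from the farther of the centres 0 and y is at least half the maximum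
  of |y| and the nearer distance. The integrand is thus bounded by two radial ones, centred at 0 and
  at y, with R = |y|. They converge at their centres as a, b < n and at infinity as a + b > n. For y
  = 0 the right-hand side is infinite.\<close>

lemma two_centre_bound:
  fixes a b :: real
  assumes a: "0 \<le> a" "a < DIM('a)" and b: "0 \<le> b" "b < DIM('a)" and ab: "DIM('a) < a + b"
  obtains C :: real where "C > 0"
    "\<And>y::'a::euclidean_space. (\<integral>\<^sup>+x. neg_pow (norm x) a * neg_pow (norm (x - y)) b \<partial>lborel)
      \<le> ennreal C * neg_pow (norm y) (a + b - DIM('a))"
proof -
  let ?n = "real DIM('a)" and ?\<omega> = "unit_ball_vol (real DIM('a))"
  define C where "C = 2 powr b * (growth_const a b ?n * ?\<omega>) + 2 powr a * (growth_const b a ?n * ?\<omega>)"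
  have gp: "0 < growth_const a b ?n * ?\<omega>" "0 < growth_const b a ?n * ?\<omega>"
    using assms by (auto intro!: mult_pos_pos growth_const_pos)
  have C: "C > 0" unfolding C_def by (intro add_pos_pos mult_pos_pos[OF _ gp(1)] mult_pos_pos[OF _ gp(2)]) auto
  have "(\<integral>\<^sup>+x. neg_pow (norm x) a * neg_pow (norm (x - y)) b \<partial>lborel)
      \<le> ennreal C * neg_pow (norm y) (a + b - DIM('a))" for y :: 'a
  proof (cases "y = 0")
    case True
    then show ?thesis using C by (simp add: ennreal_mult_top)
  next
    case False
    let ?R = "norm y"
    have R: "?R > 0" using False by simp
    let ?f = "\<lambda>x::'a. neg_pow (norm x) a * neg_pow (max ?R (norm x)) b"
    let ?g = "\<lambda>x::'a. neg_pow (norm x) b * neg_pow (max ?R (norm x)) a"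
    have pw: "neg_pow (norm x) a * neg_pow (norm (x - y)) b \<le> ennreal (2 powr b) * ?f x + ennreal (2 powr a) * ?g (x - y)" for x
    proof -
      have tri: "norm y \<le> norm x + norm (x - y)" using norm_triangle_ineq4[of x "x - y"] by simp
      show ?thesis
      proof (cases "norm x \<le> norm (x - y)")
        case True
        have mx: "max ?R (norm x) \<le> 2 * norm (x - y)"
          by (rule max.boundedI) (use True tri norm_ge_zero[of "x - y"] in linarith)+
        have "neg_pow (norm (x - y)) b \<le> ennreal (2 powr b) * neg_pow (max ?R (norm x)) b"
          by (rule neg_pow_le_scaled[OF _ mx]) (use b in \<open>auto simp: le_max_iff_disj\<close>)
        then have "neg_pow (norm x) a * neg_pow (norm (x - y)) b \<le> neg_pow (norm x) a * (ennreal (2 powr b) * neg_pow (max ?R (norm x)) b)"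
          by (rule mult_left_mono) simp
        also have "\<dots> = ennreal (2 powr b) * ?f x" by (simp only: mult_ac)
        finally show ?thesis by (rule order_trans) simp
      next
        case False
        have mx: "max ?R (norm (x - y)) \<le> 2 * norm x"
          by (rule max.boundedI) (use False tri norm_ge_zero[of x] in linarith)+
        have "neg_pow (norm x) a \<le> ennreal (2 powr a) * neg_pow (max ?R (norm (x - y))) a"
          by (rule neg_pow_le_scaled[OF _ mx]) (use a in \<open>auto simp: le_max_iff_disj\<close>)
        then have "neg_pow (norm x) a * neg_pow (norm (x - y)) b \<le> (ennreal (2 powr a) * neg_pow (max ?R (norm (x - y))) a) * neg_pow (norm (x - y)) b"
          by (rule mult_right_mono) simp
        also have "\<dots> = ennreal (2 powr a) * ?g (x - y)" by (simp only: mult_ac)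
        finally show ?thesis by (rule order_trans) simp
      qed
    qed
    have "(\<integral>\<^sup>+x. neg_pow (norm x) a * neg_pow (norm (x - y)) b \<partial>lborel)
        \<le> (\<integral>\<^sup>+x. ennreal (2 powr b) * ?f x + ennreal (2 powr a) * ?g (x - y) \<partial>lborel)"
      by (intro nn_integral_mono pw)
    also have "\<dots> = ennreal (2 powr b) * (\<integral>\<^sup>+x. ?f x \<partial>lborel) + ennreal (2 powr a) * (\<integral>\<^sup>+x. ?g (x - y) \<partial>lborel)"
      by (subst nn_integral_add) (auto simp: nn_integral_cmult)
    also have "(\<integral>\<^sup>+x. ?g (x - y) \<partial>lborel) = (\<integral>\<^sup>+x. ?g x \<partial>lborel)"
      by (rule nn_integral_lborel_shift) measurable
    also have "\<dots> \<le> ennreal (growth_const b a ?n * ?\<omega>) * neg_pow ?R (b + a - ?n)"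
      using assms R by (intro nn_integral_growth_lborel) auto
    also have "(\<integral>\<^sup>+x. ?f x \<partial>lborel) \<le> ennreal (growth_const a b ?n * ?\<omega>) * neg_pow ?R (a + b - ?n)"
      using assms R by (intro nn_integral_growth_lborel) auto
    finally have "(\<integral>\<^sup>+x. neg_pow (norm x) a * neg_pow (norm (x - y)) b \<partial>lborel)
      \<le> ennreal (2 powr b) * (ennreal (growth_const a b ?n * ?\<omega>) * neg_pow ?R (a + b - ?n))
        + ennreal (2 powr a) * (ennreal (growth_const b a ?n * ?\<omega>) * neg_pow ?R (b + a - ?n))"
      by (simp add: add_mono mult_left_mono)
    also have "\<dots> = ennreal C * neg_pow ?R (a + b - ?n)"
    proof -
      have "ennreal C = ennreal (2 powr b) * ennreal (growth_const a b ?n * ?\<omega>) + ennreal (2 powr a) * ennreal (growth_const b a ?n * ?\<omega>)"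
        unfolding C_def using gp by (simp only: ennreal_plus ennreal_mult powr_ge_zero less_imp_le mult_nonneg_nonneg)
      then show ?thesis by (simp only: distrib_right mult.assoc add.commute[of b a])
    qed
    finally show ?thesis .
  qed
  then show thesis using that C by blast
qed

text \<open>Averaging over translates by \<open>\<tau> y / \<bar>y\<bar>\<close>, \<open>0 \<le> \<tau> \<le> r\<close>, each of which meets the slab for a set of \<open>\<tau>\<close> of length at most its width.\<close>

lemma emeasure_slab_le:
  fixes y :: "'a::euclidean_space"
  assumes y: "y \<noteq> 0" and \<delta>: "\<delta> > 0" and r: "r > 0"
  shows "emeasure lborel ({z. t < y \<bullet> z \<and> y \<bullet> z < t + \<delta>} \<inter> cball 0 r)
    \<le> ennreal (unit_ball_vol DIM('a) * 2 ^ DIM('a) * (\<delta> / norm y) * r powr (real DIM('a) - 1))"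
proof -
  define W where "W = {z. t < y \<bullet> z \<and> y \<bullet> z < t + \<delta>} \<inter> cball 0 r"
  have "{z. t < y \<bullet> z \<and> y \<bullet> z < t + \<delta>} \<in> sets borel" by measurable
  then have [measurable]: "W \<in> sets borel" unfolding W_def by (rule sets.Int) simp
  define e where "e = y /\<^sub>R norm y"
  have e: "norm e = 1" "y \<bullet> e = norm y" using y by (auto simp: e_def dot_square_norm power2_eq_square)
  have "ennreal r * emeasure lborel W = (\<integral>\<^sup>+\<tau>. emeasure lborel W * indicator {0..r} \<tau> \<partial>lborel)"
    using r by (simp add: nn_integral_cmult_indicator mult.commute)
  also have "\<dots> = (\<integral>\<^sup>+\<tau>. (\<integral>\<^sup>+z. indicator {0..r} \<tau> * indicator W (z - \<tau> *\<^sub>R e) \<partial>lborel) \<partial>lborel)"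
    by (intro nn_integral_cong) (simp add: nn_integral_cmult nn_integral_lborel_shift[of "indicator W"] mult.commute)
  also have "\<dots> = (\<integral>\<^sup>+z. (\<integral>\<^sup>+\<tau>. indicator {0..r} \<tau> * indicator W (z - \<tau> *\<^sub>R e) \<partial>lborel) \<partial>lborel)"
    by (rule lborel_pair.Fubini') measurable
  \<comment> \<open>The translates by at most r stay in the ball of radius 2 r, which accounts for
    the power of 2 in the bound.\<close>
  also have "\<dots> \<le> (\<integral>\<^sup>+(z::'a). ennreal (\<delta> / norm y) * indicator (cball 0 (2 * r)) z \<partial>lborel)"
  proof (rule nn_integral_mono)
    fix z :: 'a
    show "(\<integral>\<^sup>+\<tau>. indicator {0..r} \<tau> * indicator W (z - \<tau> *\<^sub>R e) \<partial>lborel) \<le> ennreal (\<delta> / norm y) * indicator (cball 0 (2 * r)) z"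
    proof (cases "norm z \<le> 2 * r")
      case True
      let ?l = "(y \<bullet> z - t - \<delta>) / norm y"
      have "indicator {0..r} \<tau> * indicator W (z - \<tau> *\<^sub>R e) \<le> (indicator {?l .. ?l + \<delta> / norm y} \<tau> :: ennreal)" for \<tau>
      proof (cases "z - \<tau> *\<^sub>R e \<in> W")
        case True
        then have "t < y \<bullet> z - \<tau> * norm y" "y \<bullet> z - \<tau> * norm y < t + \<delta>" by (auto simp: W_def inner_simps e)
        then have "\<tau> \<in> {?l .. ?l + \<delta> / norm y}" using y by (simp add: field_simps)
        then show ?thesis by (auto simp: indicator_def)
      qed simp
      then have "(\<integral>\<^sup>+\<tau>. indicator {0..r} \<tau> * indicator W (z - \<tau> *\<^sub>R e) \<partial>lborel) \<le> (\<integral>\<^sup>+\<tau>. indicator {?l .. ?l + \<delta> / norm y} \<tau> \<partial>lborel)"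
        by (rule nn_integral_mono)
      also have "\<dots> = ennreal (\<delta> / norm y)" using \<delta> by simp
      finally show ?thesis using True by simp
    next
      case False
      have "indicator {0..r} \<tau> * indicator W (z - \<tau> *\<^sub>R e) = (0::ennreal)" for \<tau>
      proof -
        have "norm z \<le> norm (z - \<tau> *\<^sub>R e) + \<bar>\<tau>\<bar>" using norm_triangle_ineq[of "z - \<tau> *\<^sub>R e" "\<tau> *\<^sub>R e"] e by simp
        then show ?thesis using False by (auto simp: indicator_def W_def)
      qed
      then have "(\<lambda>\<tau>. indicator {0..r} \<tau> * indicator W (z - \<tau> *\<^sub>R e)) = (\<lambda>\<tau>. 0::ennreal)" by (rule ext)
      then show ?thesis by (simp only: nn_integral_const) simp
    qed
  qed
  also have "\<dots> = ennreal (\<delta> / norm y) * emeasure lborel (cball (0::'a) (2 * r))"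
    by (rule nn_integral_cmult_indicator) simp
  also have "\<dots> = ennreal ((\<delta> / norm y) * (unit_ball_vol DIM('a) * (2 * r) ^ DIM('a)))"
  proof -
    have "emeasure lborel (cball (0::'a) (2 * r)) = ennreal (unit_ball_vol DIM('a) * (2 * r) ^ DIM('a))"
      by (rule emeasure_cball) (use r in simp)
    then show ?thesis by (simp only:) (rule ennreal_mult[symmetric], use r \<delta> in auto)
  qed
  also have "(\<delta> / norm y) * (unit_ball_vol DIM('a) * (2 * r) ^ DIM('a))
    = r * (unit_ball_vol DIM('a) * 2 ^ DIM('a) * (\<delta> / norm y) * r powr (real DIM('a) - 1))"
    using r by (simp add: power_mult_distrib powr_diff powr_realpow)
  also have "ennreal (r * (unit_ball_vol DIM('a) * 2 ^ DIM('a) * (\<delta> / norm y) * r powr (real DIM('a) - 1)))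
    = ennreal r * ennreal (unit_ball_vol DIM('a) * 2 ^ DIM('a) * (\<delta> / norm y) * r powr (real DIM('a) - 1))"
    by (rule ennreal_mult) (use r \<delta> in auto)
  finally have "ennreal r * emeasure lborel W \<le> ennreal r * ennreal (unit_ball_vol DIM('a) * 2 ^ DIM('a) * (\<delta> / norm y) * r powr (real DIM('a) - 1))" .
  then have "emeasure lborel W \<le> ennreal (unit_ball_vol DIM('a) * 2 ^ DIM('a) * (\<delta> / norm y) * r powr (real DIM('a) - 1))"
    using r by (simp add: ennreal_mult_le_mult_iff)
  then show ?thesis by (simp only: W_def)
qed

text \<open>The terms in |z|^2 cancel, so the shell becomes a slab in which y . z ranges over an
  interval of length \<epsilon>/2. F < 0 makes |y - z| larger than |z| and A, hence |y| + A \<le> 3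
  |y - z|. The second weight is then at most a power of the maximum of |z| and R = (|y| + A)/3, and
  the radial bound with d = n - 1 applies.\<close>

lemma slab_bound:
  assumes a: "0 \<le> a" "a < real DIM('a) - 1" and b: "0 \<le> b" "real DIM('a) - 1 < a + b"
  obtains C :: real where "C > 0"
    "\<And>(y::'a::euclidean_space) A \<epsilon>. 0 \<le> A \<Longrightarrow> 0 < \<epsilon> \<Longrightarrow>
      (\<integral>\<^sup>+z. indicator {-\<epsilon><..<0} (A\<^sup>2 + (norm z)\<^sup>2 - (norm (y - z))\<^sup>2) * (neg_pow (norm z) a * neg_pow (norm (y - z)) b) \<partial>lborel)
      \<le> ennreal (\<epsilon> * C) * (neg_pow (norm y) 1 * neg_pow (norm y + A) (a + b - (real DIM('a) - 1)))"
proof -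
  let ?d = "real DIM('a) - 1"
  let ?\<omega> = "unit_ball_vol DIM('a) * 2 ^ DIM('a)"
  define C where "C = 3 powr (a + b - ?d) * (growth_const a b ?d * ?\<omega>) / 2"
  have g: "growth_const a b ?d > 0" using assms by (intro growth_const_pos) auto
  then have C: "C > 0" by (auto simp: C_def intro!: divide_pos_pos mult_pos_pos)
  have "(\<integral>\<^sup>+z. indicator {-\<epsilon><..<0} (A\<^sup>2 + (norm z)\<^sup>2 - (norm (y - z))\<^sup>2) * (neg_pow (norm z) a * neg_pow (norm (y - z)) b) \<partial>lborel)
      \<le> ennreal (\<epsilon> * C) * (neg_pow (norm y) 1 * neg_pow (norm y + A) (a + b - ?d))" if A: "0 \<le> A" and \<epsilon>: "0 < \<epsilon>" for y :: 'a and A \<epsilon>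
  proof (cases "y = 0")
    case True
    have "neg_pow (norm y) 1 * neg_pow (norm y + A) (a + b - ?d) = top"
      using True by (simp add: ennreal_top_mult)
    then show ?thesis using C \<epsilon> by (simp add: ennreal_mult_top)
  next
    case False
    define t where "t = ((norm y)\<^sup>2 - A\<^sup>2 - \<epsilon>) / 2"
    define \<mu> where "\<mu> = density lborel (indicator {z. t < y \<bullet> z \<and> y \<bullet> z < t + \<epsilon>/2})"
    define R where "R = (norm y + A) / 3"
    have R: "R > 0" using False A by (simp add: R_def add_pos_nonneg)
    have [measurable]: "{z. t < y \<bullet> z \<and> y \<bullet> z < t + \<epsilon>/2} \<in> sets borel" by measurable
    have eq: "A\<^sup>2 + (norm z)\<^sup>2 - (norm (y - z))\<^sup>2 = A\<^sup>2 - (norm y)\<^sup>2 + 2 * (y \<bullet> z)" for z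
      by (simp add: power2_norm_eq_inner inner_simps inner_commute)
    have pw: "indicator {-\<epsilon><..<0} (A\<^sup>2 + (norm z)\<^sup>2 - (norm (y - z))\<^sup>2) * (neg_pow (norm z) a * neg_pow (norm (y - z)) b)
      \<le> indicator {z. t < y \<bullet> z \<and> y \<bullet> z < t + \<epsilon>/2} z * (neg_pow (norm z) a * neg_pow (max R (norm z)) b)" for z
    proof (cases "A\<^sup>2 + (norm z)\<^sup>2 - (norm (y - z))\<^sup>2 \<in> {-\<epsilon><..<0}")
      case True
      then have lt: "A\<^sup>2 + (norm z)\<^sup>2 < (norm (y - z))\<^sup>2" by simp
      have "t < y \<bullet> z \<and> y \<bullet> z < t + \<epsilon>/2" using True unfolding eq by (simp add: t_def field_simps)
      moreover have "norm z \<le> norm (y - z)"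
        by (rule power2_le_imp_le) (use lt zero_le_power2[of A] in linarith, simp)
      moreover have "A \<le> norm (y - z)"
        by (rule power2_le_imp_le) (use lt zero_le_power2[of "norm z"] in linarith, simp)
      moreover have "norm y \<le> norm z + norm (y - z)" using norm_triangle_ineq[of z "y - z"] by simp
      ultimately have "t < y \<bullet> z \<and> y \<bullet> z < t + \<epsilon>/2" "neg_pow (norm (y - z)) b \<le> neg_pow (max R (norm z)) b"
        using b R by (auto simp: R_def le_max_iff_disj intro!: neg_pow_antimono)
      then show ?thesis using True by (simp add: mult_left_mono)
    qed simp
    have growth: "emeasure \<mu> (cball 0 r) \<le> ennreal (?\<omega> * ((\<epsilon> / 2) / norm y) * r powr ?d)" if "r > 0" for r
    proof -
      have "emeasure \<mu> (cball 0 r) = emeasure lborel ({z. t < y \<bullet> z \<and> y \<bullet> z < t + \<epsilon>/2} \<inter> cball 0 r)"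
        unfolding \<mu>_def by (subst emeasure_density) (auto simp flip: indicator_inter_arith)
      also have "\<dots> \<le> ennreal (?\<omega> * ((\<epsilon> / 2) / norm y) * r powr ?d)"
        using False \<epsilon> that by (intro emeasure_slab_le) auto
      finally show ?thesis .
    qed
    have "(\<integral>\<^sup>+z. indicator {-\<epsilon><..<0} (A\<^sup>2 + (norm z)\<^sup>2 - (norm (y - z))\<^sup>2) * (neg_pow (norm z) a * neg_pow (norm (y - z)) b) \<partial>lborel)
      \<le> (\<integral>\<^sup>+z. indicator {z. t < y \<bullet> z \<and> y \<bullet> z < t + \<epsilon>/2} z * (neg_pow (norm z) a * neg_pow (max R (norm z)) b) \<partial>lborel)"
      by (intro nn_integral_mono pw)
    also have "\<dots> = (\<integral>\<^sup>+z. neg_pow (norm z) a * neg_pow (max R (norm z)) b \<partial>\<mu>)"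
      unfolding \<mu>_def by (subst nn_integral_density) auto
    also have "\<dots> \<le> ennreal (growth_const a b ?d * (?\<omega> * ((\<epsilon> / 2) / norm y))) * neg_pow R (a + b - ?d)"
      by (rule nn_integral_growth[OF _ growth]) (use assms R \<epsilon> in \<open>auto simp: \<mu>_def\<close>)
    also have "\<dots> = ennreal (\<epsilon> * C) * (neg_pow (norm y) 1 * neg_pow (norm y + A) (a + b - ?d))"
    proof -
      have "neg_pow R p = ennreal (3 powr p) * neg_pow (norm y + A) p" for p
        using R by (simp add: R_def neg_pow_pos powr_divide powr_minus ennreal_mult[symmetric] field_simps)
      moreover have "ennreal (growth_const a b ?d * (?\<omega> * ((\<epsilon> / 2) / norm y))) * ennreal (3 powr (a + b - ?d)) = ennreal (\<epsilon> * C) * neg_pow (norm y) 1"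
        using False g \<epsilon> C by (simp add: neg_pow_pos powr_minus ennreal_mult[symmetric] C_def field_simps)
      ultimately show ?thesis by (metis mult.assoc)
    qed
    finally show ?thesis .
  qed
  then show thesis using that C by blast
qed

subsection \<open>Fibre integrals\<close>

lemma product_sigma_finite_lborel: "product_sigma_finite (\<lambda>_::'i. lborel :: 'a::euclidean_space measure)"
  by standard

lemma sigma_finite_PiM_lborel:
  "finite I \<Longrightarrow> sigma_finite_measure (PiM I (\<lambda>_. lborel :: 'a::euclidean_space measure))"
  by (rule product_sigma_finite.sigma_finite[OF product_sigma_finite_lborel])

lemma measurable_PiM_lborel [measurable]:
  fixes \<alpha> :: "'i \<Rightarrow> real"
  shows "(\<lambda>x. \<Sum>i\<in>I. x i :: 'a::euclidean_space) \<in> borel_measurable (PiM I (\<lambda>_. lborel))"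
    and "(\<lambda>x. \<Sum>i\<in>I. (norm (x i :: 'a::euclidean_space))\<^sup>2) \<in> borel_measurable (PiM I (\<lambda>_. lborel))"
    and "(\<lambda>x. \<Prod>i\<in>I. neg_pow (norm (x i :: 'a::euclidean_space)) (\<alpha> i)) \<in> borel_measurable (PiM I (\<lambda>_. lborel))"
proof -
  have [measurable]: "(\<lambda>x. x i) \<in> borel_measurable (PiM I (\<lambda>_. lborel :: 'a measure))" if "i \<in> I" for i
    using measurable_component_singleton[OF that, of "\<lambda>_. lborel :: 'a measure"] by simp
  show "(\<lambda>x. \<Sum>i\<in>I. x i :: 'a::euclidean_space) \<in> borel_measurable (PiM I (\<lambda>_. lborel))"
    by (rule borel_measurable_sum) measurable
  show "(\<lambda>x. \<Sum>i\<in>I. (norm (x i :: 'a::euclidean_space))\<^sup>2) \<in> borel_measurable (PiM I (\<lambda>_. lborel))"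
    by (rule borel_measurable_sum) measurable
  show "(\<lambda>x. \<Prod>i\<in>I. neg_pow (norm (x i :: 'a::euclidean_space)) (\<alpha> i)) \<in> borel_measurable (PiM I (\<lambda>_. lborel))"
    by (rule borel_measurable_prod_ennreal) measurable
qed

lemma prod_le_prod_ennreal:
  fixes f g :: "'i \<Rightarrow> ennreal"
  assumes "\<And>i. i \<in> I \<Longrightarrow> f i \<le> g i"
  shows "prod f I \<le> prod g I"
  using assms by (induction I rule: infinite_finite_induct) (auto intro!: mult_mono)

text \<open>By \<open>two_centre_bound\<close>, integrating out one variable lowers the exponent b
  by the deficit \<theta> j of its weight. The condition on the sum keeps the exponent above the
  remaining deficits, so every two-centre integral converges.\<close>

lemma iterated_bound:
  fixes \<theta> :: "'i \<Rightarrow> real" and b :: real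
  assumes "finite I" "\<And>i. i \<in> I \<Longrightarrow> 0 < \<theta> i \<and> \<theta> i \<le> DIM('a)" "sum \<theta> I < b" "b < DIM('a)"
  shows "\<exists>C>0. \<forall>s::'a::euclidean_space.
    (\<integral>\<^sup>+x. (\<Prod>i\<in>I. neg_pow (norm (x i)) (DIM('a) - \<theta> i)) * neg_pow (norm (s - (\<Sum>i\<in>I. x i))) b \<partial>PiM I (\<lambda>_. lborel))
      \<le> ennreal C * neg_pow (norm s) (b - sum \<theta> I)"
  using assms
proof (induction I arbitrary: b rule: finite_induct)
  case empty
  then show ?case by (intro exI[of _ 1]) (simp add: PiM_empty nn_integral_count_space_finite)
next
  case (insert j I)
  interpret P: product_sigma_finite "\<lambda>_::'i. lborel :: 'a measure" by (rule product_sigma_finite_lborel)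
  let ?n = "real DIM('a)"
  have \<theta>j: "0 < \<theta> j" "\<theta> j \<le> ?n" and \<theta>I: "\<And>i. i \<in> I \<Longrightarrow> 0 < \<theta> i \<and> \<theta> i \<le> ?n" using insert.prems by auto
  have "0 \<le> sum \<theta> I" using \<theta>I by (intro sum_nonneg) (auto simp: less_imp_le)
  then have sm: "sum \<theta> I < b - \<theta> j" "b - \<theta> j < ?n" "\<theta> j < b"
    using insert.prems(2,3) insert.hyps \<theta>j by auto
  obtain C1 where C1: "C1 > 0" "\<And>y::'a. (\<integral>\<^sup>+x. neg_pow (norm x) (?n - \<theta> j) * neg_pow (norm (x - y)) b \<partial>lborel)
      \<le> ennreal C1 * neg_pow (norm y) (?n - \<theta> j + b - ?n)"
  proof (rule two_centre_bound[of "?n - \<theta> j" b])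
    show "0 \<le> b" using \<theta>j sm(3) by linarith
  qed (use \<theta>j sm insert.prems(3) that in auto)
  obtain C2 where C2: "C2 > 0" "\<And>s::'a. (\<integral>\<^sup>+x. (\<Prod>i\<in>I. neg_pow (norm (x i)) (?n - \<theta> i)) * neg_pow (norm (s - (\<Sum>i\<in>I. x i))) (b - \<theta> j) \<partial>PiM I (\<lambda>_. lborel))
      \<le> ennreal C2 * neg_pow (norm s) (b - \<theta> j - sum \<theta> I)"
    using insert.IH[OF \<theta>I sm(1,2)] by blast
  show ?case
  proof (intro exI[of _ "C1 * C2"] conjI allI)
    show "C1 * C2 > 0" using C1 C2 by simp
    fix s :: 'a
    let ?f = "\<lambda>x. (\<Prod>i\<in>insert j I. neg_pow (norm (x i)) (?n - \<theta> i)) * neg_pow (norm (s - (\<Sum>i\<in>insert j I. x i))) b"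
    let ?p = "\<lambda>x. \<Prod>i\<in>I. neg_pow (norm (x i)) (?n - \<theta> i)"
    have "(\<integral>\<^sup>+x. ?f x \<partial>PiM (insert j I) (\<lambda>_. lborel)) = (\<integral>\<^sup>+x. (\<integral>\<^sup>+y. ?f (x(j := y)) \<partial>lborel) \<partial>PiM I (\<lambda>_. lborel))"
      using insert.hyps by (intro P.product_nn_integral_insert) measurable
    also have "\<dots> \<le> (\<integral>\<^sup>+x. ennreal C1 * (?p x * neg_pow (norm (s - (\<Sum>i\<in>I. x i))) (b - \<theta> j)) \<partial>PiM I (\<lambda>_. lborel))"
    proof (rule nn_integral_mono)
      fix x :: "'i \<Rightarrow> 'a"
      have upd: "(\<Prod>i\<in>I. neg_pow (norm ((x(j := y)) i)) (?n - \<theta> i)) = ?p x" "(\<Sum>i\<in>I. (x(j := y)) i) = (\<Sum>i\<in>I. x i)" for y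
        using insert.hyps by (auto intro!: prod.cong sum.cong)
      have "(\<integral>\<^sup>+y. ?f (x(j := y)) \<partial>lborel)
          = (\<integral>\<^sup>+y. ?p x * (neg_pow (norm y) (?n - \<theta> j) * neg_pow (norm (y - (s - (\<Sum>i\<in>I. x i)))) b) \<partial>lborel)"
      proof (intro nn_integral_cong)
        fix y :: 'a
        have "norm (s - (\<Sum>i\<in>insert j I. (x(j := y)) i)) = norm (y - (s - (\<Sum>i\<in>I. x i)))"
          using insert.hyps upd(2) by (simp add: norm_minus_commute algebra_simps)
        moreover have "(\<Prod>i\<in>insert j I. neg_pow (norm ((x(j := y)) i)) (?n - \<theta> i)) = neg_pow (norm y) (?n - \<theta> j) * ?p x"
          using insert.hyps upd(1) by simp
        ultimately show "?f (x(j := y)) = ?p x * (neg_pow (norm y) (?n - \<theta> j) * neg_pow (norm (y - (s - (\<Sum>i\<in>I. x i)))) b)"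
          by (simp only: mult_ac)
      qed
      also have "\<dots> = ?p x * (\<integral>\<^sup>+y. neg_pow (norm y) (?n - \<theta> j) * neg_pow (norm (y - (s - (\<Sum>i\<in>I. x i)))) b \<partial>lborel)"
        by (rule nn_integral_cmult) measurable
      also have "\<dots> \<le> ?p x * (ennreal C1 * neg_pow (norm (s - (\<Sum>i\<in>I. x i))) (?n - \<theta> j + b - ?n))"
        by (intro mult_left_mono C1) simp
      finally show "(\<integral>\<^sup>+y. ?f (x(j := y)) \<partial>lborel) \<le> ennreal C1 * (?p x * neg_pow (norm (s - (\<Sum>i\<in>I. x i))) (b - \<theta> j))"
        by (simp add: mult_ac)
    qed
    also have "\<dots> = ennreal C1 * (\<integral>\<^sup>+x. ?p x * neg_pow (norm (s - (\<Sum>i\<in>I. x i))) (b - \<theta> j) \<partial>PiM I (\<lambda>_. lborel))"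
      by (rule nn_integral_cmult) measurable
    also have "\<dots> \<le> ennreal C1 * (ennreal C2 * neg_pow (norm s) (b - \<theta> j - sum \<theta> I))"
      by (intro mult_left_mono C2) simp
    also have "\<dots> = ennreal (C1 * C2) * neg_pow (norm s) (b - sum \<theta> (insert j I))"
      using C1(1) C2(1) insert.hyps by (simp add: ennreal_mult mult.assoc diff_diff_eq)
    finally show "(\<integral>\<^sup>+x. ?f x \<partial>PiM (insert j I) (\<lambda>_. lborel)) \<le> ennreal (C1 * C2) * neg_pow (norm s) (b - sum \<theta> (insert j I))" .
  qed
qed

text \<open>
  The factor \<open>(\<bar>y\<bar> + A) ^ -(a + b - n + 1)\<close> from the slab estimate is split among
  \<open>\<bar>x\<^sub>i\<bar>\<close> and \<open>\<bar>s\<bar>\<close>, all of which it dominates, so that the remaining integrals over the \<open>x\<^sub>i\<close>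
  become two-centre integrals.
\<close>

lemma fiber_bound:
  fixes \<alpha> \<gamma> \<theta> :: "'i \<Rightarrow> real" and a b \<gamma>0 :: real
  assumes I: "finite I" and n: "DIM('a) \<ge> 2"
    and a: "0 \<le> a" "a < real DIM('a) - 1" and b: "0 \<le> b" "real DIM('a) - 1 < a + b"
    and \<gamma>: "\<And>i. i \<in> I \<Longrightarrow> 0 \<le> \<gamma> i" and \<theta>: "\<And>i. i \<in> I \<Longrightarrow> 0 < \<theta> i \<and> \<theta> i \<le> DIM('a)"
    and \<alpha>: "\<And>i. i \<in> I \<Longrightarrow> \<alpha> i + \<gamma> i = DIM('a) - \<theta> i"
    and \<theta>1: "sum \<theta> I < 1" and \<gamma>0: "0 \<le> \<gamma>0" "\<gamma>0 + sum \<gamma> I = a + b - (real DIM('a) - 1)"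
  shows "\<exists>C>0. \<forall>\<epsilon>>0. \<forall>s::'a::euclidean_space.
    (\<integral>\<^sup>+x. (\<Prod>i\<in>I. neg_pow (norm (x i)) (\<alpha> i)) *
      (\<integral>\<^sup>+z. indicator {-\<epsilon><..<0} (1 + (\<Sum>i\<in>I. (norm (x i))\<^sup>2) + (norm z)\<^sup>2 - (norm (s - (\<Sum>i\<in>I. x i) - z))\<^sup>2) *
        (neg_pow (norm z) a * neg_pow (norm (s - (\<Sum>i\<in>I. x i) - z)) b) \<partial>lborel) \<partial>PiM I (\<lambda>_. lborel))
    \<le> ennreal (\<epsilon> * C) * neg_pow (norm s) (1 - sum \<theta> I + \<gamma>0)"
proof -
  let ?d = "real DIM('a) - 1"
  obtain C1 where C1: "C1 > 0" "\<And>(y::'a) A \<epsilon>. 0 \<le> A \<Longrightarrow> 0 < \<epsilon> \<Longrightarrow>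
      (\<integral>\<^sup>+z. indicator {-\<epsilon><..<0} (A\<^sup>2 + (norm z)\<^sup>2 - (norm (y - z))\<^sup>2) * (neg_pow (norm z) a * neg_pow (norm (y - z)) b) \<partial>lborel)
      \<le> ennreal (\<epsilon> * C1) * (neg_pow (norm y) 1 * neg_pow (norm y + A) (a + b - ?d))"
    by (rule slab_bound[OF a b]) (rule that)
  have "1 < real DIM('a)" using n by simp
  then obtain C2 where C2: "C2 > 0" "\<And>s::'a.
    (\<integral>\<^sup>+x. (\<Prod>i\<in>I. neg_pow (norm (x i)) (DIM('a) - \<theta> i)) * neg_pow (norm (s - (\<Sum>i\<in>I. x i))) 1 \<partial>PiM I (\<lambda>_. lborel))
      \<le> ennreal C2 * neg_pow (norm s) (1 - sum \<theta> I)"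
    using iterated_bound[where 'a='a, OF I \<theta> \<theta>1] by blast
  \<comment> \<open>Every |x_i| is at most A, so |s| \<le> |s - S| + card I * A, where S is the sum
    of the x_i; this is at most M times |s - S| + A.\<close>
  define M where "M = 1 + real (card I)"
  have M: "M > 0" by (simp add: M_def)
  define C where "C = C1 * (M powr \<gamma>0) * C2"
  have C: "C > 0" using C1 C2 M by (simp add: C_def)
  show ?thesis
  proof (intro exI[of _ C] conjI allI impI)
    fix \<epsilon> :: real and s :: 'a assume \<epsilon>: "\<epsilon> > 0"
    let ?p = "\<lambda>x. \<Prod>i\<in>I. neg_pow (norm (x i)) (\<alpha> i)" and ?S = "\<lambda>x. \<Sum>i\<in>I. x i"
    let ?q = "\<lambda>x. \<Prod>i\<in>I. neg_pow (norm (x i)) (DIM('a) - \<theta> i)"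
    have pw: "?p x * (\<integral>\<^sup>+z. indicator {-\<epsilon><..<0} (1 + (\<Sum>i\<in>I. (norm (x i))\<^sup>2) + (norm z)\<^sup>2 - (norm (s - ?S x - z))\<^sup>2) *
        (neg_pow (norm z) a * neg_pow (norm (s - ?S x - z)) b) \<partial>lborel)
      \<le> (ennreal (\<epsilon> * C1 * M powr \<gamma>0) * neg_pow (norm s) \<gamma>0) * (?q x * neg_pow (norm (s - ?S x)) 1)" for x :: "'i \<Rightarrow> 'a"
    proof -
      define A where "A = sqrt (1 + (\<Sum>i\<in>I. (norm (x i))\<^sup>2))"
      have sq: "0 \<le> (\<Sum>i\<in>I. (norm (x i))\<^sup>2)" by (intro sum_nonneg) simp
      have A2: "A\<^sup>2 = 1 + (\<Sum>i\<in>I. (norm (x i))\<^sup>2)" using sq by (simp add: A_def)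
      have A0: "1 \<le> A" using sq by (simp add: A_def)
      have xA: "norm (x i) \<le> A" if "i \<in> I" for i
      proof -
        have "(norm (x i))\<^sup>2 \<le> (\<Sum>i\<in>I. (norm (x i))\<^sup>2)" using that I by (intro member_le_sum) auto
        then show ?thesis unfolding A_def by (intro real_le_rsqrt) simp
      qed
      let ?r = "norm (s - ?S x) + A"
      have r: "?r > 0" using A0 by (simp add: add_nonneg_pos)
      have "neg_pow ?r (a + b - ?d) = neg_pow ?r \<gamma>0 * (\<Prod>i\<in>I. neg_pow ?r (\<gamma> i))"
        using I r by (simp only: \<gamma>0(2)[symmetric] neg_pow_add[symmetric] neg_pow_sum less_imp_le)
      also have "\<dots> \<le> (ennreal (M powr \<gamma>0) * neg_pow (norm s) \<gamma>0) * (\<Prod>i\<in>I. neg_pow (norm (x i)) (\<gamma> i))"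
      proof (intro mult_mono prod_le_prod_ennreal)
        have "norm s \<le> norm (s - ?S x) + norm (?S x)" using norm_triangle_ineq[of "s - ?S x" "?S x"] by simp
        also have "norm (?S x) \<le> (\<Sum>i\<in>I. norm (x i))" by (rule norm_sum)
        also have "\<dots> \<le> (\<Sum>i\<in>I. A)" by (intro sum_mono xA)
        also have "norm (s - ?S x) + (\<Sum>i\<in>I. A) \<le> M * ?r"
          using A0 by (simp add: M_def algebra_simps)
        finally have "norm s \<le> M * ?r" by simp
        then show "neg_pow ?r \<gamma>0 \<le> ennreal (M powr \<gamma>0) * neg_pow (norm s) \<gamma>0"
          using M \<gamma>0 by (intro neg_pow_le_scaled) auto
        show "neg_pow ?r (\<gamma> i) \<le> neg_pow (norm (x i)) (\<gamma> i)" if "i \<in> I" for i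
          using xA[OF that] \<gamma>[OF that] by (auto intro!: neg_pow_antimono add_increasing)
      qed auto
      finally have P: "neg_pow ?r (a + b - ?d) \<le> (ennreal (M powr \<gamma>0) * neg_pow (norm s) \<gamma>0) * (\<Prod>i\<in>I. neg_pow (norm (x i)) (\<gamma> i))" .
      have q: "?p x * (\<Prod>i\<in>I. neg_pow (norm (x i)) (\<gamma> i)) = ?q x"
        unfolding prod.distrib[symmetric] by (intro prod.cong) (auto simp: neg_pow_add \<alpha>)
      have "?p x * (\<integral>\<^sup>+z. indicator {-\<epsilon><..<0} (1 + (\<Sum>i\<in>I. (norm (x i))\<^sup>2) + (norm z)\<^sup>2 - (norm (s - ?S x - z))\<^sup>2) *
          (neg_pow (norm z) a * neg_pow (norm (s - ?S x - z)) b) \<partial>lborel)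
        \<le> ?p x * (ennreal (\<epsilon> * C1) * (neg_pow (norm (s - ?S x)) 1 * neg_pow ?r (a + b - ?d)))"
        using C1(2)[of A \<epsilon> "s - ?S x"] A0 \<epsilon> by (intro mult_left_mono) (auto simp: A2)
      also have "\<dots> \<le> ?p x * (ennreal (\<epsilon> * C1) * (neg_pow (norm (s - ?S x)) 1 * ((ennreal (M powr \<gamma>0) * neg_pow (norm s) \<gamma>0) * (\<Prod>i\<in>I. neg_pow (norm (x i)) (\<gamma> i)))))"
        by (intro mult_left_mono P) auto
      also have "\<dots> = (ennreal (\<epsilon> * C1) * ennreal (M powr \<gamma>0) * neg_pow (norm s) \<gamma>0) * ((?p x * (\<Prod>i\<in>I. neg_pow (norm (x i)) (\<gamma> i))) * neg_pow (norm (s - ?S x)) 1)"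
        by (simp only: mult_ac)
      also have "\<dots> = (ennreal (\<epsilon> * C1 * M powr \<gamma>0) * neg_pow (norm s) \<gamma>0) * (?q x * neg_pow (norm (s - ?S x)) 1)"
        unfolding q using \<epsilon> C1 by (simp add: ennreal_mult)
      finally show ?thesis .
    qed
    have "(\<integral>\<^sup>+x. ?p x * (\<integral>\<^sup>+z. indicator {-\<epsilon><..<0} (1 + (\<Sum>i\<in>I. (norm (x i))\<^sup>2) + (norm z)\<^sup>2 - (norm (s - ?S x - z))\<^sup>2) *
        (neg_pow (norm z) a * neg_pow (norm (s - ?S x - z)) b) \<partial>lborel) \<partial>PiM I (\<lambda>_. lborel))
      \<le> (\<integral>\<^sup>+x. (ennreal (\<epsilon> * C1 * M powr \<gamma>0) * neg_pow (norm s) \<gamma>0) * (?q x * neg_pow (norm (s - ?S x)) 1) \<partial>PiM I (\<lambda>_. lborel))"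
      by (intro nn_integral_mono pw)
    also have "\<dots> = (ennreal (\<epsilon> * C1 * M powr \<gamma>0) * neg_pow (norm s) \<gamma>0) * (\<integral>\<^sup>+x. ?q x * neg_pow (norm (s - ?S x)) 1 \<partial>PiM I (\<lambda>_. lborel))"
      by (rule nn_integral_cmult) measurable
    also have "\<dots> \<le> (ennreal (\<epsilon> * C1 * M powr \<gamma>0) * neg_pow (norm s) \<gamma>0) * (ennreal C2 * neg_pow (norm s) (1 - sum \<theta> I))"
      by (intro mult_left_mono C2) simp
    also have "\<dots> = (ennreal (\<epsilon> * C1 * M powr \<gamma>0) * ennreal C2) * (neg_pow (norm s) (1 - sum \<theta> I) * neg_pow (norm s) \<gamma>0)"
      by (simp only: mult_ac)
    also have "\<dots> = ennreal (\<epsilon> * C) * neg_pow (norm s) (1 - sum \<theta> I + \<gamma>0)"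
      using \<epsilon> C1 C2 by (simp add: neg_pow_add C_def ennreal_mult mult.assoc)
    finally show "(\<integral>\<^sup>+x. ?p x * (\<integral>\<^sup>+z. indicator {-\<epsilon><..<0} (1 + (\<Sum>i\<in>I. (norm (x i))\<^sup>2) + (norm z)\<^sup>2 - (norm (s - ?S x - z))\<^sup>2) *
        (neg_pow (norm z) a * neg_pow (norm (s - ?S x - z)) b) \<partial>lborel) \<partial>PiM I (\<lambda>_. lborel))
      \<le> ennreal (\<epsilon> * C) * neg_pow (norm s) (1 - sum \<theta> I + \<gamma>0)" .
  qed (rule C)
qed

text \<open>\<open>thick_integral I \<alpha> a b \<epsilon> h\<close> approximates \<open>\<epsilon>\<close> times the integral of \<open>\<delta>[1 + \<Sum>\<bar>x\<^sub>i\<bar>\<^sup>2 + \<bar>z\<bar>\<^sup>2 - \<bar>y\<bar>\<^sup>2]\<close> against the kernel.\<close>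

definition thick_integral ::
  "'i set \<Rightarrow> ('i \<Rightarrow> real) \<Rightarrow> real \<Rightarrow> real \<Rightarrow> real \<Rightarrow> ('a::euclidean_space \<Rightarrow> ennreal) \<Rightarrow> ennreal" where
  "thick_integral I \<alpha> a b \<epsilon> h =
    (\<integral>\<^sup>+x. (\<integral>\<^sup>+z. (\<integral>\<^sup>+y.
      indicator {-\<epsilon><..<0} (1 + (\<Sum>i\<in>I. (norm (x i))\<^sup>2) + (norm z)\<^sup>2 - (norm y)\<^sup>2) *
      ((\<Prod>i\<in>I. neg_pow (norm (x i)) (\<alpha> i)) * (neg_pow (norm z) a * neg_pow (norm y) b) * h ((\<Sum>i\<in>I. x i) + z + y))
      \<partial>lborel) \<partial>lborel) \<partial>PiM I (\<lambda>_. lborel))"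

text \<open>Tonelli's theorem puts s outermost, where \<open>fiber_bound\<close> bounds the density
  uniformly in \<epsilon> after division by \<epsilon>. The function h is arbitrary so that the
  constant will not depend on the points w and v of the kernel.\<close>

lemma thick_integral_bound:
  fixes \<alpha> \<gamma> \<theta> :: "'i \<Rightarrow> real" and a b \<gamma>0 :: real
  assumes I: "finite I" and n: "DIM('a) \<ge> 2"
    and a: "0 \<le> a" "a < real DIM('a) - 1" and b: "0 \<le> b" "real DIM('a) - 1 < a + b"
    and \<gamma>: "\<And>i. i \<in> I \<Longrightarrow> 0 \<le> \<gamma> i" and \<theta>: "\<And>i. i \<in> I \<Longrightarrow> 0 < \<theta> i \<and> \<theta> i \<le> DIM('a)"
    and \<alpha>: "\<And>i. i \<in> I \<Longrightarrow> \<alpha> i + \<gamma> i = DIM('a) - \<theta> i"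
    and \<theta>1: "sum \<theta> I < 1" and \<gamma>0: "0 \<le> \<gamma>0" "\<gamma>0 + sum \<gamma> I = a + b - (real DIM('a) - 1)"
  shows "\<exists>C>0. \<forall>\<epsilon>>0. \<forall>h\<in>borel_measurable borel.
    thick_integral I \<alpha> a b \<epsilon> h \<le> ennreal (\<epsilon> * C) * (\<integral>\<^sup>+(s::'a::euclidean_space). neg_pow (norm s) (1 - sum \<theta> I + \<gamma>0) * h s \<partial>lborel)"
proof -
  let ?P = "PiM I (\<lambda>_. lborel :: 'a measure)" and ?e = "1 - sum \<theta> I + \<gamma>0"
  define S where "S x = (\<Sum>i\<in>I. x i :: 'a)" for x
  define Q where "Q x = (\<Sum>i\<in>I. (norm (x i :: 'a))\<^sup>2)" for x
  define p where "p x = (\<Prod>i\<in>I. neg_pow (norm (x i :: 'a)) (\<alpha> i))" for x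
  have [measurable]: "S \<in> borel_measurable ?P" "Q \<in> borel_measurable ?P" "p \<in> borel_measurable ?P"
    unfolding S_def Q_def p_def by measurable
  obtain C where C: "C > 0" "\<And>\<epsilon> s::'a. \<epsilon> > 0 \<Longrightarrow>
    (\<integral>\<^sup>+x. p x * (\<integral>\<^sup>+z. indicator {-\<epsilon><..<0} (1 + Q x + (norm z)\<^sup>2 - (norm (s - S x - z))\<^sup>2) *
        (neg_pow (norm z) a * neg_pow (norm (s - S x - z)) b) \<partial>lborel) \<partial>?P) \<le> ennreal (\<epsilon> * C) * neg_pow (norm s) ?e"
    using fiber_bound[where 'a='a, OF assms] unfolding p_def S_def Q_def by blast
  interpret PP: sigma_finite_measure ?P by (rule sigma_finite_PiM_lborel[OF I])
  interpret pair: pair_sigma_finite ?P "lborel :: 'a measure" ..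
  show ?thesis
  proof (intro exI[of _ C] conjI allI impI ballI)
    fix \<epsilon> :: real and h :: "'a \<Rightarrow> ennreal" assume \<epsilon>: "\<epsilon> > 0" and [measurable]: "h \<in> borel_measurable borel"
    let ?k = "\<lambda>x z y. indicator {-\<epsilon><..<0} (1 + Q x + (norm z)\<^sup>2 - (norm y)\<^sup>2) * (p x * (neg_pow (norm z) a * neg_pow (norm y) b) * h (S x + z + y))"
    have "thick_integral I \<alpha> a b \<epsilon> h = (\<integral>\<^sup>+x. (\<integral>\<^sup>+z. (\<integral>\<^sup>+y. ?k x z y \<partial>lborel) \<partial>lborel) \<partial>?P)"
      unfolding thick_integral_def S_def Q_def p_def ..
    also have "\<dots> = (\<integral>\<^sup>+x. (\<integral>\<^sup>+z. (\<integral>\<^sup>+s. ?k x z (s - (S x + z)) \<partial>lborel) \<partial>lborel) \<partial>?P)"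
      by (intro nn_integral_cong nn_integral_lborel_shift[symmetric]) measurable
    also have "\<dots> = (\<integral>\<^sup>+x. (\<integral>\<^sup>+s. (\<integral>\<^sup>+z. ?k x z (s - (S x + z)) \<partial>lborel) \<partial>lborel) \<partial>?P)"
      by (intro nn_integral_cong lborel_pair.Fubini') measurable
    also have "\<dots> = (\<integral>\<^sup>+s. (\<integral>\<^sup>+x. (\<integral>\<^sup>+z. ?k x z (s - (S x + z)) \<partial>lborel) \<partial>?P) \<partial>lborel)"
      by (rule pair.Fubini'[symmetric]) measurable
    also have "\<dots> \<le> (\<integral>\<^sup>+s. ennreal (\<epsilon> * C) * (neg_pow (norm s) ?e * h s) \<partial>lborel)"
    proof (rule nn_integral_mono)
      fix s :: 'a
      have "(\<integral>\<^sup>+x. (\<integral>\<^sup>+z. ?k x z (s - (S x + z)) \<partial>lborel) \<partial>?P)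
        = (\<integral>\<^sup>+x. h s * (p x * (\<integral>\<^sup>+z. indicator {-\<epsilon><..<0} (1 + Q x + (norm z)\<^sup>2 - (norm (s - S x - z))\<^sup>2) *
            (neg_pow (norm z) a * neg_pow (norm (s - S x - z)) b) \<partial>lborel)) \<partial>?P)"
      proof (rule nn_integral_cong)
        fix x
        have "(\<integral>\<^sup>+z. ?k x z (s - (S x + z)) \<partial>lborel)
          = (\<integral>\<^sup>+z. (h s * p x) * (indicator {-\<epsilon><..<0} (1 + Q x + (norm z)\<^sup>2 - (norm (s - S x - z))\<^sup>2) *
            (neg_pow (norm z) a * neg_pow (norm (s - S x - z)) b)) \<partial>lborel)"
          by (intro nn_integral_cong) (simp add: diff_diff_eq mult_ac)
        also have "\<dots> = (h s * p x) * (\<integral>\<^sup>+z. indicator {-\<epsilon><..<0} (1 + Q x + (norm z)\<^sup>2 - (norm (s - S x - z))\<^sup>2) *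
            (neg_pow (norm z) a * neg_pow (norm (s - S x - z)) b) \<partial>lborel)"
          by (rule nn_integral_cmult) measurable
        finally show "(\<integral>\<^sup>+z. ?k x z (s - (S x + z)) \<partial>lborel) = h s * (p x * (\<integral>\<^sup>+z. indicator {-\<epsilon><..<0} (1 + Q x + (norm z)\<^sup>2 - (norm (s - S x - z))\<^sup>2) *
            (neg_pow (norm z) a * neg_pow (norm (s - S x - z)) b) \<partial>lborel))" by (simp only: mult.assoc)
      qed
      also have "\<dots> = h s * (\<integral>\<^sup>+x. p x * (\<integral>\<^sup>+z. indicator {-\<epsilon><..<0} (1 + Q x + (norm z)\<^sup>2 - (norm (s - S x - z))\<^sup>2) *
            (neg_pow (norm z) a * neg_pow (norm (s - S x - z)) b) \<partial>lborel) \<partial>?P)"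
        by (rule nn_integral_cmult) measurable
      also have "\<dots> \<le> h s * (ennreal (\<epsilon> * C) * neg_pow (norm s) ?e)"
        by (intro mult_left_mono C(2) \<epsilon>) simp
      finally show "(\<integral>\<^sup>+x. (\<integral>\<^sup>+z. ?k x z (s - (S x + z)) \<partial>lborel) \<partial>?P) \<le> ennreal (\<epsilon> * C) * (neg_pow (norm s) ?e * h s)"
        by (simp only: mult_ac)
    qed
    also have "\<dots> = ennreal (\<epsilon> * C) * (\<integral>\<^sup>+s. neg_pow (norm s) ?e * h s \<partial>lborel)"
      by (rule nn_integral_cmult) measurable
    finally show "thick_integral I \<alpha> a b \<epsilon> h \<le> ennreal (\<epsilon> * C) * (\<integral>\<^sup>+s. neg_pow (norm s) ?e * h s \<partial>lborel)" .
  qed (rule C)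
qed

text \<open>
  With equal exponents \<open>\<alpha> = n - 1\<close> the slab integral over \<open>z\<close> diverges logarithmically.
  Since \<open>z\<close> and \<open>x\<^sub>j\<close> play the same role, a little of the weight of the smaller of the two may be
  moved to the other one.
\<close>

lemma thick_integral_equal_exponents:
  fixes \<alpha> :: real and I :: "'i set"
  assumes I: "finite I" "I \<noteq> {}" and n: "DIM('a) \<ge> 2"
    and \<alpha>: "1 \<le> \<alpha>" "\<alpha> \<le> real DIM('a) - 1"
    and M: "card I * (DIM('a) - \<alpha>) + (real DIM('a) - 1) - 2 * \<alpha> < 1"
  shows "\<exists>C>0. \<forall>\<epsilon>>0. \<forall>h\<in>borel_measurable borel.
    thick_integral I (\<lambda>_. \<alpha>) \<alpha> \<alpha> \<epsilon> h \<le> ennreal (\<epsilon> * C) *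
      (\<integral>\<^sup>+(s::'a::euclidean_space). neg_pow (norm s) (2 + 2 * \<alpha> - DIM('a) - card I * (DIM('a) - \<alpha>)) * h s \<partial>lborel)"
proof -
  let ?n = "real DIM('a)" and ?m = "real (card I)"
  obtain j where j: "j \<in> I" using I by auto
  define J where "J = I - {j}"
  have J: "finite J" "j \<notin> J" "I = insert j J" using I j by (auto simp: J_def)
  have m: "?m \<ge> 1" using I by (simp add: Suc_le_eq card_gt_0_iff)
  \<comment> \<open>\<sigma> is to be the sum of the deficits \<theta> i. It must stay below 1 for
    the fibre bound and be large enough for \<open>\<gamma>0\<close> to be nonnegative; the 1/2
    keeps it positive.\<close>
  define \<sigma> where "\<sigma> = max (1/2) (?m * (?n - \<alpha>) + (?n - 1) - 2 * \<alpha>)"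
  define \<eta> where "\<eta> = (1 - \<sigma>) / 2"
  have \<sigma>: "0 < \<sigma>" "\<sigma> < 1" "?m * (?n - \<alpha>) + (?n - 1) - 2 * \<alpha> \<le> \<sigma>" using M by (auto simp: \<sigma>_def)
  have \<eta>: "0 < \<eta>" "\<eta> + \<sigma> < 1" using \<sigma> by (auto simp: \<eta>_def field_simps)
  have \<sigma>m: "0 < \<sigma> / ?m" "\<sigma> / ?m \<le> \<sigma>" using \<sigma> m by (auto simp: divide_le_eq mult_le_cancel_left1)
  \<comment> \<open>The weight \<eta> taken from z goes to x_j. Since n - \<alpha> \<ge> 1 > \<eta>
    + \<sigma>, the share \<gamma> j remains positive.\<close>
  define \<alpha>' where "\<alpha>' = (\<lambda>_. \<alpha>)(j := \<alpha> + \<eta>)"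
  define \<theta> where "\<theta> = (\<lambda>_::'i. \<sigma> / ?m)"
  define \<gamma> where "\<gamma> i = ?n - \<theta> i - \<alpha>' i" for i
  \<comment> \<open>This value makes the shares add up to the exponent of the slab estimate for the
    modified weights.\<close>
  define \<gamma>0 where "\<gamma>0 = 2 * \<alpha> - (?n - 1) - ?m * (?n - \<alpha>) + \<sigma>"
  have \<theta>s: "sum \<theta> I = \<sigma>" using m by (simp add: \<theta>_def)
  have \<alpha>s: "sum \<alpha>' I = ?m * \<alpha> + \<eta>"
    using I j by (simp add: \<alpha>'_def sum.remove[OF I(1) j] card_Diff_singleton_if of_nat_diff algebra_simps Suc_le_eq card_gt_0_iff)
  have \<gamma>s: "sum \<gamma> I = ?m * (?n - \<alpha>) - \<eta> - \<sigma>"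
    unfolding \<gamma>_def sum_subtractf \<theta>s \<alpha>s by (simp add: algebra_simps)
  have \<gamma>pos: "0 \<le> \<gamma> i" for i
    using \<alpha> \<eta> \<sigma>m \<sigma> by (auto simp: \<gamma>_def \<theta>_def \<alpha>'_def)
  \<comment> \<open>Positivity of one share makes the whole slab exponent positive, which is the
    convergence condition a + b > n - 1.\<close>
  have \<gamma>j: "0 < \<gamma> j" using \<alpha> \<eta> \<sigma>m \<sigma> by (auto simp: \<gamma>_def \<theta>_def \<alpha>'_def)
  have "\<gamma> j \<le> sum \<gamma> I" using I j \<gamma>pos by (intro member_le_sum) auto
  then have "0 < sum \<gamma> I" using \<gamma>j by simp
  moreover have \<gamma>0: "0 \<le> \<gamma>0" "\<gamma>0 + sum \<gamma> I = (\<alpha> - \<eta>) + \<alpha> - (?n - 1)"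
    using \<sigma> by (auto simp: \<gamma>0_def \<gamma>s)
  ultimately have P: "?n - 1 < (\<alpha> - \<eta>) + \<alpha>" by linarith
  have "\<exists>C>0. \<forall>\<epsilon>>0. \<forall>h\<in>borel_measurable borel.
    thick_integral I \<alpha>' (\<alpha> - \<eta>) \<alpha> \<epsilon> h \<le> ennreal (\<epsilon> * C) * (\<integral>\<^sup>+(s::'a). neg_pow (norm s) (1 - sum \<theta> I + \<gamma>0) * h s \<partial>lborel)"
  proof (rule thick_integral_bound[OF I(1) n, where \<gamma> = \<gamma>])
    show "0 < \<theta> i \<and> \<theta> i \<le> ?n" for i using \<sigma>m \<sigma> n by (auto simp: \<theta>_def)
    show "\<alpha>' i + \<gamma> i = ?n - \<theta> i" for i by (simp add: \<gamma>_def)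
  qed (use \<alpha> \<eta> \<sigma> \<gamma>pos \<theta>s P \<gamma>0 in auto)
  moreover have "1 - sum \<theta> I + \<gamma>0 = 2 + 2 * \<alpha> - ?n - ?m * (?n - \<alpha>)"
    unfolding \<theta>s \<gamma>0_def by (simp add: algebra_simps)
  ultimately obtain C where C: "C > 0" "\<And>\<epsilon> h. \<epsilon> > 0 \<Longrightarrow> h \<in> borel_measurable borel \<Longrightarrow>
    thick_integral I \<alpha>' (\<alpha> - \<eta>) \<alpha> \<epsilon> h \<le> ennreal (\<epsilon> * C) * (\<integral>\<^sup>+(s::'a). neg_pow (norm s) (2 + 2 * \<alpha> - ?n - ?m * (?n - \<alpha>)) * h s \<partial>lborel)"
    by auto
  interpret P: product_sigma_finite "\<lambda>_::'i. lborel :: 'a measure" by (rule product_sigma_finite_lborel)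
  let ?P = "PiM J (\<lambda>_. lborel :: 'a measure)"
  have le: "thick_integral I (\<lambda>_. \<alpha>) \<alpha> \<alpha> \<epsilon> h \<le> 2 * thick_integral I \<alpha>' (\<alpha> - \<eta>) \<alpha> \<epsilon> h"
    if [measurable]: "h \<in> borel_measurable borel" for \<epsilon> and h :: "'a \<Rightarrow> ennreal"
  proof -
    define S where "S x = (\<Sum>i\<in>J. x i :: 'a)" for x
    define Q where "Q x = (\<Sum>i\<in>J. (norm (x i :: 'a))\<^sup>2)" for x
    define p where "p x = (\<Prod>i\<in>J. neg_pow (norm (x i :: 'a)) \<alpha>)" for x
    have [measurable]: "S \<in> borel_measurable ?P" "Q \<in> borel_measurable ?P" "p \<in> borel_measurable ?P"
      unfolding S_def Q_def p_def by measurable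
    \<comment> \<open>R gathers all factors other than the weights of u = x_j and z. It is symmetric
      in u and z, since these enter F and the sum s in the same way.\<close>
    define R where "R x u z = (\<integral>\<^sup>+y. indicator {-\<epsilon><..<0} (1 + (Q x + (norm u)\<^sup>2) + (norm z)\<^sup>2 - (norm y)\<^sup>2) *
      (p x * neg_pow (norm y) \<alpha> * h (S x + (u + z) + y)) \<partial>lborel)" for x and u z :: 'a
    have R_commute: "R x u z = R x z u" for x u z
      unfolding R_def by (simp only: add.commute[of u z] add.assoc add.commute[of "(norm u)\<^sup>2"])
    have [measurable]: "(\<lambda>w. R (f w) (g w) (k w)) \<in> borel_measurable M"
      if [measurable]: "f \<in> M \<rightarrow>\<^sub>M ?P" "g \<in> borel_measurable M" "k \<in> borel_measurable M" for M :: "'c measure" and f g k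
      unfolding R_def by measurable
    have split: "thick_integral I \<beta> a \<alpha> \<epsilon> h
        = (\<integral>\<^sup>+x. (\<integral>\<^sup>+u. (\<integral>\<^sup>+z. neg_pow (norm u) (\<beta> j) * neg_pow (norm z) a * R x u z \<partial>lborel) \<partial>lborel) \<partial>?P)"
      if \<beta>: "\<And>i. i \<in> J \<Longrightarrow> \<beta> i = \<alpha>" for \<beta> a
    proof -
      let ?k = "\<lambda>x z y. indicator {-\<epsilon><..<0} (1 + (\<Sum>i\<in>insert j J. (norm (x i :: 'a))\<^sup>2) + (norm z)\<^sup>2 - (norm y)\<^sup>2) *
          ((\<Prod>i\<in>insert j J. neg_pow (norm (x i)) (\<beta> i)) * (neg_pow (norm z) a * neg_pow (norm y) \<alpha>) * h ((\<Sum>i\<in>insert j J. x i) + z + y))"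
      have "thick_integral I \<beta> a \<alpha> \<epsilon> h = (\<integral>\<^sup>+x. (\<integral>\<^sup>+z. (\<integral>\<^sup>+y. ?k x z y \<partial>lborel) \<partial>lborel) \<partial>PiM (insert j J) (\<lambda>_. lborel))"
        unfolding thick_integral_def J(3) ..
      also have "\<dots> = (\<integral>\<^sup>+x. (\<integral>\<^sup>+u. (\<integral>\<^sup>+z. (\<integral>\<^sup>+y. ?k (x(j := u)) z y \<partial>lborel) \<partial>lborel) \<partial>lborel) \<partial>?P)"
        by (rule P.product_nn_integral_insert[OF J(1,2)]) measurable
      also have "\<dots> = (\<integral>\<^sup>+x. (\<integral>\<^sup>+u. (\<integral>\<^sup>+z. neg_pow (norm u) (\<beta> j) * neg_pow (norm z) a * R x u z \<partial>lborel) \<partial>lborel) \<partial>?P)"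
      proof (intro nn_integral_cong)
        fix x and u z :: 'a
        have upd: "(\<Prod>i\<in>insert j J. neg_pow (norm ((x(j := u)) i)) (\<beta> i)) = neg_pow (norm u) (\<beta> j) * p x"
          "(\<Sum>i\<in>insert j J. (norm ((x(j := u)) i))\<^sup>2) = Q x + (norm u)\<^sup>2"
          "(\<Sum>i\<in>insert j J. (x(j := u)) i) = S x + u"
          using J \<beta> by (auto simp: p_def Q_def S_def add.commute intro!: prod.cong sum.cong arg_cong2[where f="(*)"] arg_cong2[where f="(+)"])
        have "(\<integral>\<^sup>+y. ?k (x(j := u)) z y \<partial>lborel)
          = (\<integral>\<^sup>+y. (neg_pow (norm u) (\<beta> j) * neg_pow (norm z) a) * (indicator {-\<epsilon><..<0} (1 + (Q x + (norm u)\<^sup>2) + (norm z)\<^sup>2 - (norm y)\<^sup>2) *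
      (p x * neg_pow (norm y) \<alpha> * h (S x + (u + z) + y))) \<partial>lborel)"
          unfolding upd by (intro nn_integral_cong) (simp only: mult_ac add.assoc)
        also have "\<dots> = neg_pow (norm u) (\<beta> j) * neg_pow (norm z) a * R x u z"
          unfolding R_def by (rule nn_integral_cmult) measurable
        finally show "(\<integral>\<^sup>+y. ?k (x(j := u)) z y \<partial>lborel) = neg_pow (norm u) (\<beta> j) * neg_pow (norm z) a * R x u z" .
      qed
      finally show ?thesis .
    qed
    \<comment> \<open>The smaller radius takes over the factor with exponent \<eta>. Adding both
      orders covers all cases, and by the symmetry of R they have equal integrals, hence the factor
      2.\<close>
    have swap: "neg_pow r \<alpha> * neg_pow t \<alpha> \<le> neg_pow r (\<alpha> + \<eta>) * neg_pow t (\<alpha> - \<eta>) + neg_pow t (\<alpha> + \<eta>) * neg_pow r (\<alpha> - \<eta>)"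
      if "0 \<le> r" "0 \<le> t" for r t
    proof -
      have *: "neg_pow r \<alpha> * neg_pow t \<alpha> \<le> neg_pow r (\<alpha> + \<eta>) * neg_pow t (\<alpha> - \<eta>)" if "0 \<le> r" "r \<le> t" for r t
      proof -
        have "neg_pow r \<alpha> * neg_pow t \<alpha> = neg_pow r \<alpha> * (neg_pow t (\<alpha> - \<eta>) * neg_pow t \<eta>)"
          using that by (simp add: neg_pow_add)
        also have "\<dots> \<le> neg_pow r \<alpha> * (neg_pow t (\<alpha> - \<eta>) * neg_pow r \<eta>)"
          using that \<eta> by (intro mult_left_mono neg_pow_antimono) auto
        also have "\<dots> = (neg_pow r \<alpha> * neg_pow r \<eta>) * neg_pow t (\<alpha> - \<eta>)" by (simp only: mult_ac)
        also have "\<dots> = neg_pow r (\<alpha> + \<eta>) * neg_pow t (\<alpha> - \<eta>)" using that by (simp add: neg_pow_add)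
        finally show ?thesis .
      qed
      show ?thesis
      proof (cases "r \<le> t")
        case True
        show ?thesis by (rule order_trans[OF *[OF that(1) True]]) simp
      next
        case False
        then have "t \<le> r" by simp
        show ?thesis unfolding mult.commute[of "neg_pow r \<alpha>"] by (rule order_trans[OF *[OF that(2) \<open>t \<le> r\<close>]]) simp
      qed
    qed
    let ?w = "\<lambda>u z :: 'a. neg_pow (norm u) (\<alpha> + \<eta>) * neg_pow (norm z) (\<alpha> - \<eta>)"
    have main: "(\<integral>\<^sup>+u. (\<integral>\<^sup>+z. neg_pow (norm u) \<alpha> * neg_pow (norm z) \<alpha> * R x u z \<partial>lborel) \<partial>lborel)
      \<le> 2 * (\<integral>\<^sup>+u. (\<integral>\<^sup>+z. ?w u z * R x u z \<partial>lborel) \<partial>lborel)" if x: "x \<in> space ?P" for x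
    proof -
      note [measurable] = measurable_const[OF x]
      have "(\<integral>\<^sup>+u. (\<integral>\<^sup>+z. neg_pow (norm u) \<alpha> * neg_pow (norm z) \<alpha> * R x u z \<partial>lborel) \<partial>lborel)
        \<le> (\<integral>\<^sup>+u. (\<integral>\<^sup>+z. ?w u z * R x u z + ?w z u * R x z u \<partial>lborel) \<partial>lborel)"
      proof (intro nn_integral_mono)
        fix u z :: 'a
        have "neg_pow (norm u) \<alpha> * neg_pow (norm z) \<alpha> * R x u z \<le> (?w u z + ?w z u) * R x u z"
          by (intro mult_right_mono swap) auto
        then show "neg_pow (norm u) \<alpha> * neg_pow (norm z) \<alpha> * R x u z \<le> ?w u z * R x u z + ?w z u * R x z u"
          by (simp add: distrib_right R_commute[of x z u])
      qed
      also have "\<dots> = (\<integral>\<^sup>+u. (\<integral>\<^sup>+z. ?w u z * R x u z \<partial>lborel) + (\<integral>\<^sup>+z. ?w z u * R x z u \<partial>lborel) \<partial>lborel)"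
        by (intro nn_integral_cong nn_integral_add) measurable
      also have "\<dots> = (\<integral>\<^sup>+u. (\<integral>\<^sup>+z. ?w u z * R x u z \<partial>lborel) \<partial>lborel) + (\<integral>\<^sup>+u. (\<integral>\<^sup>+z. ?w z u * R x z u \<partial>lborel) \<partial>lborel)"
        by (rule nn_integral_add) measurable
      also have "(\<integral>\<^sup>+u. (\<integral>\<^sup>+z. ?w z u * R x z u \<partial>lborel) \<partial>lborel) = (\<integral>\<^sup>+u. (\<integral>\<^sup>+z. ?w u z * R x u z \<partial>lborel) \<partial>lborel)"
        by (rule lborel_pair.Fubini') measurable
      finally show ?thesis by (simp add: mult_2)
    qed
    have "thick_integral I (\<lambda>_. \<alpha>) \<alpha> \<alpha> \<epsilon> h = (\<integral>\<^sup>+x. (\<integral>\<^sup>+u. (\<integral>\<^sup>+z. neg_pow (norm u) \<alpha> * neg_pow (norm z) \<alpha> * R x u z \<partial>lborel) \<partial>lborel) \<partial>?P)"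
      by (rule split) simp
    also have "\<dots> \<le> (\<integral>\<^sup>+x. 2 * (\<integral>\<^sup>+u. (\<integral>\<^sup>+z. ?w u z * R x u z \<partial>lborel) \<partial>lborel) \<partial>?P)"
      by (intro nn_integral_mono main)
    also have "\<dots> = 2 * (\<integral>\<^sup>+x. (\<integral>\<^sup>+u. (\<integral>\<^sup>+z. ?w u z * R x u z \<partial>lborel) \<partial>lborel) \<partial>?P)"
      by (rule nn_integral_cmult) measurable
    also have "(\<integral>\<^sup>+x. (\<integral>\<^sup>+u. (\<integral>\<^sup>+z. ?w u z * R x u z \<partial>lborel) \<partial>lborel) \<partial>?P) = thick_integral I \<alpha>' (\<alpha> - \<eta>) \<alpha> \<epsilon> h"
    proof -
      have "\<alpha>' i = \<alpha>" if "i \<in> J" for i using that J(2) by (auto simp: \<alpha>'_def)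
      then have "thick_integral I \<alpha>' (\<alpha> - \<eta>) \<alpha> \<epsilon> h
        = (\<integral>\<^sup>+x. (\<integral>\<^sup>+u. (\<integral>\<^sup>+z. neg_pow (norm u) (\<alpha>' j) * neg_pow (norm z) (\<alpha> - \<eta>) * R x u z \<partial>lborel) \<partial>lborel) \<partial>?P)"
        by (rule split)
      moreover have "\<alpha>' j = \<alpha> + \<eta>" by (simp add: \<alpha>'_def)
      ultimately show ?thesis by (simp only:)
    qed
    finally show ?thesis .
  qed
  show ?thesis
  proof (intro exI[of _ "2 * C"] conjI allI impI ballI)
    fix \<epsilon> :: real and h :: "'a \<Rightarrow> ennreal" assume \<epsilon>: "\<epsilon> > 0" and h: "h \<in> borel_measurable borel"
    let ?B = "\<integral>\<^sup>+(s::'a). neg_pow (norm s) (2 + 2 * \<alpha> - ?n - ?m * (?n - \<alpha>)) * h s \<partial>lborel"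
    have "thick_integral I (\<lambda>_. \<alpha>) \<alpha> \<alpha> \<epsilon> h \<le> 2 * (ennreal (\<epsilon> * C) * ?B)"
      by (rule order_trans[OF le[OF h] mult_left_mono[OF C(2)[OF \<epsilon> h]]]) simp
    also have "\<dots> = ennreal (\<epsilon> * (2 * C)) * ?B"
      using \<epsilon> C(1) by (simp add: ennreal_mult mult_ac)
    finally show "thick_integral I (\<lambda>_. \<alpha>) \<alpha> \<alpha> \<epsilon> h \<le> ennreal (\<epsilon> * (2 * C)) * ?B" .
  qed (use C in simp)
qed

subsection \<open>The Stein--Weiss inequality\<close>

text \<open>For e = 2 \<beta> the quadratic form of this kernel is the squared L^2 norm of the
  function |s|^-\<beta> times the integral of |w - s|^-\<kappa> f(w) over w, so its boundedness is
  the Stein--Weiss inequality.\<close>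

definition stein_weiss_kernel :: "real \<Rightarrow> real \<Rightarrow> 'a::euclidean_space \<Rightarrow> 'a \<Rightarrow> ennreal" where
  "stein_weiss_kernel \<kappa> e w v =
    (\<integral>\<^sup>+s. neg_pow (norm s) e * (neg_pow (norm (w - s)) \<kappa> * neg_pow (norm (v - s)) \<kappa>) \<partial>lborel)"

lemma measurable_stein_weiss_kernel [measurable]:
  "(\<lambda>(w, v). stein_weiss_kernel \<kappa> e w v) \<in> borel_measurable (lborel \<Otimes>\<^sub>M lborel)"
  unfolding stein_weiss_kernel_def by measurable

lemma stein_weiss_kernel_commute: "stein_weiss_kernel \<kappa> e w v = stein_weiss_kernel \<kappa> e v w"
  unfolding stein_weiss_kernel_def by (simp add: mult_ac)

lemma AE_lborel_neq_0: "AE x in (lborel :: 'a::euclidean_space measure). x \<noteq> 0"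
  by (rule AE_I[of _ _ "{0}"]) auto

text \<open>Two two-centre integrals. The one over v turns n/2 and \<kappa> into n/2 - \<beta>,
  which joins 2 \<beta> to give n/2 + \<beta>; the one over s turns this and \<kappa> back into n/2.
  The bounds 0 < \<beta> < n/2 are what both convergence conditions require.\<close>

lemma stein_weiss_schur:
  fixes \<beta> \<kappa> :: real
  assumes \<beta>: "0 < \<beta>" "\<beta> < DIM('a) / 2" and \<kappa>: "\<kappa> = DIM('a) - \<beta>"
  obtains C :: real where "C > 0"
    "\<And>w::'a::euclidean_space. (\<integral>\<^sup>+v. stein_weiss_kernel \<kappa> (2 * \<beta>) w v * neg_pow (norm v) (DIM('a) / 2) \<partial>lborel)
      \<le> ennreal C * neg_pow (norm w) (DIM('a) / 2)"
proof -
  let ?n = "real DIM('a)"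
  obtain C1 where C1: "C1 > 0" "\<And>y::'a. (\<integral>\<^sup>+x. neg_pow (norm x) (?n / 2) * neg_pow (norm (x - y)) \<kappa> \<partial>lborel)
      \<le> ennreal C1 * neg_pow (norm y) (?n / 2 + \<kappa> - ?n)"
    by (rule two_centre_bound[where 'a='a, of "?n / 2" \<kappa>]) (use assms that in auto)
  obtain C2 where C2: "C2 > 0" "\<And>y::'a. (\<integral>\<^sup>+x. neg_pow (norm x) (\<beta> + ?n / 2) * neg_pow (norm (x - y)) \<kappa> \<partial>lborel)
      \<le> ennreal C2 * neg_pow (norm y) (\<beta> + ?n / 2 + \<kappa> - ?n)"
    by (rule two_centre_bound[where 'a='a, of "\<beta> + ?n / 2" \<kappa>]) (use assms that in auto)
  have "(\<integral>\<^sup>+v. stein_weiss_kernel \<kappa> (2 * \<beta>) w v * neg_pow (norm v) (?n / 2) \<partial>lborel)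
      \<le> ennreal (C1 * C2) * neg_pow (norm w) (?n / 2)" for w :: 'a
  proof -
    have "(\<integral>\<^sup>+v. stein_weiss_kernel \<kappa> (2 * \<beta>) w v * neg_pow (norm v) (?n / 2) \<partial>lborel)
      = (\<integral>\<^sup>+v. (\<integral>\<^sup>+s. (neg_pow (norm s) (2 * \<beta>) * neg_pow (norm (w - s)) \<kappa>) * (neg_pow (norm v) (?n / 2) * neg_pow (norm (v - s)) \<kappa>) \<partial>lborel) \<partial>lborel)"
      unfolding stein_weiss_kernel_def
      by (subst nn_integral_multc[symmetric]) (auto simp: mult_ac intro!: nn_integral_cong)
    also have "\<dots> = (\<integral>\<^sup>+s. (\<integral>\<^sup>+v. (neg_pow (norm s) (2 * \<beta>) * neg_pow (norm (w - s)) \<kappa>) * (neg_pow (norm v) (?n / 2) * neg_pow (norm (v - s)) \<kappa>) \<partial>lborel) \<partial>lborel)"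
      by (rule lborel_pair.Fubini') measurable
    also have "\<dots> = (\<integral>\<^sup>+s. (neg_pow (norm s) (2 * \<beta>) * neg_pow (norm (w - s)) \<kappa>) * (\<integral>\<^sup>+v. neg_pow (norm v) (?n / 2) * neg_pow (norm (v - s)) \<kappa> \<partial>lborel) \<partial>lborel)"
      by (intro nn_integral_cong nn_integral_cmult) measurable
    also have "\<dots> \<le> (\<integral>\<^sup>+s. (neg_pow (norm s) (2 * \<beta>) * neg_pow (norm (w - s)) \<kappa>) * (ennreal C1 * neg_pow (norm s) (?n / 2 + \<kappa> - ?n)) \<partial>lborel)"
      by (intro nn_integral_mono mult_left_mono C1) simp
    also have "\<dots> = (\<integral>\<^sup>+s. ennreal C1 * (neg_pow (norm s) (\<beta> + ?n / 2) * neg_pow (norm (s - w)) \<kappa>) \<partial>lborel)"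
    proof (rule nn_integral_cong)
      fix s :: 'a
      have "neg_pow (norm s) (2 * \<beta>) * neg_pow (norm s) (?n / 2 + \<kappa> - ?n) = neg_pow (norm s) (\<beta> + ?n / 2)"
        by (simp add: neg_pow_add \<kappa>)
      moreover have "(neg_pow (norm s) (2 * \<beta>) * neg_pow (norm (w - s)) \<kappa>) * (ennreal C1 * neg_pow (norm s) (?n / 2 + \<kappa> - ?n))
        = ennreal C1 * ((neg_pow (norm s) (2 * \<beta>) * neg_pow (norm s) (?n / 2 + \<kappa> - ?n)) * neg_pow (norm (w - s)) \<kappa>)"
        by (simp only: mult_ac)
      ultimately show "(neg_pow (norm s) (2 * \<beta>) * neg_pow (norm (w - s)) \<kappa>) * (ennreal C1 * neg_pow (norm s) (?n / 2 + \<kappa> - ?n))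
        = ennreal C1 * (neg_pow (norm s) (\<beta> + ?n / 2) * neg_pow (norm (s - w)) \<kappa>)"
        by (simp only: norm_minus_commute[of s w])
    qed
    also have "\<dots> = ennreal C1 * (\<integral>\<^sup>+s. neg_pow (norm s) (\<beta> + ?n / 2) * neg_pow (norm (s - w)) \<kappa> \<partial>lborel)"
      by (rule nn_integral_cmult) measurable
    also have "\<dots> \<le> ennreal C1 * (ennreal C2 * neg_pow (norm w) (\<beta> + ?n / 2 + \<kappa> - ?n))"
      by (intro mult_left_mono C2) simp
    also have "\<dots> = ennreal (C1 * C2) * neg_pow (norm w) (?n / 2)"
      using C1(1) C2(1) by (simp add: \<kappa> ennreal_mult mult.assoc)
    finally show ?thesis .
  qed
  then show thesis using that[of "C1 * C2"] C1(1) C2(1) by simp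
qed

text \<open>
  Schur's test in the form \<open>f(w) f(v) \<le> (f(w)\<^sup>2 p(w) / p(v) + f(v)\<^sup>2 p(v) / p(w)) / 2\<close> with \<open>p(x) = \<bar>x\<bar>\<^bsup>n/2\<^esup>\<close>.
\<close>

lemma stein_weiss:
  fixes \<beta> \<kappa> :: real
  assumes \<beta>: "0 < \<beta>" "\<beta> < DIM('a) / 2" and \<kappa>: "\<kappa> = DIM('a) - \<beta>"
  obtains C :: real where "C > 0"
    "\<And>f :: 'a::euclidean_space \<Rightarrow> real. f \<in> borel_measurable lborel \<Longrightarrow> (\<And>x. 0 \<le> f x) \<Longrightarrow>
      (\<integral>\<^sup>+(w, v). ennreal (f w) * stein_weiss_kernel \<kappa> (2 * \<beta>) w v * ennreal (f v) \<partial>(lborel \<Otimes>\<^sub>M lborel))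
        \<le> ennreal C * (\<integral>\<^sup>+x. ennreal ((f x)\<^sup>2) \<partial>lborel)"
proof -
  let ?n = "real DIM('a)" and ?T = "stein_weiss_kernel \<kappa> (2 * \<beta>) :: 'a \<Rightarrow> 'a \<Rightarrow> ennreal"
  obtain C where C: "C > 0" "\<And>w::'a. (\<integral>\<^sup>+v. ?T w v * neg_pow (norm v) (?n / 2) \<partial>lborel)
      \<le> ennreal C * neg_pow (norm w) (?n / 2)"
    by (rule stein_weiss_schur[where 'a='a, OF assms]) (rule that)
  have "(\<integral>\<^sup>+(w, v). ennreal (f w) * ?T w v * ennreal (f v) \<partial>(lborel \<Otimes>\<^sub>M lborel))
        \<le> ennreal C * (\<integral>\<^sup>+x. ennreal ((f x)\<^sup>2) \<partial>lborel)"
    if [measurable]: "f \<in> borel_measurable lborel" and f0: "\<And>x. 0 \<le> f x" for f :: "'a \<Rightarrow> real"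
  proof -
    define p where "p x = norm x powr (?n / 2)" for x :: 'a
    have [measurable]: "p \<in> borel_measurable borel" unfolding p_def by measurable
    define g where "g w v = ennreal ((f w)\<^sup>2 * p w) * (?T w v * neg_pow (norm v) (?n / 2))" for w v
    have [measurable]: "(\<lambda>(w, v). g w v) \<in> borel_measurable (lborel \<Otimes>\<^sub>M lborel)" unfolding g_def by measurable
    have int: "(\<integral>\<^sup>+w. (\<integral>\<^sup>+v. g w v \<partial>lborel) \<partial>lborel) \<le> ennreal C * (\<integral>\<^sup>+x. ennreal ((f x)\<^sup>2) \<partial>lborel)"
    proof -
      have "(\<integral>\<^sup>+w. (\<integral>\<^sup>+v. g w v \<partial>lborel) \<partial>lborel) = (\<integral>\<^sup>+w. ennreal ((f w)\<^sup>2 * p w) * (\<integral>\<^sup>+v. ?T w v * neg_pow (norm v) (?n / 2) \<partial>lborel) \<partial>lborel)"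
        unfolding g_def by (intro nn_integral_cong nn_integral_cmult) measurable
      also have "\<dots> \<le> (\<integral>\<^sup>+w. ennreal ((f w)\<^sup>2 * p w) * (ennreal C * neg_pow (norm w) (?n / 2)) \<partial>lborel)"
        by (intro nn_integral_mono mult_left_mono C) simp
      also have "\<dots> = (\<integral>\<^sup>+w. ennreal C * ennreal ((f w)\<^sup>2) \<partial>lborel)"
      proof (rule nn_integral_cong_AE)
        \<comment> \<open>The functions p and |w|^(-n/2) are reciprocal away from the origin, which
          is a null set.\<close>
        show "AE w in lborel. ennreal ((f w)\<^sup>2 * p w) * (ennreal C * neg_pow (norm w) (?n / 2)) = ennreal C * ennreal ((f w)\<^sup>2)"
          using AE_lborel_neq_0
        proof eventually_elim
          fix w :: 'a assume w: "w \<noteq> 0"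
          have "ennreal (p w) * neg_pow (norm w) (?n / 2) = 1"
            using w by (simp add: p_def neg_pow_pos powr_minus ennreal_mult[symmetric])
          moreover have "ennreal ((f w)\<^sup>2 * p w) = ennreal ((f w)\<^sup>2) * ennreal (p w)"
            by (simp add: ennreal_mult p_def)
          moreover have "ennreal ((f w)\<^sup>2) * ennreal (p w) * (ennreal C * neg_pow (norm w) (?n / 2))
            = ennreal C * ennreal ((f w)\<^sup>2) * (ennreal (p w) * neg_pow (norm w) (?n / 2))"
            by (simp only: mult_ac)
          ultimately show "ennreal ((f w)\<^sup>2 * p w) * (ennreal C * neg_pow (norm w) (?n / 2)) = ennreal C * ennreal ((f w)\<^sup>2)"
            by (simp only: mult_1_right)
        qed
      qed
      also have "\<dots> = ennreal C * (\<integral>\<^sup>+x. ennreal ((f x)\<^sup>2) \<partial>lborel)" by (rule nn_integral_cmult) measurable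
      finally show ?thesis .
    qed
    have pw: "ennreal (f w) * ?T w v * ennreal (f v) \<le> ennreal (1/2) * (g w v + g v w)" if "w \<noteq> 0" "v \<noteq> 0" for w v
    proof -
      have pp: "p w > 0" "p v > 0" using that by (auto simp: p_def)
      \<comment> \<open>The square of f w * r - f v, divided by r, gives the weighted
        arithmetic-geometric inequality.\<close>
      define r where "r = p w / p v"
      have r: "r > 0" using pp by (simp add: r_def)
      have "0 \<le> (f w * r - f v)\<^sup>2" by simp
      then have "2 * (f w * f v) \<le> ((f w)\<^sup>2 * r\<^sup>2 + (f v)\<^sup>2) / r"
        using r by (simp add: pos_le_divide_eq power2_eq_square algebra_simps)
      also have "\<dots> = (f w)\<^sup>2 * r + (f v)\<^sup>2 / r"
        using r by (simp add: add_divide_distrib power2_eq_square)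
      finally have "2 * (f w * f v) \<le> (f w)\<^sup>2 * r + (f v)\<^sup>2 / r" .
      then have le: "f w * f v \<le> 1/2 * ((f w)\<^sup>2 * p w * (1 / p v) + (f v)\<^sup>2 * p v * (1 / p w))"
        by (simp add: r_def field_simps)
      have np: "neg_pow (norm x) (?n / 2) = ennreal (1 / p x)" if "x \<noteq> 0" for x :: 'a
        using that by (simp add: neg_pow_pos p_def powr_minus inverse_eq_divide)
      have "ennreal (f w) * ?T w v * ennreal (f v) = ennreal (f w * f v) * ?T w v"
        using f0 by (simp add: ennreal_mult mult_ac)
      also have "\<dots> \<le> ennreal (1/2 * ((f w)\<^sup>2 * p w * (1 / p v) + (f v)\<^sup>2 * p v * (1 / p w))) * ?T w v"
        by (intro mult_right_mono ennreal_leI le) simp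
      also have "ennreal (1/2 * ((f w)\<^sup>2 * p w * (1 / p v) + (f v)\<^sup>2 * p v * (1 / p w)))
        = ennreal (1/2) * (ennreal ((f w)\<^sup>2 * p w) * ennreal (1 / p v) + ennreal ((f v)\<^sup>2 * p v) * ennreal (1 / p w))"
      proof -
        have nn: "0 \<le> (f w)\<^sup>2 * p w" "0 \<le> (f v)\<^sup>2 * p v" "0 \<le> 1 / p v" "0 \<le> 1 / p w" "(0::real) \<le> 1/2"
          "0 \<le> (f w)\<^sup>2 * p w * (1 / p v)" "0 \<le> (f v)\<^sup>2 * p v * (1 / p w)"
          "0 \<le> (f w)\<^sup>2 * p w * (1 / p v) + (f v)\<^sup>2 * p v * (1 / p w)"
          using pp by auto
        show ?thesis by (simp only: nn ennreal_mult ennreal_plus)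
      qed
      also have "\<dots> * ?T w v = ennreal (1/2) * (g w v + g v w)"
        unfolding g_def np[OF that(1)] np[OF that(2)]
        by (subst (2) stein_weiss_kernel_commute) (simp only: distrib_left distrib_right mult_ac)
      finally show ?thesis .
    qed
    have "(\<integral>\<^sup>+(w, v). ennreal (f w) * ?T w v * ennreal (f v) \<partial>(lborel \<Otimes>\<^sub>M lborel))
        = (\<integral>\<^sup>+w. (\<integral>\<^sup>+v. ennreal (f w) * ?T w v * ennreal (f v) \<partial>lborel) \<partial>lborel)"
      by (subst lborel.nn_integral_fst[symmetric]) (auto simp: case_prod_unfold, measurable)
    also have "\<dots> \<le> (\<integral>\<^sup>+w. (\<integral>\<^sup>+v. ennreal (1/2) * (g w v + g v w) \<partial>lborel) \<partial>lborel)"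
    proof (rule nn_integral_mono_AE)
      show "AE w in lborel. (\<integral>\<^sup>+v. ennreal (f w) * ?T w v * ennreal (f v) \<partial>lborel) \<le> (\<integral>\<^sup>+v. ennreal (1/2) * (g w v + g v w) \<partial>lborel)"
        using AE_lborel_neq_0
      proof eventually_elim
        fix w :: 'a assume w: "w \<noteq> 0"
        show "(\<integral>\<^sup>+v. ennreal (f w) * ?T w v * ennreal (f v) \<partial>lborel) \<le> (\<integral>\<^sup>+v. ennreal (1/2) * (g w v + g v w) \<partial>lborel)"
        proof (rule nn_integral_mono_AE)
          show "AE v in lborel. ennreal (f w) * ?T w v * ennreal (f v) \<le> ennreal (1/2) * (g w v + g v w)"
            using AE_lborel_neq_0 by eventually_elim (use w pw in blast)
        qed
      qed
    qed
    also have "\<dots> = (\<integral>\<^sup>+w. ennreal (1/2) * ((\<integral>\<^sup>+v. g w v \<partial>lborel) + (\<integral>\<^sup>+v. g v w \<partial>lborel)) \<partial>lborel)"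
    proof (rule nn_integral_cong)
      fix w :: 'a
      have "(\<integral>\<^sup>+v. ennreal (1/2) * (g w v + g v w) \<partial>lborel) = ennreal (1/2) * (\<integral>\<^sup>+v. g w v + g v w \<partial>lborel)"
        by (rule nn_integral_cmult) measurable
      also have "(\<integral>\<^sup>+v. g w v + g v w \<partial>lborel) = (\<integral>\<^sup>+v. g w v \<partial>lborel) + (\<integral>\<^sup>+v. g v w \<partial>lborel)"
        by (rule nn_integral_add) measurable
      finally show "(\<integral>\<^sup>+v. ennreal (1/2) * (g w v + g v w) \<partial>lborel) = ennreal (1/2) * ((\<integral>\<^sup>+v. g w v \<partial>lborel) + (\<integral>\<^sup>+v. g v w \<partial>lborel))" .
    qed
    also have "\<dots> = ennreal (1/2) * (\<integral>\<^sup>+w. (\<integral>\<^sup>+v. g w v \<partial>lborel) + (\<integral>\<^sup>+v. g v w \<partial>lborel) \<partial>lborel)"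
      by (rule nn_integral_cmult) measurable
    also have "(\<integral>\<^sup>+w. (\<integral>\<^sup>+v. g w v \<partial>lborel) + (\<integral>\<^sup>+v. g v w \<partial>lborel) \<partial>lborel)
        = (\<integral>\<^sup>+w. (\<integral>\<^sup>+v. g w v \<partial>lborel) \<partial>lborel) + (\<integral>\<^sup>+w. (\<integral>\<^sup>+v. g v w \<partial>lborel) \<partial>lborel)"
      by (rule nn_integral_add) measurable
    also have "(\<integral>\<^sup>+w. (\<integral>\<^sup>+v. g v w \<partial>lborel) \<partial>lborel) = (\<integral>\<^sup>+w. (\<integral>\<^sup>+v. g w v \<partial>lborel) \<partial>lborel)"
      by (rule lborel_pair.Fubini') measurable
    also have "ennreal (1/2) * ((\<integral>\<^sup>+w. (\<integral>\<^sup>+v. g w v \<partial>lborel) \<partial>lborel) + (\<integral>\<^sup>+w. (\<integral>\<^sup>+v. g w v \<partial>lborel) \<partial>lborel))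
       = (ennreal (1/2) + ennreal (1/2)) * (\<integral>\<^sup>+w. (\<integral>\<^sup>+v. g w v \<partial>lborel) \<partial>lborel)"
      by (simp only: distrib_left distrib_right)
    also have "ennreal (1/2) + ennreal (1/2) = 1" by (subst ennreal_plus[symmetric]) auto
    finally show ?thesis using int by simp
  qed
  then show thesis using that C(1) by blast
qed

subsection \<open>The four kernels\<close>

text \<open>Multiplication on [0, infinity] is discontinuous only where 0 meets infinity. The
  weights never vanish, so their products avoid that case.\<close>

lemma continuous_on_mult_ennreal:
  fixes f g :: "'a::topological_space \<Rightarrow> ennreal"
  assumes "continuous_on S f" "continuous_on S g" "\<And>x. x \<in> S \<Longrightarrow> f x \<noteq> 0" "\<And>x. x \<in> S \<Longrightarrow> g x \<noteq> 0"
  shows "continuous_on S (\<lambda>x. f x * g x)"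
  using assms unfolding continuous_on_def by (intro ballI tendsto_mult_ennreal) auto

lemma neg_pow_prod:
  assumes "\<And>i. i \<in> I \<Longrightarrow> 0 \<le> f i"
  shows "neg_pow (\<Prod>i\<in>I. f i) s = (\<Prod>i\<in>I. neg_pow (f i) s)"
  using assms
  by (induction I rule: infinite_finite_induct) (auto simp: neg_pow_mult prod_nonneg neg_pow_pos)

section \<open>Lebesgue measure on vectors of vectors as a product measure\<close>

lemma measurable_vec_lambda_lborel [measurable]:
  "(\<lambda>x. \<chi> i. x i) \<in> borel_measurable (PiM UNIV (\<lambda>_::'n::finite. lborel :: 'a::euclidean_space measure))"
    (is "_ \<in> borel_measurable ?P")
proof (rule borel_measurable_euclidean_space[THEN iffD2], rule ballI)
  fix b :: "'a ^ 'n" assume "b \<in> Basis"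
  then obtain i u where b: "b = axis i u" by (auto simp: Basis_vec_def)
  have "(\<lambda>x. x i) \<in> borel_measurable ?P"
    using measurable_component_singleton[of i UNIV "\<lambda>_. lborel :: 'a measure"] by simp
  then show "(\<lambda>x. (\<chi> i. x i) \<bullet> b) \<in> borel_measurable ?P"
    by (simp add: b inner_axis)
qed

text \<open>Both measures agree on boxes, because the basis of the big space consists of the basis
  vectors placed in each component. In product form single variables can be split off from the
  integral.\<close>

lemma nn_integral_lborel_vec:
  fixes f :: "'a::euclidean_space ^ 'n \<Rightarrow> ennreal"
  assumes [measurable]: "f \<in> borel_measurable borel"
  shows "(\<integral>\<^sup>+X. f X \<partial>lborel) = (\<integral>\<^sup>+x. f (\<chi> i. x i) \<partial>PiM UNIV (\<lambda>_. lborel))"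
proof -
  interpret P: product_sigma_finite "\<lambda>_::'n. lborel :: 'a measure" by (rule product_sigma_finite_lborel)
  let ?P = "PiM UNIV (\<lambda>_::'n. lborel :: 'a measure)"
  have "lborel = distr ?P borel (\<lambda>x. \<chi> i. x i)"
  proof (rule lborel_eqI)
    fix l u :: "'a ^ 'n" assume lu: "\<And>b. b \<in> Basis \<Longrightarrow> l \<bullet> b \<le> u \<bullet> b"
    have lui: "l $ i \<bullet> b \<le> u $ i \<bullet> b" if "b \<in> Basis" for i b
      using lu[of "axis i b"] that by (auto simp: inner_axis Basis_vec_def)
    have "emeasure (distr ?P borel (\<lambda>x. \<chi> i. x i)) (box l u) = emeasure ?P (PiE UNIV (\<lambda>i. box (l $ i) (u $ i)))"
    proof (subst emeasure_distr)
      have "(\<lambda>x. \<chi> i. x i) -` box l u \<inter> space ?P = PiE UNIV (\<lambda>i. box (l $ i) (u $ i))"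
        by (auto simp: space_PiM mem_box Basis_vec_def inner_axis PiE_def Pi_iff)
      then show "emeasure ?P ((\<lambda>x. \<chi> i. x i) -` box l u \<inter> space ?P) = emeasure ?P (PiE UNIV (\<lambda>i. box (l $ i) (u $ i)))"
        by (simp only:)
    qed auto
    also have "\<dots> = (\<Prod>i\<in>UNIV. emeasure lborel (box (l $ i) (u $ i)))"
      by (rule P.emeasure_PiM) auto
    also have "\<dots> = (\<Prod>i\<in>UNIV. ennreal (\<Prod>b\<in>Basis. (u $ i - l $ i) \<bullet> b))"
      using lui by (intro prod.cong refl emeasure_lborel_box) auto
    also have "\<dots> = ennreal (\<Prod>i\<in>UNIV. \<Prod>b\<in>Basis. (u $ i - l $ i) \<bullet> b)"
      using lui by (intro prod_ennreal prod_nonneg) (auto simp: inner_diff_left)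
    also have "(\<Prod>i\<in>UNIV. \<Prod>b\<in>Basis. (u $ i - l $ i) \<bullet> b) = (\<Prod>b\<in>Basis. (u - l) \<bullet> b)"
    proof -
      have inj: "inj_on (\<lambda>(i, b). axis i b) ((UNIV :: 'n set) \<times> (Basis :: 'a set))"
        by (auto simp: inj_on_def axis_eq_axis)
      have "(Basis :: ('a ^ 'n) set) = (\<lambda>(i, b). axis i b) ` (UNIV \<times> Basis)"
        by (auto simp: Basis_vec_def)
      then have "(\<Prod>b\<in>Basis. (u - l) \<bullet> b) = (\<Prod>b\<in>(\<lambda>(i, b). axis i b) ` (UNIV \<times> Basis). (u - l) \<bullet> b)"
        by (rule arg_cong)
      also have "\<dots> = (\<Prod>(i, b)\<in>UNIV \<times> Basis. (u - l) \<bullet> axis i b)"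
        by (subst prod.reindex[OF inj]) (simp add: case_prod_unfold comp_def)
      finally show ?thesis by (simp add: prod.cartesian_product inner_axis)
    qed
    finally show "emeasure (distr ?P borel (\<lambda>x. \<chi> i. x i)) (box l u) = (\<Prod>b\<in>Basis. (u - l) \<bullet> b)" .
  qed simp
  then have "(\<integral>\<^sup>+X. f X \<partial>lborel) = (\<integral>\<^sup>+X. f X \<partial>distr ?P borel (\<lambda>x. \<chi> i. x i))" by simp
  also have "\<dots> = (\<integral>\<^sup>+x. f (\<chi> i. x i) \<partial>?P)" by (rule nn_integral_distr) auto
  finally show ?thesis .
qed

section \<open>Domination of each kernel by a Stein--Weiss kernel\<close>

definition kernel_weight :: "real \<Rightarrow> 'a::euclidean_space \<Rightarrow> 'a \<Rightarrow> 'a \<Rightarrow> ennreal" where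
  "kernel_weight \<kappa> w v s = neg_pow (norm (w - s) * norm (v - s)) \<kappa>"

lemma measurable_kernel_weight [measurable]: "kernel_weight \<kappa> w v \<in> borel_measurable borel"
  unfolding kernel_weight_def by measurable

lemma stein_weiss_kernel_eq:
  "(\<integral>\<^sup>+s. neg_pow (norm s) e * kernel_weight \<kappa> w v s \<partial>lborel) = stein_weiss_kernel \<kappa> e w v"
  unfolding kernel_weight_def stein_weiss_kernel_def by (simp add: neg_pow_mult)

lemma kernel_K_alpha_le:
  fixes \<alpha> :: real and l :: "'n::finite"
  assumes n: "CARD('n) \<ge> 3" and \<alpha>: "\<alpha> \<le> real CARD('n) - 1" "real CARD('n) - 1 - 2 / real CARD('n) < \<alpha>"
  shows "\<exists>C>0. \<forall>w v. kernel_K_alpha \<alpha> l w v \<le> ennreal C *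
    stein_weiss_kernel (real CARD('n) * (real CARD('n) - \<alpha> + 1) / 2 - 1)
      (2 - real CARD('n) * (real CARD('n) - 1 - \<alpha>)) w v"
proof -
  let ?n = "real CARD('n)"
  define \<kappa> where "\<kappa> = ?n * (?n - \<alpha> + 1) / 2 - 1"
  define A :: "real^'n^'n \<Rightarrow> real^'n^'n" where "A X = (\<chi> k. if k = l then - X $ k else X $ k)" for X
  interpret quadric A
  proof (rule quadric.intro)
    show "linear A" unfolding A_def by (rule linearI) (auto simp: vec_eq_iff)
    show "X \<bullet> A Y = A X \<bullet> Y" for X Y by (auto simp: A_def inner_vec_def intro!: sum.cong)
    have "A X \<bullet> A X = X \<bullet> X" for X by (auto simp: A_def inner_vec_def intro!: sum.cong)
    then show "norm (A X) = norm X" for X by (simp add: norm_eq_sqrt_inner)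
    show "A b = b \<or> A b = - b" if b: "b \<in> Basis" for b
    proof -
      obtain i u where "b = axis i u" using b unfolding Basis_vec_def by blast
      then show ?thesis by (cases "i = l") (auto simp: A_def vec_eq_iff axis_def)
    qed
    have "2 * 1 \<le> CARD('n) * CARD('n)" using n by (intro mult_le_mono) auto
    then show "2 \<le> DIM(real^'n^'n)" by simp
  qed
  have F: "F = (\<lambda>X. 1 + (\<Sum>k\<in>UNIV - {l}. (norm (X $ k))\<^sup>2) - (norm (X $ l))\<^sup>2)"
  proof
    fix X :: "real^'n^'n"
    have "X \<bullet> A X = (\<Sum>k\<in>UNIV. X $ k \<bullet> A X $ k)" by (simp add: inner_vec_def)
    also have "\<dots> = X $ l \<bullet> A X $ l + (\<Sum>k\<in>UNIV - {l}. X $ k \<bullet> A X $ k)"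
      by (rule sum.remove) auto
    also have "(\<Sum>k\<in>UNIV - {l}. X $ k \<bullet> A X $ k) = (\<Sum>k\<in>UNIV - {l}. (norm (X $ k))\<^sup>2)"
      by (intro sum.cong) (auto simp: A_def power2_norm_eq_inner)
    also have "X $ l \<bullet> A X $ l = - (norm (X $ l))\<^sup>2" by (simp add: A_def power2_norm_eq_inner)
    finally show "F X = 1 + (\<Sum>k\<in>UNIV - {l}. (norm (X $ k))\<^sup>2) - (norm (X $ l))\<^sup>2" by (simp add: F_def)
  qed
  \<comment> \<open>The variable l plays the part of y and j that of z; the others are indexed by I,
    which is nonempty since n \<ge> 3.\<close>
  obtain j where j: "j \<noteq> l"
  proof -
    have "card (UNIV - {l}) \<noteq> 0" using n by (simp add: card_Diff_singleton)
    then have "UNIV - {l} \<noteq> {}" by (metis card.empty)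
    then show thesis using that by auto
  qed
  define I where "I = UNIV - {l, j}"
  have card: "card I = CARD('n) - 2" using j by (simp add: I_def card_Diff_subset)
  have I: "finite I" "I \<noteq> {}" using card n by auto
  have rcard: "real (card I) = ?n - 2" using card n by simp
  have n3: "?n \<ge> 3" using n by simp
  have "2 / ?n \<le> 2 / 3" using n3 by (intro divide_left_mono) auto
  then have \<alpha>1: "1 \<le> \<alpha>" using \<alpha> n3 by linarith
  have n\<alpha>: "?n * (?n - 1 - \<alpha>) < 2"
  proof -
    have "?n - 1 - \<alpha> < 2 / ?n" using \<alpha> by linarith
    then show ?thesis using n3 by (simp add: pos_less_divide_eq mult.commute)
  qed
  \<comment> \<open>With n - 2 remaining variables this condition is n (n - 1 - \<alpha>) < 2, the
    lower bound on \<alpha>.\<close>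
  have "real (card I) * (real DIM(real^'n) - \<alpha>) + (real DIM(real^'n) - 1) - 2 * \<alpha> < 1"
    using n\<alpha> by (simp add: rcard algebra_simps)
  then have "\<exists>C>0. \<forall>\<epsilon>>0. \<forall>h\<in>borel_measurable borel. thick_integral I (\<lambda>_. \<alpha>) \<alpha> \<alpha> \<epsilon> h \<le> ennreal (\<epsilon> * C) *
      (\<integral>\<^sup>+(s::real^'n). neg_pow (norm s) (2 + 2 * \<alpha> - real DIM(real^'n) - real (card I) * (real DIM(real^'n) - \<alpha>)) * h s \<partial>lborel)"
    using \<alpha> \<alpha>1 n by (intro thick_integral_equal_exponents[OF I]) auto
  moreover have "2 + 2 * \<alpha> - real DIM(real^'n) - real (card I) * (real DIM(real^'n) - \<alpha>) = 2 - ?n * (?n - 1 - \<alpha>)"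
    by (simp add: rcard algebra_simps)
  ultimately have "\<exists>C>0. \<forall>\<epsilon>>0. \<forall>h\<in>borel_measurable borel. thick_integral I (\<lambda>_. \<alpha>) \<alpha> \<alpha> \<epsilon> h \<le> ennreal (\<epsilon> * C) *
      (\<integral>\<^sup>+(s::real^'n). neg_pow (norm s) (2 - ?n * (?n - 1 - \<alpha>)) * h s \<partial>lborel)"
    by (simp only:)
  then obtain C where C: "C > 0" "\<And>\<epsilon> h. \<epsilon> > 0 \<Longrightarrow> h \<in> borel_measurable borel \<Longrightarrow>
      thick_integral I (\<lambda>_. \<alpha>) \<alpha> \<alpha> \<epsilon> h \<le> ennreal (\<epsilon> * C) * (\<integral>\<^sup>+(s::real^'n). neg_pow (norm s) (2 - ?n * (?n - 1 - \<alpha>)) * h s \<partial>lborel)"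
    by blast
  have \<kappa>0: "\<kappa> > 0"
  proof -
    have "3 * 2 \<le> ?n * (?n - \<alpha> + 1)" using n3 \<alpha> by (intro mult_mono) auto
    then show ?thesis by (simp add: \<kappa>_def)
  qed
  interpret P: product_sigma_finite "\<lambda>_::'n. lborel :: (real^'n) measure" by (rule product_sigma_finite_lborel)
  show ?thesis
  \<comment> \<open>The summand 1 makes the constant positive from \<open>sheet_const_nonneg\<close>
    alone.\<close>
  proof (intro exI[of _ "3 * DIM(real^'n^'n) * sheet_const * C + 1"] conjI allI)
    show "0 < 3 * DIM(real^'n^'n) * sheet_const * C + 1" using C(1) sheet_const_nonneg by (simp add: add_nonneg_pos)
    fix w v :: "real^'n"
    let ?SW = "stein_weiss_kernel \<kappa> (2 - ?n * (?n - 1 - \<alpha>)) w v"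
    define G where "G X = (\<Prod>k\<in>UNIV. neg_pow (norm (X $ k)) \<alpha>) * kernel_weight \<kappa> w v (\<Sum>k\<in>UNIV. X $ k)" for X :: "real^'n^'n"
    have G: "continuous_on UNIV G"
    proof -
      \<comment> \<open>The product of the weights is written as one weight of the product of the
        norms, a continuous real function, so the case of 0 times infinity does not arise.\<close>
      have "continuous_on UNIV (\<lambda>X :: real^'n^'n. neg_pow (\<Prod>k\<in>UNIV. norm (X $ k)) \<alpha>)"
        using \<alpha>1 by (intro continuous_intros) (auto intro!: prod_nonneg)
      then show ?thesis
        unfolding G_def kernel_weight_def using \<kappa>0
        by (intro continuous_on_mult_ennreal continuous_intros) (auto simp: neg_pow_prod simp flip: neg_pow_prod)
    qed
    have [measurable]: "G \<in> borel_measurable borel" using G by (rule borel_measurable_continuous_onI)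
    have "delta_integral F G \<le> ennreal (3 * DIM(real^'n^'n) * sheet_const) * (ennreal C * ?SW)"
    proof (rule delta_integral_le[OF G])
      fix \<epsilon> :: real assume \<epsilon>: "\<epsilon> > 0"
      let ?g = "\<lambda>X. G X * indicator (thick \<epsilon>) X"
      have UNIV: "UNIV = insert l (insert j I)" by (auto simp: I_def)
      have "(\<integral>\<^sup>+X. ?g X \<partial>lborel) = (\<integral>\<^sup>+x. ?g (\<chi> i. x i) \<partial>PiM UNIV (\<lambda>_. lborel))"
        by (rule nn_integral_lborel_vec) measurable
      also have "\<dots> = (\<integral>\<^sup>+x. ?g (\<chi> i. x i) \<partial>PiM (insert l (insert j I)) (\<lambda>_. lborel))"
        by (simp only: UNIV[symmetric])
      also have "\<dots> = (\<integral>\<^sup>+x. (\<integral>\<^sup>+y. ?g (\<chi> i. (x(l := y)) i) \<partial>lborel) \<partial>PiM (insert j I) (\<lambda>_. lborel))"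
      proof (rule P.product_nn_integral_insert)
        show "(\<lambda>x. ?g (\<chi> i. x i)) \<in> borel_measurable (PiM (insert l (insert j I)) (\<lambda>_. lborel))"
          unfolding UNIV[symmetric] by measurable
      qed (use j in \<open>auto simp: I_def\<close>)
      also have "\<dots> = (\<integral>\<^sup>+x. (\<integral>\<^sup>+z. (\<integral>\<^sup>+y. ?g (\<chi> i. (x(j := z, l := y)) i) \<partial>lborel) \<partial>lborel) \<partial>PiM I (\<lambda>_. lborel))"
      proof (rule P.product_nn_integral_insert)
        have "(\<lambda>(x, y). x(l := y)) \<in> PiM (insert j I) (\<lambda>_. lborel :: (real^'n) measure) \<Otimes>\<^sub>M lborel \<rightarrow>\<^sub>M PiM UNIV (\<lambda>_. lborel)"
          unfolding UNIV by (rule measurable_add_dim)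
        then have [measurable]: "(\<lambda>p. (fst p)(l := snd p)) \<in> PiM (insert j I) (\<lambda>_. lborel :: (real^'n) measure) \<Otimes>\<^sub>M lborel \<rightarrow>\<^sub>M PiM UNIV (\<lambda>_. lborel)"
          by (simp add: case_prod_unfold)
        have "(\<lambda>p. ?g (\<chi> i. ((fst p)(l := snd p)) i)) \<in> borel_measurable (PiM (insert j I) (\<lambda>_. lborel) \<Otimes>\<^sub>M lborel)"
          by measurable
        then show "(\<lambda>x. \<integral>\<^sup>+y. ?g (\<chi> i. (x(l := y)) i) \<partial>lborel) \<in> borel_measurable (PiM (insert j I) (\<lambda>_. lborel))"
          by (intro lborel.borel_measurable_nn_integral) (simp add: case_prod_unfold)
      qed (auto simp: I_def)
      also have "\<dots> = thick_integral I (\<lambda>_. \<alpha>) \<alpha> \<alpha> \<epsilon> (kernel_weight \<kappa> w v)"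
        unfolding thick_integral_def
      proof (intro nn_integral_cong)
        fix x :: "'n \<Rightarrow> real^'n" and z y :: "real^'n"
        let ?x = "x(j := z, l := y)"
        have Ix: "?x i = x i" if "i \<in> I" for i using that by (auto simp: I_def)
        have fin: "finite I" "l \<notin> insert j I" "j \<notin> I" using j by (auto simp: I_def)
        have s: "(\<Sum>k\<in>UNIV. ?x k) = (\<Sum>i\<in>I. x i) + z + y"
          unfolding UNIV using fin j Ix by (simp add: add.commute add.left_commute cong: sum.cong)
        have p: "(\<Prod>k\<in>UNIV. neg_pow (norm (?x k)) \<alpha>) = (\<Prod>i\<in>I. neg_pow (norm (x i)) \<alpha>) * (neg_pow (norm z) \<alpha> * neg_pow (norm y) \<alpha>)"
          unfolding UNIV using fin j Ix by (simp add: mult_ac cong: prod.cong)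
        have "UNIV - {l} = insert j I" using j by (auto simp: I_def)
        then have q: "(\<Sum>k\<in>UNIV - {l}. (norm (?x k))\<^sup>2) = (\<Sum>i\<in>I. (norm (x i))\<^sup>2) + (norm z)\<^sup>2"
          using fin j Ix by (simp add: add.commute cong: sum.cong)
        have "F (\<chi> i. ?x i) = 1 + (\<Sum>k\<in>UNIV - {l}. (norm (?x k))\<^sup>2) - (norm (?x l))\<^sup>2"
          unfolding F by (simp only: vec_lambda_beta)
        then have F': "F (\<chi> i. ?x i) = 1 + (\<Sum>i\<in>I. (norm (x i))\<^sup>2) + (norm z)\<^sup>2 - (norm y)\<^sup>2"
          unfolding q by simp
        have ind: "indicator (thick \<epsilon>) (\<chi> i. ?x i) = (indicator {-\<epsilon><..<0} (1 + (\<Sum>i\<in>I. (norm (x i))\<^sup>2) + (norm z)\<^sup>2 - (norm y)\<^sup>2) :: ennreal)"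
          unfolding thick_def indicator_def mem_Collect_eq F' by simp
        have "G (\<chi> i. ?x i) = (\<Prod>i\<in>I. neg_pow (norm (x i)) \<alpha>) * (neg_pow (norm z) \<alpha> * neg_pow (norm y) \<alpha>) * kernel_weight \<kappa> w v ((\<Sum>i\<in>I. x i) + z + y)"
          unfolding G_def vec_lambda_beta s p ..
        then show "?g (\<chi> i. ?x i) = indicator {-\<epsilon><..<0} (1 + (\<Sum>i\<in>I. (norm (x i))\<^sup>2) + (norm z)\<^sup>2 - (norm y)\<^sup>2) *
          ((\<Prod>i\<in>I. neg_pow (norm (x i)) \<alpha>) * (neg_pow (norm z) \<alpha> * neg_pow (norm y) \<alpha>) * kernel_weight \<kappa> w v ((\<Sum>i\<in>I. x i) + z + y))"
          unfolding ind by (simp only: mult.commute)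
      qed
      also have "\<dots> \<le> ennreal (\<epsilon> * C) * (\<integral>\<^sup>+s. neg_pow (norm s) (2 - ?n * (?n - 1 - \<alpha>)) * kernel_weight \<kappa> w v s \<partial>lborel)"
        by (rule C(2)[OF \<epsilon>]) measurable
      also have "\<dots> = ennreal \<epsilon> * (ennreal C * ?SW)"
        using \<epsilon> C(1) unfolding stein_weiss_kernel_eq by (simp add: ennreal_mult mult.assoc)
      finally show "(\<integral>\<^sup>+X\<in>thick \<epsilon>. G X \<partial>lborel) \<le> ennreal \<epsilon> * (ennreal C * ?SW)" .
    qed
    also have "\<dots> = ennreal (3 * DIM(real^'n^'n) * sheet_const * C) * ?SW"
      using C(1) sheet_const_nonneg by (subst ennreal_mult) (auto simp: mult.assoc)
    also have "\<dots> \<le> ennreal (3 * DIM(real^'n^'n) * sheet_const * C + 1) * ?SW"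
      by (intro mult_right_mono ennreal_leI) auto
    finally have "delta_integral F G \<le> ennreal (3 * DIM(real^'n^'n) * sheet_const * C + 1) * ?SW" .
    then show "kernel_K_alpha \<alpha> l w v \<le> ennreal (3 * DIM(real^'n^'n) * sheet_const * C + 1) * stein_weiss_kernel (?n * (?n - \<alpha> + 1) / 2 - 1) (2 - ?n * (?n - 1 - \<alpha>)) w v"
      unfolding kernel_K_alpha_def F[symmetric] G_def[abs_def] kernel_weight_def \<kappa>_def .
  qed
qed

lemma kernel_K_le:
  fixes l :: "'n::finite"
  assumes n: "CARD('n) \<ge> 3"
  shows "\<exists>C>0. \<forall>w v. kernel_K l w v \<le> ennreal C * stein_weiss_kernel (real CARD('n) - 1) 2 w v"
proof -
  have "kernel_K l = kernel_K_alpha (real CARD('n) - 1) l"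
    by (intro ext) (simp add: kernel_K_def kernel_K_alpha_def)
  then show ?thesis using kernel_K_alpha_le[OF n, of "real CARD('n) - 1" l] n by simp
qed

text \<open>There are no variables besides y and z, so the index set is empty. As \<alpha> < n - 1
  strictly, the slab integral converges without moving weight, and \<alpha> > (n - 1)/2 is its
  convergence at infinity.\<close>

lemma kernel_H_le:
  fixes \<alpha> :: real
  assumes n: "CARD('n::finite) \<ge> 2" and \<alpha>: "(real CARD('n) - 1) / 2 < \<alpha>" "\<alpha> < real CARD('n) - 1"
  shows "\<exists>C>0. \<forall>w v :: real^'n. kernel_H \<alpha> w v \<le> ennreal C *
    stein_weiss_kernel (3 * real CARD('n) / 2 - 1 - \<alpha>) (2 * \<alpha> - real CARD('n) + 2) w v"
proof -
  let ?n = "real CARD('n)" and ?\<kappa> = "3 * real CARD('n) / 2 - 1 - \<alpha>"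
  define A :: "(real^'n) \<times> (real^'n) \<Rightarrow> (real^'n) \<times> (real^'n)" where "A X = (fst X, - snd X)" for X
  interpret quadric A
  proof (rule quadric.intro)
    show "linear A" unfolding A_def by (rule linearI) auto
    show "X \<bullet> A Y = A X \<bullet> Y" "norm (A X) = norm X" for X Y by (auto simp: A_def inner_prod_def norm_prod_def)
    show "A b = b \<or> A b = - b" if "b \<in> Basis" for b using that by (auto simp: A_def Basis_prod_def zero_prod_def)
    show "2 \<le> DIM((real^'n) \<times> (real^'n))" using n by simp
  qed
  have F: "F = (\<lambda>(x, y). 1 + (norm x)\<^sup>2 - (norm y)\<^sup>2)"
    by (auto simp: F_def A_def fun_eq_iff inner_prod_def power2_norm_eq_inner)
  have n2: "?n \<ge> 2" using n by simp
  have "\<exists>C>0. \<forall>\<epsilon>>0. \<forall>h\<in>borel_measurable borel.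
      thick_integral ({} :: unit set) (\<lambda>_. 0) \<alpha> \<alpha> \<epsilon> h \<le> ennreal (\<epsilon> * C) * (\<integral>\<^sup>+(s::real^'n). neg_pow (norm s) (1 - sum (\<lambda>_. 0) ({} :: unit set) + (2 * \<alpha> - (?n - 1))) * h s \<partial>lborel)"
    by (rule thick_integral_bound[where \<gamma>="\<lambda>_. 0"]) (use \<alpha> n2 n in auto)
  moreover have "1 - sum (\<lambda>_. 0) ({} :: unit set) + (2 * \<alpha> - (?n - 1)) = 2 * \<alpha> - ?n + 2" by simp
  ultimately have "\<exists>C>0. \<forall>\<epsilon>>0. \<forall>h\<in>borel_measurable borel.
      thick_integral ({} :: unit set) (\<lambda>_. 0) \<alpha> \<alpha> \<epsilon> h \<le> ennreal (\<epsilon> * C) * (\<integral>\<^sup>+(s::real^'n). neg_pow (norm s) (2 * \<alpha> - ?n + 2) * h s \<partial>lborel)"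
    by (simp only:)
  then obtain C where C: "C > 0" "\<And>\<epsilon> h. \<epsilon> > 0 \<Longrightarrow> h \<in> borel_measurable borel \<Longrightarrow>
      thick_integral ({} :: unit set) (\<lambda>_. 0) \<alpha> \<alpha> \<epsilon> h \<le> ennreal (\<epsilon> * C) * (\<integral>\<^sup>+(s::real^'n). neg_pow (norm s) (2 * \<alpha> - ?n + 2) * h s \<partial>lborel)"
    by blast
  have \<kappa>0: "?\<kappa> > 0" using \<alpha> n2 by simp
  show ?thesis
  proof (intro exI[of _ "3 * DIM((real^'n) \<times> (real^'n)) * sheet_const * C + 1"] conjI allI)
    show "0 < 3 * DIM((real^'n) \<times> (real^'n)) * sheet_const * C + 1" using C(1) sheet_const_nonneg by (intro add_nonneg_pos mult_nonneg_nonneg) auto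
    fix w v :: "real^'n"
    let ?SW = "stein_weiss_kernel ?\<kappa> (2 * \<alpha> - ?n + 2) w v"
    define G where "G X = neg_pow (norm (fst X)) \<alpha> * neg_pow (norm (snd X)) \<alpha> * kernel_weight ?\<kappa> w v (fst X + snd X)" for X :: "(real^'n) \<times> (real^'n)"
    have G: "continuous_on UNIV G"
    proof -
      have "\<alpha> > 0" using \<alpha> n2 by simp
      then show ?thesis
        unfolding G_def kernel_weight_def using \<kappa>0
        by (intro continuous_on_mult_ennreal continuous_on_neg_pow continuous_intros) simp_all
    qed
    have [measurable]: "G \<in> borel_measurable borel" using G by (rule borel_measurable_continuous_onI)
    have "delta_integral F G \<le> ennreal (3 * DIM((real^'n) \<times> (real^'n)) * sheet_const) * (ennreal C * ?SW)"
    proof (rule delta_integral_le[OF G])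
      fix \<epsilon> :: real assume \<epsilon>: "\<epsilon> > 0"
      let ?g = "\<lambda>X. G X * indicator (thick \<epsilon>) X"
      have "(\<integral>\<^sup>+X. ?g X \<partial>lborel) = (\<integral>\<^sup>+X. ?g X \<partial>(lborel \<Otimes>\<^sub>M lborel))" by (simp only: lborel_prod)
      also have "\<dots> = (\<integral>\<^sup>+z. (\<integral>\<^sup>+y. ?g (z, y) \<partial>lborel) \<partial>lborel)"
        by (rule lborel.nn_integral_fst[symmetric]) (unfold lborel_prod, measurable)
      also have "\<dots> = thick_integral ({} :: unit set) (\<lambda>_. 0) \<alpha> \<alpha> \<epsilon> (kernel_weight ?\<kappa> w v)"
        by (simp add: thick_integral_def PiM_empty)
          (intro nn_integral_cong, simp add: G_def thick_def F indicator_def)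
      also have "\<dots> \<le> ennreal (\<epsilon> * C) * (\<integral>\<^sup>+s. neg_pow (norm s) (2 * \<alpha> - ?n + 2) * kernel_weight ?\<kappa> w v s \<partial>lborel)"
        by (rule C(2)[OF \<epsilon>]) measurable
      also have "\<dots> = ennreal \<epsilon> * (ennreal C * ?SW)"
        using \<epsilon> C(1) unfolding stein_weiss_kernel_eq by (simp add: ennreal_mult mult.assoc)
      finally show "(\<integral>\<^sup>+X\<in>thick \<epsilon>. G X \<partial>lborel) \<le> ennreal \<epsilon> * (ennreal C * ?SW)" .
    qed
    also have "\<dots> = ennreal (3 * DIM((real^'n) \<times> (real^'n)) * sheet_const * C) * ?SW"
      using C(1) sheet_const_nonneg by (subst ennreal_mult) (auto simp: mult.assoc)
    also have "\<dots> \<le> ennreal (3 * DIM((real^'n) \<times> (real^'n)) * sheet_const * C + 1) * ?SW"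
      by (intro mult_right_mono ennreal_leI) auto
    finally have "delta_integral F G \<le> ennreal (3 * DIM((real^'n) \<times> (real^'n)) * sheet_const * C + 1) * ?SW" .
    moreover have "kernel_H \<alpha> w v = delta_integral F G"
      unfolding kernel_H_def F G_def[abs_def] kernel_weight_def by (simp add: case_prod_unfold diff_diff_eq)
    ultimately show "kernel_H \<alpha> w v \<le> ennreal (3 * DIM((real^'n) \<times> (real^'n)) * sheet_const * C + 1) * ?SW" by simp
  qed
qed

text \<open>One variable is left besides y and z, and all exponents equal n - 1, so weight must be
  moved between x and z. The condition of \<open>thick_integral_equal_exponents\<close> reduces to n
  > 1.\<close>

lemma kernel_J_le:
  assumes n: "CARD('n::finite) \<ge> 2"
  shows "\<exists>C>0. \<forall>w v :: real^'n. kernel_J w v \<le> ennreal C *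
    stein_weiss_kernel ((real CARD('n) + 1) / 2) (real CARD('n) - 1) w v"
proof -
  let ?n = "real CARD('n)" and ?\<kappa> = "(real CARD('n) + 1) / 2"
  let ?D = "DIM((real^'n) \<times> (real^'n) \<times> (real^'n))"
  define A :: "(real^'n) \<times> (real^'n) \<times> (real^'n) \<Rightarrow> (real^'n) \<times> (real^'n) \<times> (real^'n)"
    where "A X = (fst X, - fst (snd X), snd (snd X))" for X
  interpret quadric A
  proof (rule quadric.intro)
    show "linear A" unfolding A_def by (rule linearI) auto
    show "X \<bullet> A Y = A X \<bullet> Y" "norm (A X) = norm X" for X Y by (auto simp: A_def inner_prod_def norm_prod_def)
    show "A b = b \<or> A b = - b" if "b \<in> Basis" for b using that by (auto simp: A_def Basis_prod_def zero_prod_def)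
    show "2 \<le> ?D" using n by simp
  qed
  have F: "F = (\<lambda>(x, y, z). 1 + (norm x)\<^sup>2 + (norm z)\<^sup>2 - (norm y)\<^sup>2)"
    by (auto simp: F_def A_def fun_eq_iff inner_prod_def power2_norm_eq_inner)
  have n2: "?n \<ge> 2" using n by simp
  have "\<exists>C>0. \<forall>\<epsilon>>0. \<forall>h\<in>borel_measurable borel.
      thick_integral {()} (\<lambda>_. ?n - 1) (?n - 1) (?n - 1) \<epsilon> h \<le> ennreal (\<epsilon> * C) * (\<integral>\<^sup>+(s::real^'n). neg_pow (norm s) (?n - 1) * h s \<partial>lborel)"
    using thick_integral_equal_exponents[of "{()}" "?n - 1", where 'a="real^'n"] n2 n by simp
  then obtain C where C: "C > 0" "\<And>\<epsilon> h. \<epsilon> > 0 \<Longrightarrow> h \<in> borel_measurable borel \<Longrightarrow>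
      thick_integral {()} (\<lambda>_. ?n - 1) (?n - 1) (?n - 1) \<epsilon> h \<le> ennreal (\<epsilon> * C) * (\<integral>\<^sup>+(s::real^'n). neg_pow (norm s) (?n - 1) * h s \<partial>lborel)"
    by blast
  have \<kappa>0: "?\<kappa> > 0" using n2 by simp
  interpret P: product_sigma_finite "\<lambda>_::unit. lborel :: (real^'n) measure" by (rule product_sigma_finite_lborel)
  show ?thesis
  proof (intro exI[of _ "3 * ?D * sheet_const * C + 1"] conjI allI)
    show "0 < 3 * ?D * sheet_const * C + 1" using C(1) sheet_const_nonneg by (intro add_nonneg_pos mult_nonneg_nonneg) auto
    fix w v :: "real^'n"
    let ?SW = "stein_weiss_kernel ?\<kappa> (?n - 1) w v"
    define G where "G = (\<lambda>(x, y, z). neg_pow (norm x * norm y * norm z) (?n - 1) * kernel_weight ?\<kappa> w v (x + y + z))"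
    have G: "continuous_on UNIV G"
      unfolding G_def kernel_weight_def case_prod_unfold using \<kappa>0 n2
      by (intro continuous_on_mult_ennreal continuous_intros) auto
    have [measurable]: "G \<in> borel_measurable borel" using G by (rule borel_measurable_continuous_onI)
    have "delta_integral F G \<le> ennreal (3 * ?D * sheet_const) * (ennreal C * ?SW)"
    proof (rule delta_integral_le[OF G])
      fix \<epsilon> :: real assume \<epsilon>: "\<epsilon> > 0"
      define k where "k = (\<lambda>x z y. indicator {-\<epsilon><..<0} (1 + (norm x)\<^sup>2 + (norm z)\<^sup>2 - (norm y)\<^sup>2) *
        (neg_pow (norm x) (?n - 1) * (neg_pow (norm z) (?n - 1) * neg_pow (norm y) (?n - 1)) * kernel_weight ?\<kappa> w v (x + z + y)))"
      let ?g = "\<lambda>X. G X * indicator (thick \<epsilon>) X"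
      have gk: "?g (x, y, z) = k x z y" for x y z
        by (simp add: G_def k_def thick_def F indicator_def neg_pow_mult mult_ac add_ac)
      have [measurable]: "(\<lambda>(x, y). \<integral>\<^sup>+z. k x z y \<partial>lborel) \<in> borel_measurable (lborel \<Otimes>\<^sub>M lborel)"
        "(\<lambda>x. \<integral>\<^sup>+z. \<integral>\<^sup>+y. k x z y \<partial>lborel \<partial>lborel) \<in> borel_measurable lborel"
        unfolding k_def by measurable
      have "(\<integral>\<^sup>+X. ?g X \<partial>lborel) = (\<integral>\<^sup>+X. ?g X \<partial>(lborel \<Otimes>\<^sub>M lborel))" by (simp only: lborel_prod)
      also have "\<dots> = (\<integral>\<^sup>+x. (\<integral>\<^sup>+p. ?g (x, p) \<partial>lborel) \<partial>lborel)"
        by (rule lborel.nn_integral_fst[symmetric]) (unfold lborel_prod, measurable)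
      also have "\<dots> = (\<integral>\<^sup>+x. (\<integral>\<^sup>+p. ?g (x, p) \<partial>(lborel \<Otimes>\<^sub>M lborel)) \<partial>lborel)" by (simp only: lborel_prod)
      also have "\<dots> = (\<integral>\<^sup>+x. (\<integral>\<^sup>+y. (\<integral>\<^sup>+z. ?g (x, y, z) \<partial>lborel) \<partial>lborel) \<partial>lborel)"
        by (intro nn_integral_cong lborel.nn_integral_fst[symmetric]) (unfold lborel_prod, measurable)
      also have "\<dots> = (\<integral>\<^sup>+x. (\<integral>\<^sup>+y. (\<integral>\<^sup>+z. k x z y \<partial>lborel) \<partial>lborel) \<partial>lborel)" by (simp only: gk)
      \<comment> \<open>In the triple, the variable with the minus sign comes second;
        \<open>thick_integral\<close> has it innermost.\<close>
      also have "\<dots> = (\<integral>\<^sup>+x. (\<integral>\<^sup>+z. (\<integral>\<^sup>+y. k x z y \<partial>lborel) \<partial>lborel) \<partial>lborel)"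
        by (intro nn_integral_cong lborel_pair.Fubini') (unfold k_def, measurable)
      also have "\<dots> = (\<integral>\<^sup>+x. (\<integral>\<^sup>+z. (\<integral>\<^sup>+y. k (x ()) z y \<partial>lborel) \<partial>lborel) \<partial>PiM {()} (\<lambda>_. lborel))"
        by (rule P.product_nn_integral_singleton[symmetric]) measurable
      also have "\<dots> = thick_integral {()} (\<lambda>_. ?n - 1) (?n - 1) (?n - 1) \<epsilon> (kernel_weight ?\<kappa> w v)"
        unfolding thick_integral_def k_def by simp
      also have "\<dots> \<le> ennreal (\<epsilon> * C) * (\<integral>\<^sup>+s. neg_pow (norm s) (?n - 1) * kernel_weight ?\<kappa> w v s \<partial>lborel)"
        by (rule C(2)[OF \<epsilon>]) measurable
      also have "\<dots> = ennreal \<epsilon> * (ennreal C * ?SW)"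
        using \<epsilon> C(1) unfolding stein_weiss_kernel_eq by (simp add: ennreal_mult mult.assoc)
      finally show "(\<integral>\<^sup>+X\<in>thick \<epsilon>. G X \<partial>lborel) \<le> ennreal \<epsilon> * (ennreal C * ?SW)" .
    qed
    also have "\<dots> = ennreal (3 * ?D * sheet_const * C) * ?SW"
      using C(1) sheet_const_nonneg by (subst ennreal_mult) (auto simp: mult.assoc)
    also have "\<dots> \<le> ennreal (3 * ?D * sheet_const * C + 1) * ?SW"
      by (intro mult_right_mono ennreal_leI) auto
    finally have "delta_integral F G \<le> ennreal (3 * ?D * sheet_const * C + 1) * ?SW" .
    moreover have "kernel_J w v = delta_integral F G"
      unfolding kernel_J_def F G_def kernel_weight_def by (simp add: case_prod_unfold diff_diff_eq)
    ultimately show "kernel_J w v \<le> ennreal (3 * ?D * sheet_const * C + 1) * ?SW" by simp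
  qed
qed

text \<open>Monotonicity of \<open>nn_integral\<close> holds for arbitrary integrands, so T is first
  replaced by the measurable Stein--Weiss kernel. The rest transfers the bound from Borel to
  Lebesgue measurable f: Lebesgue measure on pairs completes the product of the Borel ones, and f
  has a Borel representative.\<close>

lemma lebesgue_integral_bound:
  fixes T :: "'a::euclidean_space \<Rightarrow> 'a \<Rightarrow> ennreal" and \<beta> \<kappa> :: real
  assumes \<beta>: "0 < \<beta>" "\<beta> < DIM('a) / 2" and \<kappa>: "\<kappa> = DIM('a) - \<beta>"
    and T: "\<exists>C>0. \<forall>w v. T w v \<le> ennreal C * stein_weiss_kernel \<kappa> (2 * \<beta>) w v"
  shows "\<exists>c::real. \<forall>f :: 'a \<Rightarrow> real.
    f \<in> borel_measurable lebesgue \<longrightarrow> (\<forall>x. 0 \<le> f x) \<longrightarrow> integrable lebesgue (\<lambda>x. \<bar>f x\<bar>\<^sup>2) \<longrightarrow>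
    (\<integral>\<^sup>+(w, v). ennreal (f w) * T w v * ennreal (f v) \<partial>lebesgue)
      \<le> ennreal (c * (LINT x|lebesgue. \<bar>f x\<bar>\<^sup>2))"
proof -
  obtain C1 where C1: "C1 > 0" "\<And>w v. T w v \<le> ennreal C1 * stein_weiss_kernel \<kappa> (2 * \<beta>) w v"
    using T by blast
  let ?S = "stein_weiss_kernel \<kappa> (2 * \<beta>) :: 'a \<Rightarrow> 'a \<Rightarrow> ennreal"
  obtain C2 where C2: "C2 > 0" "\<And>f :: 'a \<Rightarrow> real. f \<in> borel_measurable lborel \<Longrightarrow> (\<And>x. 0 \<le> f x) \<Longrightarrow>
      (\<integral>\<^sup>+(w, v). ennreal (f w) * ?S w v * ennreal (f v) \<partial>(lborel \<Otimes>\<^sub>M lborel))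
        \<le> ennreal C2 * (\<integral>\<^sup>+x. ennreal ((f x)\<^sup>2) \<partial>lborel)"
    by (rule stein_weiss[where 'a='a, OF \<beta> \<kappa>]) (blast intro: that)
  show ?thesis
  proof (intro exI[of _ "C1 * C2"] allI impI)
    fix f :: "'a \<Rightarrow> real"
    assume f: "f \<in> borel_measurable lebesgue" "\<forall>x. 0 \<le> f x" "integrable lebesgue (\<lambda>x. \<bar>f x\<bar>\<^sup>2)"
    obtain f' where f' [measurable]: "f' \<in> borel_measurable lborel" and ae: "AE x in lborel. f x = f' x"
      using completion_ex_borel_measurable_real[OF f(1)] by auto
    \<comment> \<open>The Borel representative may be negative on a null set; its modulus is
      nonnegative everywhere and still equals f almost everywhere.\<close>
    define g where "g x = \<bar>f' x\<bar>" for x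
    have g [measurable]: "g \<in> borel_measurable lborel" unfolding g_def by measurable
    have aeg: "AE x in lborel. f x = g x" using ae
    proof eventually_elim
      fix x assume "f x = f' x"
      then show "f x = g x" using f(2)[rule_format, of x] by (simp add: g_def)
    qed
    then obtain N where N: "{x \<in> space lborel. f x \<noteq> g x} \<subseteq> N" "emeasure lborel N = 0" "N \<in> sets lborel"
      by (rule AE_E)
    \<comment> \<open>The exceptional pairs lie over the null set N in one of the two coordinates,
      and both cylinders are null in the product.\<close>
    have "AE p in (lborel \<Otimes>\<^sub>M lborel). f (fst p) = g (fst p) \<and> f (snd p) = g (snd p)"
    proof (rule AE_I)
      show "{p \<in> space (lborel \<Otimes>\<^sub>M lborel). \<not> (f (fst p) = g (fst p) \<and> f (snd p) = g (snd p))} \<subseteq> N \<times> UNIV \<union> UNIV \<times> N"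
        using N(1) by (auto simp: space_pair_measure)
      have "N \<times> UNIV \<in> null_sets (lborel \<Otimes>\<^sub>M lborel)" "UNIV \<times> N \<in> null_sets (lborel \<Otimes>\<^sub>M lborel)"
        using N(2,3) by (auto simp: null_sets_def lborel.emeasure_pair_measure_Times intro!: pair_measureI)
      then have "N \<times> UNIV \<union> UNIV \<times> N \<in> null_sets (lborel \<Otimes>\<^sub>M lborel)" by (rule null_sets.Un)
      then show "emeasure (lborel \<Otimes>\<^sub>M lborel) (N \<times> UNIV \<union> UNIV \<times> N) = 0" "N \<times> UNIV \<union> UNIV \<times> N \<in> sets (lborel \<Otimes>\<^sub>M lborel)"
        by auto
    qed
    note aep = this
    have "(\<integral>\<^sup>+(w, v). ennreal (f w) * T w v * ennreal (f v) \<partial>lebesgue)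
      \<le> (\<integral>\<^sup>+(w, v). ennreal C1 * (ennreal (f w) * ?S w v * ennreal (f v)) \<partial>lebesgue)"
    proof (rule nn_integral_mono)
      fix p :: "'a \<times> 'a"
      obtain w v where p: "p = (w, v)" by (cases p)
      have "ennreal (f w) * T w v * ennreal (f v) \<le> ennreal (f w) * (ennreal C1 * ?S w v) * ennreal (f v)"
        by (intro mult_right_mono mult_left_mono C1(2)) auto
      also have "\<dots> = ennreal C1 * (ennreal (f w) * ?S w v * ennreal (f v))" by (simp only: mult_ac)
      finally show "(case p of (w, v) \<Rightarrow> ennreal (f w) * T w v * ennreal (f v)) \<le> (case p of (w, v) \<Rightarrow> ennreal C1 * (ennreal (f w) * ?S w v * ennreal (f v)))"
        by (simp add: p)
    qed
    also have "\<dots> = (\<integral>\<^sup>+(w, v). ennreal C1 * (ennreal (f w) * ?S w v * ennreal (f v)) \<partial>(lborel \<Otimes>\<^sub>M lborel))"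
      by (simp only: nn_integral_completion lborel_prod)
    also have "\<dots> = (\<integral>\<^sup>+(w, v). ennreal C1 * (ennreal (g w) * ?S w v * ennreal (g v)) \<partial>(lborel \<Otimes>\<^sub>M lborel))"
    proof (rule nn_integral_cong_AE)
      show "AE p in (lborel \<Otimes>\<^sub>M lborel). (case p of (w, v) \<Rightarrow> ennreal C1 * (ennreal (f w) * ?S w v * ennreal (f v)))
        = (case p of (w, v) \<Rightarrow> ennreal C1 * (ennreal (g w) * ?S w v * ennreal (g v)))"
        using aep by eventually_elim (auto simp: case_prod_unfold)
    qed
    also have "\<dots> = ennreal C1 * (\<integral>\<^sup>+(w, v). ennreal (g w) * ?S w v * ennreal (g v) \<partial>(lborel \<Otimes>\<^sub>M lborel))"
      unfolding case_prod_unfold by (rule nn_integral_cmult) measurable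
    also have "\<dots> \<le> ennreal C1 * (ennreal C2 * (\<integral>\<^sup>+x. ennreal ((g x)\<^sup>2) \<partial>lborel))"
      by (intro mult_left_mono C2(2) g) (auto simp: g_def)
    also have "(\<integral>\<^sup>+x. ennreal ((g x)\<^sup>2) \<partial>lborel) = (\<integral>\<^sup>+x. ennreal (\<bar>f x\<bar>\<^sup>2) \<partial>lebesgue)"
      unfolding nn_integral_completion
      by (rule nn_integral_cong_AE) (use aeg in eventually_elim, simp)
    also have "\<dots> = ennreal (LINT x|lebesgue. \<bar>f x\<bar>\<^sup>2)"
      by (rule nn_integral_eq_integral[OF f(3)]) simp
    also have "ennreal C1 * (ennreal C2 * ennreal (LINT x|lebesgue. \<bar>f x\<bar>\<^sup>2)) = ennreal (C1 * C2 * (LINT x|lebesgue. \<bar>f x\<bar>\<^sup>2))"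
      using C1(1) C2(1) by (simp add: ennreal_mult mult.assoc)
    finally show "(\<integral>\<^sup>+(w, v). ennreal (f w) * T w v * ennreal (f v) \<partial>lebesgue) \<le> ennreal (C1 * C2 * (LINT x|lebesgue. \<bar>f x\<bar>\<^sup>2))" .
  qed
qed

theorem theorem6:
  fixes T :: "real^'n \<Rightarrow> real^'n \<Rightarrow> ennreal"
  assumes "(CARD('n) \<ge> 3 \<and> (\<exists>l. T = kernel_K l))
    \<or> (CARD('n) \<ge> 3 \<and> (\<exists>\<alpha> l. \<alpha> < real CARD('n) - 1 \<and> real CARD('n) - 1 - 2 / real CARD('n) < \<alpha>
          \<and> T = kernel_K_alpha \<alpha> l))
    \<or> (CARD('n) \<ge> 2 \<and> (\<exists>\<alpha>. (real CARD('n) - 1) / 2 < \<alpha> \<and> \<alpha> < real CARD('n) - 1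
          \<and> T = kernel_H \<alpha>))
    \<or> (CARD('n) \<ge> 2 \<and> T = kernel_J)"
  shows "\<exists>c::real. \<forall>f :: real^'n \<Rightarrow> real.
    f \<in> borel_measurable lebesgue \<longrightarrow> (\<forall>x. 0 \<le> f x) \<longrightarrow> integrable lebesgue (\<lambda>x. \<bar>f x\<bar>\<^sup>2) \<longrightarrow>
    (\<integral>\<^sup>+(w, v). ennreal (f w) * T w v * ennreal (f v) \<partial>lebesgue)
      \<le> ennreal (c * (LINT x|lebesgue. \<bar>f x\<bar>\<^sup>2))"
  using assms
proof (elim disjE conjE exE)
  fix l assume n: "CARD('n) \<ge> 3" and T: "T = kernel_K l"
  \<comment> \<open>Here \<beta> = 1, and \<beta> < n/2 amounts to n \<ge> 3.\<close>
  show ?thesis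
    by (rule lebesgue_integral_bound[of 1 "real CARD('n) - 1"]) (use kernel_K_le[OF n] T n in auto)
next
  fix \<alpha> l
  assume n: "CARD('n) \<ge> 3" and \<alpha>: "\<alpha> < real CARD('n) - 1" "real CARD('n) - 1 - 2 / real CARD('n) < \<alpha>"
    and T: "T = kernel_K_alpha \<alpha> l"
  let ?n = "real CARD('n)"
  \<comment> \<open>The lower bound on \<alpha> is equivalent to \<beta> > 0, while the upper bound
    gives \<beta> \<le> 1 < n/2.\<close>
  define \<beta> where "\<beta> = 1 - ?n * (?n - 1 - \<alpha>) / 2"
  have "?n - 1 - \<alpha> < 2 / ?n" using \<alpha> by linarith
  then have "?n * (?n - 1 - \<alpha>) < 2" using n by (simp add: pos_less_divide_eq mult.commute)
  then have "0 < \<beta>" by (simp add: \<beta>_def)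
  moreover have "0 \<le> ?n * (?n - 1 - \<alpha>)" using \<alpha> by (intro mult_nonneg_nonneg) auto
  then have "\<beta> < ?n / 2" using n by (simp add: \<beta>_def)
  ultimately have *: "0 < \<beta>" "\<beta> < ?n / 2" by simp_all
  have "?n * (?n - \<alpha> + 1) / 2 - 1 = ?n - \<beta>" "2 - ?n * (?n - 1 - \<alpha>) = 2 * \<beta>"
    by (simp_all add: \<beta>_def field_simps)
  then have "\<exists>C>0. \<forall>w v. T w v \<le> ennreal C * stein_weiss_kernel (?n - \<beta>) (2 * \<beta>) w v"
    using kernel_K_alpha_le[OF n less_imp_le[OF \<alpha>(1)] \<alpha>(2), of l] by (simp only: T)
  then show ?thesis using * by (intro lebesgue_integral_bound[of \<beta> "?n - \<beta>"]) simp_all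
next
  fix \<alpha>
  assume n: "CARD('n) \<ge> 2" and \<alpha>: "(real CARD('n) - 1) / 2 < \<alpha>" "\<alpha> < real CARD('n) - 1" and T: "T = kernel_H \<alpha>"
  let ?n = "real CARD('n)"
  \<comment> \<open>The upper bound on \<alpha> is equivalent to \<beta> < n/2, and the lower one
    gives \<beta> > 1/2.\<close>
  define \<beta> where "\<beta> = \<alpha> - ?n / 2 + 1"
  have "0 < \<beta>" "\<beta> < ?n / 2" using \<alpha> by (auto simp: \<beta>_def field_simps)
  note * = this
  have "3 * ?n / 2 - 1 - \<alpha> = ?n - \<beta>" "2 * \<alpha> - ?n + 2 = 2 * \<beta>" by (simp_all add: \<beta>_def)
  then have "\<exists>C>0. \<forall>w v. T w v \<le> ennreal C * stein_weiss_kernel (?n - \<beta>) (2 * \<beta>) w v"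
    using kernel_H_le[OF n \<alpha>] by (simp only: T)
  then show ?thesis using * by (intro lebesgue_integral_bound[of \<beta> "?n - \<beta>"]) simp_all
next
  assume n: "CARD('n) \<ge> 2" and T: "T = kernel_J"
  let ?n = "real CARD('n)"
  define \<beta> where "\<beta> = (?n - 1) / 2"
  have "0 < \<beta>" "\<beta> < ?n / 2" using n by (auto simp: \<beta>_def)
  note * = this
  have "(?n + 1) / 2 = ?n - \<beta>" "?n - 1 = 2 * \<beta>" by (simp_all add: \<beta>_def field_simps)
  then have "\<exists>C>0. \<forall>w v. T w v \<le> ennreal C * stein_weiss_kernel (?n - \<beta>) (2 * \<beta>) w v"
    using kernel_J_le[OF n] by (simp only: T)
  then show ?thesis using * by (intro lebesgue_integral_bound[of \<beta> "?n - \<beta>"]) simp_all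
qed

end
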